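(* Let $d\ge1$, $p\in[1,+\infty]$ and $s\ge d/p$ (with $d/p=0$ if $p=+\infty$). Let $C^s_p$ be the closure of $\mathcal{S}'_h\cap\dot{B}^s_{p,\infty}$ in $\dot{B}^s_{p,\infty}$. Then $C^s_p$ is not complemented in $\dot{B}^s_{p,\infty}$: there is no subspace $G\subset\dot{B}^s_{p,\infty}$ such that $\dot{B}^s_{p,\infty}=C^s_p\oplus G$ with continuous projections.
   Context: All function spaces are spaces of complex-valued functions or distributions on $\mathbb{R}^d$; $\mathcal{S}$ is the Schwartz space and $\mathcal{S}'$ the space of tempered distributions. Fix a smooth radial function $\chi:\mathbb{R}^d\to\mathbb{R}$ supported in the ball $B(0,2)$, equal to $1$ in a neighborhood of $B(0,1)$, and such that $r\mapsto\chi(re)$ is nonincreasing on $\mathbb{R}_+$ for every unit vector $e$. Set $\varphi(\xi)=\chi(\xi)-\chi(2\xi)$. For a function $\sigma$, $\sigma(D)$ denotes the Fourier multiplier $f\mapsto\mathcal{F}^{-1}[\sigma(\xi)\widehat f(\xi)]$. The homogeneous dyadic blocks are $\dot\Delta_m=\varphi(2^{-m}D)$, $m\in\mathbb{Z}$. $\mathcal{S}'_h$ is the space of $f\in\mathcal{S}'$ such that $\chi(\lambda\xi)\widehat f(\xi)\to 0$ in $\mathcal{S}'$ as $\lambda\to+\infty$. Let $\mathcal{S}'/\mathcal{P}$ be the quotient of $\mathcal{S}'$ by the space $\mathcal{P}$ of polynomial functions on $\mathbb{R}^d$; the operators $\dot\Delta_m$ annihilate polynomials and hence are well defined on $\mathcal{S}'/\mathcal{P}$.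 The homogeneous Besov space $\dot{B}^s_{p,\infty}$ is the Banach space of those $f\in\mathcal{S}'/\mathcal{P}$ such that $\|f\|_{\dot{B}^s_{p,\infty}}=\sup_{m\in\mathbb{Z}}2^{ms}\|\dot\Delta_m f\|_{L^p}<+\infty$. Since $\mathcal{S}'_h$ contains no nonzero polynomial, the natural map $\mathcal{S}'_h\to\mathcal{S}'/\mathcal{P}$ is injective, and $\mathcal{S}'_h\cap\dot{B}^s_{p,\infty}$ denotes the subspace of those classes in $\dot{B}^s_{p,\infty}$ that have a representative in $\mathcal{S}'_h$. *)

theory Defs
  imports "HOL-Analysis.Analysis" "HOL-Probability.Essential_Supremum"
begin

fun iter_deriv :: "'a::real_normed_vector list \<Rightarrow> ('a \<Rightarrow> 'b::real_normed_vector) \<Rightarrow> 'a \<Rightarrow> 'b" where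
  "iter_deriv [] f = f"
| "iter_deriv (b # bs) f = (\<lambda>x. frechet_derivative (iter_deriv bs f) (at x) b)"

text \<open>Multi-indices are rendered as lists of basis vectors.\<close>

definition smooth :: "('a::euclidean_space \<Rightarrow> 'b::real_normed_vector) \<Rightarrow> bool" where
  "smooth f \<longleftrightarrow> (\<forall>bs \<in> lists Basis. iter_deriv bs f differentiable_on UNIV)"

definition schwartz :: "('a::euclidean_space \<Rightarrow> complex) set" where
  "schwartz = {\<phi>. smooth \<phi> \<and>
     (\<forall>k. \<forall>bs \<in> lists Basis. bounded (range (\<lambda>x. (1 + norm x) ^ k *\<^sub>R iter_deriv bs \<phi> x)))}"

definition schwartz_norm :: "nat \<Rightarrow> ('a::euclidean_space \<Rightarrow> complex) \<Rightarrow> real" where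
  "schwartz_norm k \<phi> = (SUP (x, bs) \<in> UNIV \<times> {bs \<in> lists Basis. length bs \<le> k}.
     (1 + norm x) ^ k * norm (iter_deriv bs \<phi> x))"

text \<open>Functionals are represented by total functions on all of \<open>'a \<Rightarrow> complex\<close>; only their values
  on \<^const>\<open>schwartz\<close> are meaningful.\<close>

type_synonym 'a functional = "('a \<Rightarrow> complex) \<Rightarrow> complex"

definition tempered :: "'a::euclidean_space functional \<Rightarrow> bool" where
  "tempered T \<longleftrightarrow>
     (\<forall>\<phi>\<in>schwartz. \<forall>\<psi>\<in>schwartz. T (\<lambda>x. \<phi> x + \<psi> x) = T \<phi> + T \<psi>) \<and>
     (\<forall>c. \<forall>\<phi>\<in>schwartz. T (\<lambda>x. c * \<phi> x) = c * T \<phi>) \<and>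
     (\<exists>k C. \<forall>\<phi>\<in>schwartz. norm (T \<phi>) \<le> C * schwartz_norm k \<phi>)"

definition represents :: "('a::euclidean_space \<Rightarrow> complex) \<Rightarrow> 'a functional \<Rightarrow> bool" where
  "represents g T \<longleftrightarrow> g \<in> borel_measurable lborel \<and>
     (\<forall>\<phi>\<in>schwartz. integrable lborel (\<lambda>x. g x * \<phi> x) \<and> T \<phi> = (LINT x|lborel. g x * \<phi> x))"

definition fourier :: "('a::euclidean_space \<Rightarrow> complex) \<Rightarrow> 'a \<Rightarrow> complex" where
  "fourier f \<xi> = (LINT x|lborel. exp (- \<i> * of_real (x \<bullet> \<xi>)) * f x)"

definition inv_fourier :: "('a::euclidean_space \<Rightarrow> complex) \<Rightarrow> 'a \<Rightarrow> complex" where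
  "inv_fourier f x =
     of_real (1 / (2 * pi) ^ DIM('a)) * (LINT \<xi>|lborel. exp (\<i> * of_real (x \<bullet> \<xi>)) * f \<xi>)"

definition fourier_dist :: "'a::euclidean_space functional \<Rightarrow> 'a functional" where
  "fourier_dist T = (\<lambda>\<phi>. T (fourier \<phi>))"

definition inv_fourier_dist :: "'a::euclidean_space functional \<Rightarrow> 'a functional" where
  "inv_fourier_dist T = (\<lambda>\<phi>. T (inv_fourier \<phi>))"

definition mult_dist :: "('a \<Rightarrow> real) \<Rightarrow> 'a functional \<Rightarrow> 'a functional" where
  "mult_dist \<sigma> T = (\<lambda>\<phi>. T (\<lambda>\<xi>. of_real (\<sigma> \<xi>) * \<phi> \<xi>))"

definition fourier_multiplier :: "('a::euclidean_space \<Rightarrow> real) \<Rightarrow> 'a functional \<Rightarrow> 'a functional" where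
  "fourier_multiplier \<sigma> T = inv_fourier_dist (mult_dist \<sigma> (fourier_dist T))"

text \<open>Balls are read as closed balls: with open balls, the neighbourhood condition would
  reduce to \<open>chi = 1\<close> on the ball.\<close>

definition dyadic_cutoff :: "('a::euclidean_space \<Rightarrow> real) \<Rightarrow> bool" where
  "dyadic_cutoff chi \<longleftrightarrow>
     smooth chi \<and>
     (\<forall>x y. norm x = norm y \<longrightarrow> chi x = chi y) \<and>
     closure {x. chi x \<noteq> 0} \<subseteq> cball 0 2 \<and>
     (\<exists>U. open U \<and> cball 0 1 \<subseteq> U \<and> (\<forall>x\<in>U. chi x = 1)) \<and>
     (\<forall>e. norm e = 1 \<longrightarrow> antimono_on {0..} (\<lambda>r. chi (r *\<^sub>R e)))"

definition annulus_fn :: "('a::real_vector \<Rightarrow> real) \<Rightarrow> 'a \<Rightarrow> real" where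
  "annulus_fn chi \<xi> = chi \<xi> - chi (2 *\<^sub>R \<xi>)"

definition dyadic_block :: "('a::euclidean_space \<Rightarrow> real) \<Rightarrow> int \<Rightarrow> 'a functional \<Rightarrow> 'a functional" where
  "dyadic_block chi m = fourier_multiplier (\<lambda>\<xi>. annulus_fn chi ((2 powi (- m)) *\<^sub>R \<xi>))"

text \<open>Convergence in the space of tempered distributions is pointwise on Schwartz functions.\<close>

definition S'h :: "('a::euclidean_space \<Rightarrow> real) \<Rightarrow> 'a functional set" where
  "S'h chi = {T. tempered T \<and> (\<forall>\<phi>\<in>schwartz.
     ((\<lambda>t::real. mult_dist (\<lambda>\<xi>. chi (t *\<^sub>R \<xi>)) (fourier_dist T) \<phi>) \<longlongrightarrow> 0) at_top)}"

definition poly_rel :: "'a::euclidean_space functional \<Rightarrow> 'a functional \<Rightarrow> bool" where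
  "poly_rel T U \<longleftrightarrow> tempered T \<and> tempered U \<and>
     (\<exists>P. polynomial_function P \<and> represents P (\<lambda>\<phi>. T \<phi> - U \<phi>))"

lemma represents_add:
  assumes "represents f T" "represents g U"
  shows "represents (\<lambda>x. f x + g x) (\<lambda>\<phi>. T \<phi> + U \<phi>)"
  using assms unfolding represents_def by (auto simp: distrib_right)

lemma represents_cmult:
  assumes "represents f T"
  shows "represents (\<lambda>x. c * f x) (\<lambda>\<phi>. c * T \<phi>)"
  using assms unfolding represents_def by (auto simp: mult.assoc)

lemma represents_0: "represents (\<lambda>x. 0) (\<lambda>\<phi>. 0)"
  unfolding represents_def by simp

lemma polynomial_function_cmult:
  fixes P :: "'a::real_normed_vector \<Rightarrow> complex"
  assumes "polynomial_function P"
  shows "polynomial_function (\<lambda>x. c * P x)"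
  unfolding polynomial_function_def
proof (intro allI impI)
  fix f :: "complex \<Rightarrow> real" assume "bounded_linear f"
  then have "bounded_linear (\<lambda>z. f (c * z))"
    by (rule bounded_linear_compose) (rule bounded_linear_mult_right)
  with assms show "real_polynomial_function (f \<circ> (\<lambda>x. c * P x))"
    unfolding polynomial_function_def by (fastforce simp: o_def)
qed

lemma finite_bounded_lists: "finite {bs \<in> lists (Basis :: 'a::euclidean_space set). length bs \<le> k}"
  using finite_lists_length_le[OF finite_Basis] by (simp add: lists_eq_set conj_commute)

lemma schwartz_norm_bdd:
  fixes \<phi> :: "'a::euclidean_space \<Rightarrow> complex"
  assumes "\<phi> \<in> schwartz"
  shows "bdd_above ((\<lambda>(x, bs). (1 + norm x) ^ k * norm (iter_deriv bs \<phi> x)) `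
           (UNIV \<times> {bs \<in> lists Basis. length bs \<le> l}))"
proof -
  let ?L = "{bs \<in> lists (Basis :: 'a set). length bs \<le> l}"
  let ?f = "\<lambda>bs x. (1 + norm x) ^ k * norm (iter_deriv bs \<phi> x)"
  have "bdd_above (?f bs ` UNIV)" if "bs \<in> ?L" for bs
  proof -
    have "bounded (range (\<lambda>x. (1 + norm x) ^ k *\<^sub>R iter_deriv bs \<phi> x))"
      using assms that unfolding schwartz_def by blast
    then obtain B where "\<And>x. norm ((1 + norm x) ^ k *\<^sub>R iter_deriv bs \<phi> x) \<le> B"
      unfolding bounded_iff by blast
    then have "?f bs x \<le> B" for x
      by (metis abs_of_nonneg add_nonneg_nonneg norm_ge_zero norm_scaleR zero_le_one zero_le_power)
    then show ?thesis by (intro bdd_aboveI2)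
  qed
  then have "bdd_above (\<Union>bs\<in>?L. ?f bs ` UNIV)"
    using finite_bounded_lists[of l, where 'a='a] by simp
  moreover have "(\<lambda>(x, bs). ?f bs x) ` (UNIV \<times> ?L) = (\<Union>bs\<in>?L. ?f bs ` UNIV)"
    by auto
  ultimately show ?thesis by simp
qed

lemma schwartz_norm_nonneg:
  assumes "\<phi> \<in> schwartz"
  shows "0 \<le> schwartz_norm k \<phi>"
proof -
  have "(\<lambda>(x, bs). (1 + norm x) ^ k * norm (iter_deriv bs \<phi> x)) (0, []) \<le> schwartz_norm k \<phi>"
    unfolding schwartz_norm_def by (rule cSUP_upper[OF _ schwartz_norm_bdd[OF assms]]) auto
  then show ?thesis
    by (simp add: order_trans[OF norm_ge_zero])
qed

lemma schwartz_norm_mono: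
  assumes "\<phi> \<in> schwartz" "k \<le> l"
  shows "schwartz_norm k \<phi> \<le> schwartz_norm l \<phi>"
  unfolding schwartz_norm_def
proof (rule cSUP_mono[OF _ schwartz_norm_bdd[OF assms(1)]])
  show "UNIV \<times> {bs \<in> lists Basis. length bs \<le> k} \<noteq> {}"
    by (auto intro: exI[of _ "[]"])
  fix z :: "'a \<times> 'a list"
  assume z: "z \<in> UNIV \<times> {bs \<in> lists Basis. length bs \<le> k}"
  show "\<exists>w\<in>UNIV \<times> {bs \<in> lists Basis. length bs \<le> l}.
     (case z of (x, bs) \<Rightarrow> (1 + norm x) ^ k * norm (iter_deriv bs \<phi> x))
      \<le> (case w of (x, bs) \<Rightarrow> (1 + norm x) ^ l * norm (iter_deriv bs \<phi> x))"
    using z assms(2)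
    by (intro bexI[of _ z]) (auto intro!: mult_right_mono power_increasing)
qed

lemma tempered_0: "tempered (\<lambda>\<phi>. 0)"
proof -
  have "\<forall>\<phi>\<in>schwartz. norm (0::complex) \<le> 0 * schwartz_norm 0 (\<phi> :: 'a \<Rightarrow> complex)"
    by simp
  then show ?thesis unfolding tempered_def by (metis add.right_neutral mult_zero_right)
qed

lemma tempered_add:
  assumes "tempered T" "tempered U"
  shows "tempered (\<lambda>\<phi>. T \<phi> + U \<phi>)"
proof -
  obtain k C where T: "\<And>\<phi>. \<phi> \<in> schwartz \<Longrightarrow> norm (T \<phi>) \<le> C * schwartz_norm k \<phi>"
    using assms(1) unfolding tempered_def by blast
  obtain l D where U: "\<And>\<phi>. \<phi> \<in> schwartz \<Longrightarrow> norm (U \<phi>) \<le> D * schwartz_norm l \<phi>"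
    using assms(2) unfolding tempered_def by blast
  have "norm (T \<phi> + U \<phi>) \<le> (\<bar>C\<bar> + \<bar>D\<bar>) * schwartz_norm (max k l) \<phi>" if "\<phi> \<in> schwartz" for \<phi>
  proof -
    have "C * schwartz_norm k \<phi> \<le> \<bar>C\<bar> * schwartz_norm (max k l) \<phi>"
      using schwartz_norm_mono[OF that, of k "max k l"] schwartz_norm_nonneg[OF that]
      by (intro mult_mono) auto
    moreover have "D * schwartz_norm l \<phi> \<le> \<bar>D\<bar> * schwartz_norm (max k l) \<phi>"
      using schwartz_norm_mono[OF that, of l "max k l"] schwartz_norm_nonneg[OF that]
      by (intro mult_mono) auto
    ultimately show ?thesis
      using T[OF that] U[OF that] norm_triangle_ineq[of "T \<phi>" "U \<phi>"]
      by (simp add: distrib_right)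
  qed
  then have "\<exists>k C. \<forall>\<phi>\<in>schwartz. norm (T \<phi> + U \<phi>) \<le> C * schwartz_norm k \<phi>"
    by blast
  then show ?thesis
    using assms unfolding tempered_def by (simp add: distrib_left)
qed

lemma tempered_cmult:
  assumes "tempered T"
  shows "tempered (\<lambda>\<phi>. c * T \<phi>)"
proof -
  obtain k C where T: "\<And>\<phi>. \<phi> \<in> schwartz \<Longrightarrow> norm (T \<phi>) \<le> C * schwartz_norm k \<phi>"
    using assms unfolding tempered_def by blast
  have "norm (c * T \<phi>) \<le> (norm c * C) * schwartz_norm k \<phi>" if "\<phi> \<in> schwartz" for \<phi>
    using mult_left_mono[OF T[OF that] norm_ge_zero[of c]] by (simp add: norm_mult mult.assoc)
  then have "\<exists>k C. \<forall>\<phi>\<in>schwartz. norm (c * T \<phi>) \<le> C * schwartz_norm k \<phi>"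
    by blast
  then show ?thesis
    using assms unfolding tempered_def by (simp add: distrib_left mult.left_commute)
qed

lemma poly_rel_refl: "tempered T \<Longrightarrow> poly_rel T T"
  unfolding poly_rel_def using represents_0 by auto

lemma poly_rel_add:
  assumes "poly_rel T T'" "poly_rel U U'"
  shows "poly_rel (\<lambda>\<phi>. T \<phi> + U \<phi>) (\<lambda>\<phi>. T' \<phi> + U' \<phi>)"
proof -
  obtain P Q where "polynomial_function P" "represents P (\<lambda>\<phi>. T \<phi> - T' \<phi>)"
    "polynomial_function Q" "represents Q (\<lambda>\<phi>. U \<phi> - U' \<phi>)"
    using assms unfolding poly_rel_def by blast
  then have "polynomial_function (\<lambda>x. P x + Q x)"
    "represents (\<lambda>x. P x + Q x) (\<lambda>\<phi>. (T \<phi> + U \<phi>) - (T' \<phi> + U' \<phi>))"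
    using represents_add[of P "\<lambda>\<phi>. T \<phi> - T' \<phi>" Q "\<lambda>\<phi>. U \<phi> - U' \<phi>"]
    by (auto simp: add_diff_add)
  then show ?thesis using assms tempered_add unfolding poly_rel_def by blast
qed

lemma poly_rel_cmult:
  assumes "poly_rel T T'"
  shows "poly_rel (\<lambda>\<phi>. c * T \<phi>) (\<lambda>\<phi>. c * T' \<phi>)"
proof -
  obtain P where "polynomial_function P" "represents P (\<lambda>\<phi>. T \<phi> - T' \<phi>)"
    using assms unfolding poly_rel_def by blast
  then have "polynomial_function (\<lambda>x. c * P x)"
    "represents (\<lambda>x. c * P x) (\<lambda>\<phi>. c * T \<phi> - c * T' \<phi>)"
    using represents_cmult[of P "\<lambda>\<phi>. T \<phi> - T' \<phi>" c] polynomial_function_cmult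
    by (auto simp: right_diff_distrib)
  then show ?thesis using assms tempered_cmult unfolding poly_rel_def by blast
qed

lemma part_equivp_poly_rel:
  "part_equivp (poly_rel :: 'a::euclidean_space functional \<Rightarrow> _)"
proof (rule part_equivpI)
  show "\<exists>T. poly_rel T T" using poly_rel_refl[OF tempered_0] by blast
  show "symp (poly_rel :: 'a functional \<Rightarrow> _)"
  proof (rule sympI)
    fix T U :: "'a functional" assume TU: "poly_rel T U"
    then obtain P where P: "polynomial_function P" "represents P (\<lambda>\<phi>. T \<phi> - U \<phi>)"
      unfolding poly_rel_def by blast
    have "represents (\<lambda>x. (-1) * P x) (\<lambda>\<phi>. U \<phi> - T \<phi>)"
      using represents_cmult[OF P(2), of "-1"] by simp
    then show "poly_rel U T"
      using TU polynomial_function_cmult[OF P(1), of "-1"] unfolding poly_rel_def by blast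
  qed
  show "transp (poly_rel :: 'a functional \<Rightarrow> _)"
  proof (rule transpI)
    fix T U V :: "'a functional" assume TU: "poly_rel T U" "poly_rel U V"
    then obtain P Q where P: "polynomial_function P" "represents P (\<lambda>\<phi>. T \<phi> - U \<phi>)"
      and Q: "polynomial_function Q" "represents Q (\<lambda>\<phi>. U \<phi> - V \<phi>)"
      unfolding poly_rel_def by blast
    have "represents (\<lambda>x. P x + Q x) (\<lambda>\<phi>. T \<phi> - V \<phi>)"
      using represents_add[OF P(2) Q(2)] by simp
    then show "poly_rel T V"
      using TU polynomial_function_add[OF P(1) Q(1)] unfolding poly_rel_def by blast
  qed
qed

quotient_type (overloaded) 'a tempered_mod_poly =
  "'a::euclidean_space functional" / partial: poly_rel
  morphisms rep_class class_of
  by (rule part_equivp_poly_rel)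

instantiation tempered_mod_poly :: (euclidean_space) ab_group_add
begin

lift_definition zero_tempered_mod_poly :: "'a tempered_mod_poly" is "\<lambda>\<phi>. 0"
  by (rule poly_rel_refl[OF tempered_0])

lift_definition plus_tempered_mod_poly ::
  "'a tempered_mod_poly \<Rightarrow> 'a tempered_mod_poly \<Rightarrow> 'a tempered_mod_poly"
  is "\<lambda>T U \<phi>. T \<phi> + U \<phi>"
  by (rule poly_rel_add)

lift_definition uminus_tempered_mod_poly :: "'a tempered_mod_poly \<Rightarrow> 'a tempered_mod_poly"
  is "\<lambda>T \<phi>. - T \<phi>"
  using poly_rel_cmult[of _ _ "-1"] by simp

definition minus_tempered_mod_poly ::
  "'a tempered_mod_poly \<Rightarrow> 'a tempered_mod_poly \<Rightarrow> 'a tempered_mod_poly"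
  where "minus_tempered_mod_poly F G = F + (- G)"

instance
proof
  fix a b c :: "'a tempered_mod_poly"
  show "a + b + c = a + (b + c)"
    by transfer (auto simp: add.assoc poly_rel_def tempered_add intro!: exI[of _ "\<lambda>_. 0"] represents_0)
  show "a + b = b + a"
    by transfer (auto simp: add.commute poly_rel_def tempered_add intro!: exI[of _ "\<lambda>_. 0"] represents_0)
  show "0 + a = a"
    by transfer simp
  show "- a + a = 0"
    by transfer (simp add: poly_rel_refl tempered_0)
  show "a - b = a + - b"
    by (rule minus_tempered_mod_poly_def)
qed

end

lift_definition scaleC :: "complex \<Rightarrow> 'a::euclidean_space tempered_mod_poly \<Rightarrow> 'a tempered_mod_poly"
  is "\<lambda>c T \<phi>. c * T \<phi>"
  by (rule poly_rel_cmult)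

global_interpretation tmp: vector_space scaleC
proof
  fix a b :: complex and x y :: "'a tempered_mod_poly"
  show "scaleC a (x + y) = scaleC a x + scaleC a y"
    by transfer (simp add: poly_rel_add poly_rel_cmult flip: distrib_left)
  show "scaleC (a + b) x = scaleC a x + scaleC b x"
    by transfer (simp add: poly_rel_cmult flip: distrib_right)
  show "scaleC a (scaleC b x) = scaleC (a * b) x"
    by transfer (simp add: poly_rel_cmult flip: mult.assoc)
  show "scaleC 1 x = x"
    by transfer simp
qed

definition lp_norm :: "ereal \<Rightarrow> ('a::euclidean_space \<Rightarrow> complex) \<Rightarrow> ennreal" where
  "lp_norm p g =
     (if p = \<infinity> then esssup lborel (\<lambda>x. ennreal (norm (g x)))
      else let I = (\<integral>\<^sup>+x. ennreal (norm (g x) powr real_of_ereal p) \<partial>lborel)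
           in if I = \<infinity> then \<infinity> else ennreal (enn2real I powr (1 / real_of_ereal p)))"

text \<open>All functions representing a given distribution agree almost everywhere, so the infimum is
  over at most one value; it is \<open>\<infinity>\<close> if the distribution is not a function.\<close>

definition lp_norm_dist :: "ereal \<Rightarrow> 'a::euclidean_space functional \<Rightarrow> ennreal" where
  "lp_norm_dist p T = (INF g \<in> {g. represents g T}. lp_norm p g)"

text \<open>The dyadic blocks annihilate polynomials, so the choice of representative in
  \<^const>\<open>rep_class\<close> is immaterial.\<close>

definition besov_norm ::
  "('a::euclidean_space \<Rightarrow> real) \<Rightarrow> real \<Rightarrow> ereal \<Rightarrow> 'a tempered_mod_poly \<Rightarrow> ennreal" where
  "besov_norm chi s p F =
     (SUP m. ennreal (2 powr (of_int m * s)) * lp_norm_dist p (dyadic_block chi m (rep_class F)))"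

definition besov ::
  "('a::euclidean_space \<Rightarrow> real) \<Rightarrow> real \<Rightarrow> ereal \<Rightarrow> 'a tempered_mod_poly set" where
  "besov chi s p = {F. besov_norm chi s p F < \<infinity>}"

text \<open>The norm topology, written as in \<open>Metric_space.mtopology\<close>; the latter cannot be used
  without first proving definiteness of the norm.\<close>

definition besov_topology ::
  "('a::euclidean_space \<Rightarrow> real) \<Rightarrow> real \<Rightarrow> ereal \<Rightarrow> 'a tempered_mod_poly topology" where
  "besov_topology chi s p = topology (\<lambda>U. U \<subseteq> besov chi s p \<and>
     (\<forall>F\<in>U. \<exists>r>0. {G \<in> besov chi s p. besov_norm chi s p (G - F) < ennreal r} \<subseteq> U))"

lemma openin_besov_topology:
  "openin (besov_topology chi s p) U \<longleftrightarrow> U \<subseteq> besov chi s p \<and>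
     (\<forall>F\<in>U. \<exists>r>0. {G \<in> besov chi s p. besov_norm chi s p (G - F) < ennreal r} \<subseteq> U)"
proof -
  let ?B = "\<lambda>F r. {G \<in> besov chi s p. besov_norm chi s p (G - F) < ennreal r}"
  let ?open = "\<lambda>U. U \<subseteq> besov chi s p \<and> (\<forall>F\<in>U. \<exists>r>0. ?B F r \<subseteq> U)"
  have "?open (S \<inter> T)" if S: "?open S" and T: "?open T" for S T
  proof (intro conjI ballI)
    show "S \<inter> T \<subseteq> besov chi s p" using S by blast
    fix F assume F: "F \<in> S \<inter> T"
    obtain q where q: "q > 0" "?B F q \<subseteq> S" using S F by blast
    obtain r where r: "r > 0" "?B F r \<subseteq> T" using T F by blast
    have "?B F (min q r) \<subseteq> ?B F q \<inter> ?B F r"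
      by (auto intro: less_le_trans[OF _ ennreal_leI])
    then show "\<exists>r>0. ?B F r \<subseteq> S \<inter> T"
      using q r by (intro exI[of _ "min q r"]) auto
  qed
  moreover have "?open (\<Union>K)" if K: "\<forall>U\<in>K. ?open U" for K
  proof (intro conjI ballI)
    show "\<Union>K \<subseteq> besov chi s p" using K by blast
    fix F assume "F \<in> \<Union>K"
    then obtain U where U: "U \<in> K" "F \<in> U" by blast
    then obtain r where "r > 0" "?B F r \<subseteq> U" using K by blast
    then show "\<exists>r>0. ?B F r \<subseteq> \<Union>K" using U by blast
  qed
  ultimately have "istopology ?open"
    unfolding istopology_def by blast
  then show ?thesis
    unfolding besov_topology_def by (simp add: topology_inverse')
qed

lemma topspace_besov_topology: "topspace (besov_topology chi s p) = besov chi s p"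
proof -
  have "openin (besov_topology chi s p) (besov chi s p)"
    unfolding openin_besov_topology by (auto intro: exI[of _ 1])
  then show ?thesis
    by (meson openin_besov_topology openin_subset openin_topspace subset_antisym)
qed

definition besov_Sh ::
  "('a::euclidean_space \<Rightarrow> real) \<Rightarrow> real \<Rightarrow> ereal \<Rightarrow> 'a tempered_mod_poly set" where
  "besov_Sh chi s p = class_of ` S'h chi \<inter> besov chi s p"

definition besov_closure_Sh ::
  "('a::euclidean_space \<Rightarrow> real) \<Rightarrow> real \<Rightarrow> ereal \<Rightarrow> 'a tempered_mod_poly set" where
  "besov_closure_Sh chi s p = besov_topology chi s p closure_of besov_Sh chi s p"

definition topological_direct_sum ::
  "'a::euclidean_space tempered_mod_poly topology \<Rightarrow> 'a tempered_mod_poly set \<Rightarrow>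
   'a tempered_mod_poly set \<Rightarrow> bool" where
  "topological_direct_sum X C G \<longleftrightarrow>
     (\<forall>F \<in> topspace X. \<exists>!(c, g). c \<in> C \<and> g \<in> G \<and> F = c + g) \<and>
     (\<exists>P Q. continuous_map X X P \<and> continuous_map X X Q \<and>
        (\<forall>c\<in>C. \<forall>g\<in>G. P (c + g) = c \<and> Q (c + g) = g))"

definition complemented_in ::
  "'a::euclidean_space tempered_mod_poly topology \<Rightarrow> 'a tempered_mod_poly set \<Rightarrow> bool" where
  "complemented_in X C \<longleftrightarrow>
     (\<exists>G. tmp.subspace G \<and> G \<subseteq> topspace X \<and> topological_direct_sum X C G)"

end

theory Submission
  imports Defs "HOL-Probability.Characteristic_Functions" "HOL-Probability.Sinc_Integral"
begin

text \<open>
  Let \<open>\<sigma> = s - d/p \<ge> 0\<close>. By Bernstein's inequality the functionals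
  \<open>F \<mapsto> 2\<^bsup>m\<sigma>\<^esup> (\<Delta>\<^sub>m F)(0)\<close>, \<open>m < 0\<close>, are uniformly bounded on the Besov space. On classes with
  a representative in \<open>S'\<^sub>h\<close> they tend to \<open>0\<close> as \<open>m \<rightarrow> -\<infinity>\<close>, hence also on the closure \<open>C\<close>.
  Conversely, a bounded sequence \<open>a\<close> is sent to the class of
  \<open>\<Sum>\<^sub>m a\<^sub>m 2\<^bsup>-m\<sigma>\<^esup> h(2\<^sup>m x)\<close>, where the Fourier transform of \<open>h\<close> lives on a thin annulus seen by exactly one
  dyadic block; modulo polynomials the series can be made convergent by subtracting Taylor polynomials.
  Finitely supported sequences land in \<open>C\<close>, and the functionals above recover a multiple of \<open>a\<close>.
  A continuous projection along \<open>C\<close> would thus make the null sequences complemented in the bounded ones,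
  which is excluded by Whitley's almost disjoint family argument (Phillips--Sobczyk theorem).
\<close>

subsection \<open>Iterated derivatives and Schwartz functions\<close>

text \<open>The plain series cannot converge in general: for m tending to minus infinity the
  coefficients 2^(-m \<sigma>) do not decay, while h(2^m x) tends to h(0) > 0. A Taylor remainder of
  order N + 1 > \<sigma> gains enough powers of 2^m, and the subtracted polynomials disappear in the
  quotient. That the blocks cannot see them rests on one fact: a dyadic block tests a distribution
  only against Fourier transforms of functions vanishing near 0, and these annihilate polynomials.
  The projections of a direct sum come with continuity but with no estimate and no linearity.
  Additivity is recovered from the rule Q (c + g) = g, and a bound from a neighbourhood of 0. The
  final obstruction is one of cardinality: countably many functionals that ignore finite sets can
  detect only countably many members of an almost disjoint family, and there are such families
  indexed by the reals.\<close>

abbreviation partial :: "'a::euclidean_space \<Rightarrow> ('a \<Rightarrow> 'b::real_normed_vector) \<Rightarrow> 'a \<Rightarrow> 'b" where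
  "partial b f \<equiv> \<lambda>x. frechet_derivative f (at x) b"

definition rapidly_decreasing :: "('a::euclidean_space \<Rightarrow> complex) \<Rightarrow> bool" where
  "rapidly_decreasing f \<longleftrightarrow> (\<forall>k. \<exists>C. \<forall>x. (1 + norm x) ^ k * norm (f x) \<le> C)"

definition polynomially_bounded :: "('a::euclidean_space \<Rightarrow> complex) \<Rightarrow> bool" where
  "polynomially_bounded f \<longleftrightarrow> (\<exists>k C. 0 \<le> C \<and> (\<forall>x. norm (f x) \<le> C * (1 + norm x) ^ k))"

text \<open>The multipliers of the Schwartz space, usually written O_M: the growth exponent may
  depend on the derivative.\<close>

definition moderate :: "('a::euclidean_space \<Rightarrow> complex) set" where
  "moderate = {f. smooth f \<and> (\<forall>bs \<in> lists Basis. polynomially_bounded (iter_deriv bs f))}"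

lemma rapidly_decreasing_iff_bounded:
  "rapidly_decreasing f \<longleftrightarrow> (\<forall>k. bounded (range (\<lambda>x. (1 + norm x) ^ k *\<^sub>R f x)))"
  unfolding rapidly_decreasing_def bounded_iff by (auto simp: abs_of_nonneg)

lemma schwartz_iff:
  "f \<in> schwartz \<longleftrightarrow> smooth f \<and> (\<forall>bs \<in> lists Basis. rapidly_decreasing (iter_deriv bs f))"
  unfolding schwartz_def rapidly_decreasing_iff_bounded by auto

lemma partial_eq: "(f has_derivative f') (at x) \<Longrightarrow> partial b f x = f' b"
  using frechet_derivative_at by metis

lemma iter_deriv_append: "iter_deriv (as @ bs) f = iter_deriv as (iter_deriv bs f)"
  by (induction as) auto

lemma iter_deriv_closed:
  assumes "f \<in> X" "\<And>g b. g \<in> X \<Longrightarrow> b \<in> Basis \<Longrightarrow> partial b g \<in> X" "bs \<in> lists Basis"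
  shows "iter_deriv bs f \<in> X"
  using assms(3,1,2) by (induction) auto

text \<open>Spares formulas for iterated derivatives: once a family stable under first partials is
  found, only first-order facts about its members remain to be checked. Products, sums and Fourier
  transforms are treated this way.\<close>

lemma schwartz_coinduct:
  assumes "f \<in> X"
    and "\<And>g. g \<in> X \<Longrightarrow> g differentiable_on UNIV"
    and "\<And>g. g \<in> X \<Longrightarrow> rapidly_decreasing g"
    and "\<And>g b. g \<in> X \<Longrightarrow> b \<in> Basis \<Longrightarrow> partial b g \<in> X"
  shows "f \<in> schwartz"
  using iter_deriv_closed[OF assms(1,4)] assms(2,3) unfolding schwartz_iff smooth_def by blast

lemma moderate_coinduct:
  assumes "f \<in> X"
    and "\<And>g. g \<in> X \<Longrightarrow> g differentiable_on UNIV"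
    and "\<And>g. g \<in> X \<Longrightarrow> polynomially_bounded g"
    and "\<And>g b. g \<in> X \<Longrightarrow> b \<in> Basis \<Longrightarrow> partial b g \<in> X"
  shows "f \<in> moderate"
  using iter_deriv_closed[OF assms(1,4)] assms(2,3) unfolding moderate_def smooth_def by blast

lemma schwartz_differentiable: "f \<in> schwartz \<Longrightarrow> f differentiable (at x)"
  unfolding schwartz_iff smooth_def differentiable_on_def by (auto dest!: bspec[of _ _ "[]"])

lemma moderate_differentiable: "f \<in> moderate \<Longrightarrow> f differentiable (at x)"
  unfolding moderate_def smooth_def differentiable_on_def by (auto dest!: bspec[of _ _ "[]"])

lemma schwartz_rapid: "f \<in> schwartz \<Longrightarrow> rapidly_decreasing f"
  unfolding schwartz_iff by (auto dest!: bspec[of _ _ "[]"])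

lemma moderate_polynomially_bounded: "f \<in> moderate \<Longrightarrow> polynomially_bounded f"
  unfolding moderate_def by (auto dest!: bspec[of _ _ "[]"])

lemma schwartz_partial:
  assumes "f \<in> schwartz" "b \<in> Basis"
  shows "partial b f \<in> schwartz"
proof -
  have "iter_deriv bs (partial b f) = iter_deriv (bs @ [b]) f" for bs
    by (simp add: iter_deriv_append)
  then show ?thesis using assms unfolding schwartz_iff smooth_def by simp
qed

lemma moderate_partial:
  assumes "f \<in> moderate" "b \<in> Basis"
  shows "partial b f \<in> moderate"
proof -
  have "iter_deriv bs (partial b f) = iter_deriv (bs @ [b]) f" for bs
    by (simp add: iter_deriv_append)
  then show ?thesis using assms unfolding moderate_def smooth_def by simp
qed

lemma schwartz_bound:
  assumes "f \<in> schwartz"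
  obtains C where "C \<ge> 0" "\<And>x. (1 + norm x) ^ k * norm (f x) \<le> C"
proof -
  obtain C where C: "\<And>x. (1 + norm x) ^ k * norm (f x) \<le> C"
    using schwartz_rapid[OF assms] unfolding rapidly_decreasing_def by blast
  have "0 \<le> (1 + norm (0::'a)) ^ k * norm (f 0)" by simp
  also have "\<dots> \<le> C" by (rule C)
  finally show ?thesis using that C by blast
qed

lemma rapidly_decreasing_add:
  assumes "rapidly_decreasing f" "rapidly_decreasing g"
  shows "rapidly_decreasing (\<lambda>x. f x + g x)"
  unfolding rapidly_decreasing_def
proof
  fix k
  obtain C D where C: "\<And>x. (1 + norm x) ^ k * norm (f x) \<le> C"
    and D: "\<And>x. (1 + norm x) ^ k * norm (g x) \<le> D"
    using assms unfolding rapidly_decreasing_def by metis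
  have "(1 + norm x) ^ k * norm (f x + g x) \<le> C + D" for x
  proof -
    have "(1 + norm x) ^ k * norm (f x + g x) \<le> (1 + norm x) ^ k * (norm (f x) + norm (g x))"
      by (intro mult_left_mono norm_triangle_ineq) auto
    also have "\<dots> \<le> C + D" using C[of x] D[of x] by (simp add: distrib_left)
    finally show ?thesis .
  qed
  then show "\<exists>C. \<forall>x. (1 + norm x) ^ k * norm (f x + g x) \<le> C" by blast
qed

lemma rapidly_decreasing_mult:
  assumes "rapidly_decreasing f" "polynomially_bounded g"
  shows "rapidly_decreasing (\<lambda>x. f x * g x)"
  unfolding rapidly_decreasing_def
proof
  fix k
  obtain l D where D: "D \<ge> 0" "\<And>x. norm (g x) \<le> D * (1 + norm x) ^ l"
    using assms(2) unfolding polynomially_bounded_def by blast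
  obtain C where C: "\<And>x. (1 + norm x) ^ (k + l) * norm (f x) \<le> C"
    using assms(1) unfolding rapidly_decreasing_def by blast
  have "(1 + norm x) ^ k * norm (f x * g x) \<le> C * D" for x
  proof -
    have "(1 + norm x) ^ k * norm (f x * g x)
        \<le> ((1 + norm x) ^ k * norm (f x)) * (D * (1 + norm x) ^ l)"
      unfolding norm_mult mult.assoc[symmetric] by (intro mult_left_mono[OF D(2), unfolded mult.assoc[symmetric]]) auto
    also have "\<dots> = ((1 + norm x) ^ (k + l) * norm (f x)) * D"
      by (simp add: power_add algebra_simps)
    also have "\<dots> \<le> C * D" using C D(1) by (intro mult_right_mono)
    finally show ?thesis .
  qed
  then show "\<exists>C. \<forall>x. (1 + norm x) ^ k * norm (f x * g x) \<le> C" by blast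
qed

inductive_set schwartz_moderate_span :: "('a::euclidean_space \<Rightarrow> complex) set" where
  prod: "f \<in> schwartz \<Longrightarrow> g \<in> moderate \<Longrightarrow> (\<lambda>x. f x * g x) \<in> schwartz_moderate_span"
| add: "f \<in> schwartz_moderate_span \<Longrightarrow> g \<in> schwartz_moderate_span \<Longrightarrow>
    (\<lambda>x. f x + g x) \<in> schwartz_moderate_span"

text \<open>The span contains the derivatives of its elements by the product rule, so it consists of
  Schwartz functions; this replaces an explicit Leibniz formula.\<close>

lemma schwartz_moderate_span:
  assumes "f \<in> schwartz_moderate_span"
  shows "f differentiable_on UNIV \<and> rapidly_decreasing f \<and>
    (\<forall>b\<in>Basis. partial b f \<in> schwartz_moderate_span)"
  using assms
proof induction
  case (prod f g)
  have "((\<lambda>x. f x * g x) has_derivative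
      (\<lambda>h. f x * frechet_derivative g (at x) h + frechet_derivative f (at x) h * g x)) (at x)" for x
    using schwartz_differentiable[OF prod(1), of x] moderate_differentiable[OF prod(2), of x]
    by (intro has_derivative_mult) (simp_all add: frechet_derivative_works)
  then have D: "(\<lambda>x. f x * g x) differentiable (at x)"
    and P: "partial b (\<lambda>x. f x * g x) x = f x * partial b g x + partial b f x * g x" for x b
    by (auto simp: differentiable_def dest: partial_eq)
  have "partial b (\<lambda>x. f x * g x) \<in> schwartz_moderate_span" if "b \<in> Basis" for b
    unfolding P using that prod schwartz_partial moderate_partial
    by (intro schwartz_moderate_span.intros) auto
  then show ?case
    using D schwartz_rapid[OF prod(1)] moderate_polynomially_bounded[OF prod(2)]
    by (auto simp: differentiable_on_def differentiable_at_withinI rapidly_decreasing_mult)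
next
  case (add f g)
  have d: "f differentiable (at x)" "g differentiable (at x)" for x
    using add.IH by (auto simp: differentiable_on_def)
  then have P: "partial b (\<lambda>x. f x + g x) x = partial b f x + partial b g x" for x b
    by (intro partial_eq has_derivative_add) (simp_all add: frechet_derivative_works)
  show ?case
    unfolding P using add by (auto intro: rapidly_decreasing_add schwartz_moderate_span.add)
qed

lemma schwartz_mult_moderate:
  assumes "f \<in> schwartz" "g \<in> moderate"
  shows "(\<lambda>x. f x * g x) \<in> schwartz"
  by (rule schwartz_coinduct[of _ schwartz_moderate_span])
    (use schwartz_moderate_span schwartz_moderate_span.prod[OF assms] in blast)+

lemma polynomially_boundedI:
  assumes "\<And>x. norm (f x) \<le> C * (1 + norm x) ^ k"
  shows "polynomially_bounded f"
proof -
  have "0 \<le> norm (f 0)" by simp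
  also have "\<dots> \<le> C" using assms[of 0] by simp
  finally show ?thesis using assms unfolding polynomially_bounded_def by blast
qed

lemma schwartz_subset_moderate: "schwartz \<subseteq> moderate"
proof
  fix f :: "'a \<Rightarrow> complex" assume "f \<in> schwartz"
  moreover have "polynomially_bounded g" if "rapidly_decreasing g" for g :: "'a \<Rightarrow> complex"
  proof -
    have "\<exists>C. \<forall>x. (1 + norm x) ^ 0 * norm (g x) \<le> C"
      using that unfolding rapidly_decreasing_def by (rule spec)
    then obtain C where "\<And>x. norm (g x) \<le> C" by auto
    then show ?thesis by (intro polynomially_boundedI[of _ C 0]) simp
  qed
  ultimately show "f \<in> moderate" unfolding moderate_def schwartz_iff by blast
qed

lemma schwartz_mult: "f \<in> schwartz \<Longrightarrow> g \<in> schwartz \<Longrightarrow> (\<lambda>x. f x * g x) \<in> schwartz"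
  using schwartz_mult_moderate schwartz_subset_moderate by blast

lemma moderate_affine_inner: "(\<lambda>x. \<alpha> * of_real (x \<bullet> y) + \<beta>) \<in> moderate"
\<comment> \<open>The vector y is fixed while both coefficients vary: a derivative is a constant,
  that is, a member with \<alpha> = 0.\<close>
proof (rule moderate_coinduct[of _ "range (\<lambda>(\<alpha>, \<beta>) x. \<alpha> * of_real (x \<bullet> y) + \<beta>)"])
  show "(\<lambda>x. \<alpha> * of_real (x \<bullet> y) + \<beta>) \<in> range (\<lambda>(\<alpha>, \<beta>) x. \<alpha> * of_real (x \<bullet> y) + \<beta>)"
    by (auto intro!: image_eqI[of _ _ "(\<alpha>, \<beta>)"])
next
  fix g assume "g \<in> range (\<lambda>(\<alpha>, \<beta>) (x::'a). \<alpha> * complex_of_real (x \<bullet> y) + \<beta>)"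
  then obtain \<alpha> \<beta> where g: "g = (\<lambda>x. \<alpha> * of_real (x \<bullet> y) + \<beta>)" by auto
  have D: "(g has_derivative (\<lambda>h. \<alpha> * of_real (h \<bullet> y))) (at x)" for x
    unfolding g by (auto intro!: derivative_eq_intros)
  then show "g differentiable_on UNIV"
    by (auto simp: differentiable_on_def differentiable_def intro: has_derivative_at_withinI)
  show "partial b g \<in> range (\<lambda>(\<alpha>, \<beta>) (x::'a). \<alpha> * complex_of_real (x \<bullet> y) + \<beta>)" for b
    using partial_eq[OF D] by (auto intro!: image_eqI[of _ _ "(0, \<alpha> * of_real (b \<bullet> y))"])
  have "norm (g x) \<le> (norm \<alpha> * norm y + norm \<beta>) * (1 + norm x) ^ 1" for x
  proof -
    have "norm (g x) \<le> norm \<alpha> * \<bar>x \<bullet> y\<bar> + norm \<beta>"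
      unfolding g by (rule order_trans[OF norm_triangle_ineq]) (simp add: norm_mult)
    also have "\<dots> \<le> norm \<alpha> * (norm x * norm y) + norm \<beta>"
      by (intro add_right_mono mult_left_mono Cauchy_Schwarz_ineq2) auto
    also have "\<dots> \<le> (norm \<alpha> * norm y + norm \<beta>) * (1 + norm x) ^ 1"
      by (simp add: algebra_simps)
    finally show ?thesis .
  qed
  then show "polynomially_bounded g" by (rule polynomially_boundedI)
qed

lemma moderate_inner: "(\<lambda>x. of_real (x \<bullet> y)) \<in> moderate"
  using moderate_affine_inner[of 1 y 0] by simp

lemma moderate_const: "(\<lambda>x. c) \<in> moderate"
  using moderate_affine_inner[of 0 0 c] by simp

lemma schwartz_cmult: "f \<in> schwartz \<Longrightarrow> (\<lambda>x. c * f x) \<in> schwartz"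
  using schwartz_mult_moderate[OF _ moderate_const, of f c] by (simp add: mult.commute)

lemma schwartz_add:
  assumes "f \<in> schwartz" "g \<in> schwartz"
  shows "(\<lambda>x. f x + g x) \<in> schwartz"
proof (rule schwartz_coinduct[of _ schwartz_moderate_span])
  \<comment> \<open>Writing f as f * 1 places the sum in the span, whose derivatives are already
    under control.\<close>
  have "(\<lambda>x. f x * 1 + g x * 1) \<in> schwartz_moderate_span"
    using assms moderate_const by (intro schwartz_moderate_span.intros)
  then show "(\<lambda>x. f x + g x) \<in> schwartz_moderate_span" by simp
qed (use schwartz_moderate_span in blast)+

lemma schwartz_zero: "(\<lambda>x. 0) \<in> (schwartz :: ('a::euclidean_space \<Rightarrow> complex) set)"
  by (rule schwartz_coinduct[of _ "{\<lambda>x. 0}"])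
    (auto simp: rapidly_decreasing_def frechet_derivative_const)

lemma schwartz_sum:
  "(\<And>i. i \<in> I \<Longrightarrow> f i \<in> schwartz) \<Longrightarrow> (\<lambda>x. \<Sum>i\<in>I. f i x) \<in> schwartz"
  by (induction I rule: infinite_finite_induct) (auto intro: schwartz_zero schwartz_add)

lemma partial_affine:
  assumes "f differentiable (at (c *\<^sub>R x + a))"
  shows "((\<lambda>x. f (c *\<^sub>R x + a)) has_derivative
    (\<lambda>h. c *\<^sub>R frechet_derivative f (at (c *\<^sub>R x + a)) h)) (at x)"
proof -
  have "((\<lambda>x. c *\<^sub>R x + a) has_derivative (\<lambda>h. c *\<^sub>R h)) (at x)"
    by (auto intro!: derivative_eq_intros)
  moreover have f: "(f has_derivative frechet_derivative f (at (c *\<^sub>R x + a))) (at (c *\<^sub>R x + a))"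
    using assms by (simp add: frechet_derivative_works)
  ultimately have "((\<lambda>x. f (c *\<^sub>R x + a)) has_derivative
      (\<lambda>h. frechet_derivative f (at (c *\<^sub>R x + a)) (c *\<^sub>R h))) (at x)"
    by (rule has_derivative_compose)
  then show ?thesis
    using linear_cmul[OF has_derivative_linear[OF f]] by simp
qed

lemma iter_deriv_affine:
  assumes "smooth f" "bs \<in> lists Basis"
  shows "iter_deriv bs (\<lambda>x. f (c *\<^sub>R x + a)) = (\<lambda>x. c ^ length bs *\<^sub>R iter_deriv bs f (c *\<^sub>R x + a))"
  using assms(2)
proof induction
  case (Cons b bs)
  let ?g = "iter_deriv bs f"
  have d: "?g differentiable (at x)" for x
    using assms(1) Cons unfolding smooth_def differentiable_on_def by auto
  have "((\<lambda>x. c ^ length bs *\<^sub>R ?g (c *\<^sub>R x + a)) has_derivative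
      (\<lambda>h. c ^ length bs *\<^sub>R c *\<^sub>R frechet_derivative ?g (at (c *\<^sub>R x + a)) h)) (at x)" for x
    by (intro has_derivative_scaleR_right partial_affine d)
  from partial_eq[OF this, where b=b] show ?case
    using Cons.IH by (simp add: mult.commute)
qed simp

lemma smooth_affine:
  assumes "smooth f"
  shows "smooth (\<lambda>x. f (c *\<^sub>R x + a))"
  unfolding smooth_def
proof
  fix bs :: "'a list" assume bs: "bs \<in> lists Basis"
  have d: "iter_deriv bs f differentiable (at x)" for x
    using assms bs unfolding smooth_def differentiable_on_def by auto
  show "iter_deriv bs (\<lambda>x. f (c *\<^sub>R x + a)) differentiable_on UNIV"
    unfolding iter_deriv_affine[OF assms bs] differentiable_on_def differentiable_def
    using has_derivative_scaleR_right[OF partial_affine[OF d]] by fast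
qed

lemma iter_deriv_of_real:
  assumes "smooth f" "bs \<in> lists Basis"
  shows "iter_deriv bs (\<lambda>x. complex_of_real (f x)) = (\<lambda>x. of_real (iter_deriv bs f x))"
  using assms(2)
proof induction
  case (Cons b bs)
  have "(iter_deriv bs f has_derivative frechet_derivative (iter_deriv bs f) (at x)) (at x)" for x
    using assms(1) Cons unfolding smooth_def differentiable_on_def by (auto simp: frechet_derivative_works)
  then have "((\<lambda>x. complex_of_real (iter_deriv bs f x)) has_derivative
      (\<lambda>h. of_real (frechet_derivative (iter_deriv bs f) (at x) h))) (at x)" for x
    by (rule has_derivative_of_real)
  from partial_eq[OF this, where b=b] show ?case
    using Cons.IH by simp
qed simp

lemma smooth_of_real:
  assumes "smooth f"
  shows "smooth (\<lambda>x. complex_of_real (f x))"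
  unfolding smooth_def
proof
  fix bs :: "'a list" assume bs: "bs \<in> lists Basis"
  have "(iter_deriv bs f has_derivative frechet_derivative (iter_deriv bs f) (at x)) (at x)" for x
    using assms(1) bs unfolding smooth_def differentiable_on_def by (auto simp: frechet_derivative_works)
  then have "((\<lambda>x. complex_of_real (iter_deriv bs f x)) has_derivative
      (\<lambda>h. of_real (frechet_derivative (iter_deriv bs f) (at x) h))) (at x)" for x
    by (rule has_derivative_of_real)
  then show "iter_deriv bs (\<lambda>x. complex_of_real (f x)) differentiable_on UNIV"
    unfolding iter_deriv_of_real[OF assms bs] differentiable_on_def differentiable_def by fast
qed

text \<open>Derivatives are local, and the strict inequality describes an open set.\<close>

lemma iter_deriv_zero_outside:
  fixes f :: "'a::euclidean_space \<Rightarrow> 'b::real_normed_vector"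
  assumes "\<And>x. r < norm x \<Longrightarrow> f x = 0" "r < norm x"
  shows "iter_deriv bs f x = 0"
  using assms(2)
proof (induction bs arbitrary: x)
  case (Cons b bs)
  have "open {y. r < norm y}" by (intro open_Collect_less continuous_intros)
  then have "(iter_deriv bs f has_derivative (\<lambda>h. 0)) (at x)"
    by (rule has_derivative_transform_within_open[OF has_derivative_const[of 0]]) (use Cons in auto)
  from partial_eq[OF this] show ?case by simp
qed (use assms in auto)

lemma schwartz_compact_support:
  fixes f :: "'a::euclidean_space \<Rightarrow> complex"
  assumes "smooth f" "\<And>x. r < norm x \<Longrightarrow> f x = 0"
  shows "f \<in> schwartz"
  unfolding schwartz_iff rapidly_decreasing_def
proof (intro conjI ballI allI)
  fix bs :: "'a list" and k assume "bs \<in> lists Basis"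
  then have c: "continuous_on UNIV (iter_deriv bs f)"
    using assms(1) by (auto simp: smooth_def differentiable_imp_continuous_on)
  let ?g = "\<lambda>x. (1 + norm x) ^ k * norm (iter_deriv bs f x)"
  have "compact (?g ` cball 0 r)"
    by (intro compact_continuous_image continuous_intros continuous_on_subset[OF c]) auto
  then have "bounded (?g ` cball 0 r)" by (rule compact_imp_bounded)
  then obtain B where "\<And>y. y \<in> ?g ` cball 0 r \<Longrightarrow> norm y \<le> B"
    unfolding bounded_iff by blast
  then have B: "norm x \<le> r \<Longrightarrow> ?g x \<le> B" for x by fastforce
  have "?g x \<le> max B 0" for x
    using B[of x] iter_deriv_zero_outside[where f = f and bs = bs and r = r and x = x, OF assms(2)] by (cases "norm x \<le> r") auto
  then show "\<exists>C. \<forall>x. ?g x \<le> C" by blast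
qed fact

lemma schwartz_affine:
  fixes f :: "'a::euclidean_space \<Rightarrow> complex"
  assumes f: "f \<in> schwartz" and c: "c \<noteq> 0"
  shows "(\<lambda>x. f (c *\<^sub>R x + a)) \<in> schwartz"
  unfolding schwartz_iff rapidly_decreasing_def
proof (intro conjI ballI allI)
  have s: "smooth f" using f by (simp add: schwartz_iff)
  then show "smooth (\<lambda>x. f (c *\<^sub>R x + a))" by (rule smooth_affine)
  fix bs :: "'a list" and k assume bs: "bs \<in> lists Basis"
  obtain C where C: "\<And>x. (1 + norm x) ^ k * norm (iter_deriv bs f x) \<le> C"
    using f bs unfolding schwartz_iff rapidly_decreasing_def by blast
  \<comment> \<open>Compares the weights at x and at c x + a: the factor 1 + 1/|c| pays for the
    dilation, 1 + norm a for the shift.\<close>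
  define K where "K = (1 + norm a) * (1 + 1 / \<bar>c\<bar>)"
  have K: "1 + norm x \<le> K * (1 + norm (c *\<^sub>R x + a))" for x
  proof -
    have "norm (c *\<^sub>R x) \<le> norm (c *\<^sub>R x + a) + norm a"
      using norm_triangle_ineq4[of "c *\<^sub>R x + a" a] by simp
    then have "norm x \<le> (norm (c *\<^sub>R x + a) + norm a) / \<bar>c\<bar>"
      using c by (simp add: field_simps)
    then have "1 + norm x \<le> 1 + (norm (c *\<^sub>R x + a) + norm a) / \<bar>c\<bar>" by simp
    also have "\<dots> \<le> (1 + 1 / \<bar>c\<bar>) * (1 + norm (c *\<^sub>R x + a) + norm a)"
      using c by (simp add: field_simps)
    also have "\<dots> \<le> (1 + 1 / \<bar>c\<bar>) * ((1 + norm a) * (1 + norm (c *\<^sub>R x + a)))"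
      by (intro mult_left_mono) (auto simp: algebra_simps)
    finally show ?thesis by (simp add: K_def mult_ac)
  qed
  have K0: "K \<ge> 0" by (simp add: K_def)
  have "(1 + norm x) ^ k * norm (iter_deriv bs (\<lambda>x. f (c *\<^sub>R x + a)) x)
      \<le> K ^ k * \<bar>c\<bar> ^ length bs * C" for x
  proof -
    have "(1 + norm x) ^ k * norm (iter_deriv bs (\<lambda>x. f (c *\<^sub>R x + a)) x)
        \<le> (K * (1 + norm (c *\<^sub>R x + a))) ^ k * (\<bar>c\<bar> ^ length bs * norm (iter_deriv bs f (c *\<^sub>R x + a)))"
      unfolding iter_deriv_affine[OF s bs] norm_scaleR power_abs
      by (intro mult_right_mono power_mono K) auto
    also have "\<dots> = K ^ k * \<bar>c\<bar> ^ length bs *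
        ((1 + norm (c *\<^sub>R x + a)) ^ k * norm (iter_deriv bs f (c *\<^sub>R x + a)))"
      by (simp add: power_mult_distrib mult_ac)
    also have "\<dots> \<le> K ^ k * \<bar>c\<bar> ^ length bs * C"
      using K0 by (intro mult_left_mono C) auto
    finally show ?thesis .
  qed
  then show "\<exists>C. \<forall>x. (1 + norm x) ^ k * norm (iter_deriv bs (\<lambda>x. f (c *\<^sub>R x + a)) x) \<le> C"
    by blast
qed

lemma schwartz_continuous: "f \<in> schwartz \<Longrightarrow> continuous_on S f"
  by (meson continuous_at_imp_continuous_on differentiable_imp_continuous_within schwartz_differentiable)

lemma schwartz_measurable: "f \<in> schwartz \<Longrightarrow> f \<in> borel_measurable borel"
  by (intro borel_measurable_continuous_onI schwartz_continuous)

subsection \<open>Integration on Euclidean space\<close>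

text \<open>\<open>lborel\<close> is the image of a product of one-dimensional Lebesgue measures
  under the coordinate map. This serves \<open>weight\<close> and the Gaussian.\<close>

lemma
  fixes f :: "'a::euclidean_space \<Rightarrow> real \<Rightarrow> 'b::{real_normed_field, banach, second_countable_topology}"
  assumes f: "\<And>b. b \<in> Basis \<Longrightarrow> integrable lborel (f b)"
  shows integrable_lborel_prod: "integrable lborel (\<lambda>x::'a. \<Prod>b\<in>Basis. f b (x \<bullet> b))" (is ?I)
    and integral_lborel_prod:
      "(LINT x|lborel. (\<Prod>b\<in>Basis. f b ((x::'a) \<bullet> b))) = (\<Prod>b\<in>Basis. (LINT t|lborel. f b t))" (is ?E)
proof -
  interpret product_sigma_finite "\<lambda>_::'a. lborel :: real measure" ..
  let ?P = "\<Pi>\<^sub>M b\<in>Basis. (lborel :: real measure)"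
  let ?g = "\<lambda>v. \<Sum>b\<in>Basis. v b *\<^sub>R (b::'a)"
  have [measurable]: "?g \<in> ?P \<rightarrow>\<^sub>M borel" by measurable
  have [measurable]: "b \<in> Basis \<Longrightarrow> f b \<in> borel_measurable borel" for b
    using borel_measurable_integrable[OF f] by simp
  have m: "(\<lambda>x::'a. \<Prod>b\<in>Basis. f b (x \<bullet> b)) \<in> borel_measurable borel" by measurable
  have e: "(\<Prod>b\<in>Basis. f b (?g v \<bullet> b)) = (\<Prod>b\<in>Basis. f b (v b))" for v
    by (intro prod.cong) (simp_all add: inner_sum_left_Basis)
  show ?I
    by (subst lborel_eq) (simp add: integrable_distr_eq m e product_integrable_prod f)
  show ?E
    by (subst lborel_eq) (simp add: integral_distr m e product_integral_prod f)
qed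

text \<open>Two powers of 1 + norm x per dimension leave one factor 1/(1 + t^2) for each coordinate,
  and the product of these is integrable. Integrability of rapidly decreasing functions is reduced
  to this majorant.\<close>

definition weight :: "'a::euclidean_space \<Rightarrow> real" where
  "weight x = inverse ((1 + norm x) ^ (2 * DIM('a)))"

lemma weight_nonneg: "0 \<le> weight x"
  by (simp add: weight_def)

lemma integrable_weight: "integrable lborel (weight :: 'a::euclidean_space \<Rightarrow> real)"
proof (rule Bochner_Integration.integrable_bound)
  have "integrable lborel (\<lambda>t::real. inverse (1 + t\<^sup>2))"
    using integrable_inverse_1_plus_square by (simp add: set_integrable_def)
  then show "integrable lborel (\<lambda>x::'a. \<Prod>b\<in>Basis. inverse (1 + (x \<bullet> b)\<^sup>2))"
    by (intro integrable_lborel_prod)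
  show "weight \<in> borel_measurable (lborel :: 'a measure)"
    unfolding weight_def[abs_def] by measurable
  have "norm (weight x) \<le> norm (\<Prod>b\<in>Basis. inverse (1 + (x \<bullet> b)\<^sup>2))" for x :: 'a
  proof -
    have "(\<Prod>b\<in>Basis. 1 + (x \<bullet> b)\<^sup>2) \<le> (\<Prod>b\<in>(Basis::'a set). (1 + norm x)\<^sup>2)"
    proof (intro prod_mono conjI)
      fix b :: 'a assume "b \<in> Basis"
      then have "\<bar>x \<bullet> b\<bar> \<le> norm x" by (rule Basis_le_norm)
      then have "(x \<bullet> b)\<^sup>2 \<le> (norm x)\<^sup>2" using abs_le_square_iff[of "x \<bullet> b" "norm x"] by simp
      then show "1 + (x \<bullet> b)\<^sup>2 \<le> (1 + norm x)\<^sup>2"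
        by (auto simp: power2_sum intro: add_increasing2)
    qed auto
    also have "\<dots> = (1 + norm x) ^ (2 * DIM('a))"
      by (simp add: power_mult)
    finally have le: "(\<Prod>b\<in>Basis. 1 + (x \<bullet> b)\<^sup>2) \<le> (1 + norm x) ^ (2 * DIM('a))" .
    have pos: "0 < (\<Prod>b\<in>Basis. 1 + (x \<bullet> b)\<^sup>2)"
      by (intro prod_pos) (auto intro: add_pos_nonneg)
    have "weight x \<le> inverse (\<Prod>b\<in>Basis. 1 + (x \<bullet> b)\<^sup>2)"
      unfolding weight_def by (rule le_imp_inverse_le[OF le pos])
    also have "\<dots> = (\<Prod>b\<in>Basis. inverse (1 + (x \<bullet> b)\<^sup>2))"
      using prod_inversef[of "\<lambda>b. 1 + (x \<bullet> b)\<^sup>2" Basis] by (simp add: o_def)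
    finally show ?thesis using weight_nonneg[of x] by simp
  qed
  then show "AE x in lborel. norm (weight x) \<le> norm (\<Prod>b\<in>Basis. inverse (1 + ((x::'a) \<bullet> b)\<^sup>2))"
    by simp
qed

lemma weight_bound:
  fixes f :: "'a::euclidean_space \<Rightarrow> complex"
  assumes "(1 + norm x) ^ (2 * DIM('a)) * norm (f x) \<le> C"
  shows "norm (f x) \<le> C * weight x"
proof -
  have "(1 + norm x) ^ (2 * DIM('a)) > 0" by (simp add: add_pos_nonneg)
  then show ?thesis using assms by (simp add: weight_def field_simps)
qed

lemma integrable_weight_bound:
  fixes f :: "'a::euclidean_space \<Rightarrow> complex"
  assumes "f \<in> borel_measurable borel" "\<And>x. norm (f x) \<le> C * weight x"
  shows "integrable lborel f"
proof (rule Bochner_Integration.integrable_bound)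
  show "integrable lborel (\<lambda>x::'a. C * weight x)"
    by (intro integrable_mult_right integrable_weight)
  show "AE x in lborel. norm (f x) \<le> norm (C * weight x)"
    using order_trans[OF assms(2) abs_ge_self] by simp
qed (use assms(1) in simp)

lemma rapidly_decreasing_weight:
  fixes f :: "'a::euclidean_space \<Rightarrow> complex"
  assumes "rapidly_decreasing f"
  obtains C where "0 \<le> C" "\<And>x. norm (f x) \<le> C * weight x"
proof -
  obtain C where C: "\<And>x. (1 + norm x) ^ (2 * DIM('a)) * norm (f x) \<le> C"
    using assms unfolding rapidly_decreasing_def by metis
  have "0 \<le> (1 + norm (0::'a)) ^ (2 * DIM('a)) * norm (f 0)" by simp
  also have "\<dots> \<le> C" by (rule C)
  finally show ?thesis by (rule that) (rule weight_bound[OF C])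
qed

lemma integrable_rapidly_decreasing:
  "f \<in> borel_measurable borel \<Longrightarrow> rapidly_decreasing f \<Longrightarrow> integrable lborel f"
  by (metis rapidly_decreasing_weight integrable_weight_bound)

lemma integrable_schwartz: "f \<in> schwartz \<Longrightarrow> integrable lborel f"
  by (intro integrable_rapidly_decreasing schwartz_measurable schwartz_rapid)

lemma integrable_poly_schwartz:
  assumes "g \<in> borel_measurable borel" "polynomially_bounded g" "f \<in> schwartz"
  shows "integrable lborel (\<lambda>x. g x * f x)"
  using integrable_rapidly_decreasing[OF _ rapidly_decreasing_mult[OF schwartz_rapid[OF assms(3)] assms(2)]]
    schwartz_measurable[OF assms(3)] assms(1) by (simp add: mult.commute)

lemma integral_lborel_affine:
  fixes f :: "'a::euclidean_space \<Rightarrow> 'b::{banach, second_countable_topology}"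
  assumes c: "c \<noteq> 0" and [measurable]: "f \<in> borel_measurable borel"
  shows "(LINT x|lborel. f x) = \<bar>c\<bar> ^ DIM('a) *\<^sub>R (LINT x|lborel. f (a + c *\<^sub>R x))"
proof -
  have e: "lborel = density (distr lborel borel (\<lambda>x::'a. a + c *\<^sub>R x)) (\<lambda>_. ennreal (\<bar>c\<bar> ^ DIM('a)))"
    using lborel_affine[OF c, of a] by simp
  show ?thesis
    by (subst (1) e) (simp add: integral_density integral_distr)
qed

lemma integrable_pair_dominated:
  fixes F :: "'a::euclidean_space \<times> 'b::euclidean_space \<Rightarrow> complex"
  assumes [measurable]: "F \<in> borel_measurable (lborel \<Otimes>\<^sub>M lborel)"
    and A: "integrable lborel A" and B: "integrable lborel B"
    and le: "\<And>x y. norm (F (x, y)) \<le> A x * B y"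
  shows "integrable (lborel \<Otimes>\<^sub>M lborel) F"
proof (rule lborel_pair.Fubini_integrable)
  have i: "integrable lborel (\<lambda>y. F (x, y))" for x
  proof (rule Bochner_Integration.integrable_bound)
    show "integrable lborel (\<lambda>y. A x * B y)" using B by simp
    show "AE y in lborel. norm (F (x, y)) \<le> norm (A x * B y)"
      using order_trans[OF le abs_ge_self] by simp
  qed simp
  then show "AE x in lborel. integrable lborel (\<lambda>y. F (x, y))" by simp
  show "integrable lborel (\<lambda>x. LINT y|lborel. norm (F (x, y)))"
  proof (rule Bochner_Integration.integrable_bound)
    show "integrable lborel (\<lambda>x. A x * (LINT y|lborel. B y))" using A by simp
    have "norm (LINT y|lborel. norm (F (x, y))) \<le> norm (A x * (LINT y|lborel. B y))" for x
    proof -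
      have "(LINT y|lborel. norm (F (x, y))) \<le> (LINT y|lborel. A x * B y)"
        using i[of x] B le by (intro integral_mono) auto
      then show ?thesis by simp
    qed
    then show "AE x in lborel. norm (LINT y|lborel. norm (F (x, y))) \<le> norm (A x * (LINT y|lborel. B y))"
      by simp
  qed measurable
qed fact

subsection \<open>The Fourier transform on Schwartz functions\<close>

lemma norm_exp_ii [simp]: "cmod (exp (- (\<i> * complex_of_real t))) = 1"
  by (simp add: norm_exp_eq_Re)

lemma integrable_fourier:
  fixes f :: "'a::euclidean_space \<Rightarrow> complex"
  assumes "integrable lborel f"
  shows "integrable lborel (\<lambda>x. exp (- \<i> * of_real (x \<bullet> \<xi>)) * f x)"
  by (rule Bochner_Integration.integrable_bound[OF assms])
    (use borel_measurable_integrable[OF assms] in \<open>auto simp: norm_mult\<close>)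

lemma fourier_add:
  "integrable lborel f \<Longrightarrow> integrable lborel g \<Longrightarrow>
    fourier (\<lambda>x. f x + g x) \<xi> = fourier f \<xi> + fourier g \<xi>"
  unfolding fourier_def distrib_left
  by (intro Bochner_Integration.integral_add integrable_fourier)

lemma fourier_cmult: "fourier (\<lambda>x. c * f x) \<xi> = c * fourier f \<xi>"
  unfolding fourier_def by (simp add: mult.left_commute)

lemma fourier_affine:
  fixes f :: "'a::euclidean_space \<Rightarrow> complex"
  assumes c: "c \<noteq> 0" and [measurable]: "f \<in> borel_measurable borel"
  shows "fourier (\<lambda>x. f (c *\<^sub>R x + a)) \<xi> = (1 / \<bar>c\<bar> ^ DIM('a)) *\<^sub>R
    (exp (\<i> * of_real (a \<bullet> \<xi> / c)) * fourier f (\<xi> /\<^sub>R c))"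
proof -
  let ?h = "\<lambda>y. exp (\<i> * of_real (a \<bullet> \<xi> / c)) * (exp (- \<i> * of_real (y \<bullet> (\<xi> /\<^sub>R c))) * f y)"
  have "exp (- \<i> * of_real (x \<bullet> \<xi>)) * f (c *\<^sub>R x + a) = ?h (a + c *\<^sub>R x)" for x
  proof -
    have "\<i> * of_real (a \<bullet> \<xi> / c) + - \<i> * of_real ((a + c *\<^sub>R x) \<bullet> (\<xi> /\<^sub>R c)) = - \<i> * of_real (x \<bullet> \<xi>)"
      using c by (simp add: inner_add_left inner_left_distrib field_simps)
    then show ?thesis unfolding mult.assoc[symmetric] exp_add[symmetric] by (simp add: add.commute)
  qed
  then have "fourier (\<lambda>x. f (c *\<^sub>R x + a)) \<xi> = (LINT x|lborel. ?h (a + c *\<^sub>R x))"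
    by (simp add: fourier_def)
  also have "\<dots> = (1 / \<bar>c\<bar> ^ DIM('a)) *\<^sub>R (LINT y|lborel. ?h y)"
    using c by (subst integral_lborel_affine[OF c, of ?h a]) auto
  finally show ?thesis by (simp add: fourier_def)
qed

lemma inv_fourier_eq:
  "inv_fourier f (x::'a::euclidean_space) = of_real (1 / (2 * pi) ^ DIM('a)) * fourier f (- x)"
  unfolding inv_fourier_def fourier_def by (simp add: inner_commute)

text \<open>Differentiation under the integral with an explicit error: the second-order bound on
  e^(it) - 1 - it integrates to the second absolute moment of f times |h|^2, which is
  o(|h|).\<close>

lemma fourier_has_derivative:
  fixes f :: "'a::euclidean_space \<Rightarrow> complex"
  assumes m [measurable]: "f \<in> borel_measurable borel" and r: "rapidly_decreasing f"
  shows "(fourier f has_derivative (\<lambda>h. fourier (\<lambda>y. - \<i> * of_real (y \<bullet> h) * f y) \<xi>)) (at \<xi>)"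
proof -
  let ?D = "\<lambda>h. fourier (\<lambda>y. - \<i> * of_real (y \<bullet> h) * f y) \<xi>"
  have rm: "rapidly_decreasing (\<lambda>y. - \<i> * of_real (y \<bullet> h) * f y)" for h
  proof -
    have "polynomially_bounded (\<lambda>y. - \<i> * of_real (y \<bullet> h))"
      using moderate_polynomially_bounded[OF moderate_affine_inner[of "- \<i>" h 0]] by simp
    from rapidly_decreasing_mult[OF r this] show ?thesis by (simp add: mult.commute)
  qed
  have i0: "integrable lborel f" by (rule integrable_rapidly_decreasing[OF m r])
  have i1: "integrable lborel (\<lambda>y. - \<i> * of_real (y \<bullet> h) * f y)" for h
    by (rule integrable_rapidly_decreasing[OF _ rm]) simp
  have "linear ?D"
  proof (rule linearI)
    fix h h' :: 'a and c :: real
    have "(\<lambda>y. - \<i> * complex_of_real (y \<bullet> (h + h')) * f y) =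
        (\<lambda>y. - \<i> * of_real (y \<bullet> h) * f y + - \<i> * of_real (y \<bullet> h') * f y)"
      by (simp add: inner_add_right algebra_simps)
    then show "?D (h + h') = ?D h + ?D h'" using fourier_add[OF i1 i1] by simp
    have "(\<lambda>y. - \<i> * complex_of_real (y \<bullet> (c *\<^sub>R h)) * f y) =
        (\<lambda>y. of_real c * (- \<i> * of_real (y \<bullet> h) * f y))"
      by (simp add: algebra_simps)
    then show "?D (c *\<^sub>R h) = c *\<^sub>R ?D h" by (simp only: fourier_cmult scaleR_conv_of_real)
  qed
  then have bl: "bounded_linear ?D" by (rule linear_conv_bounded_linear[THEN iffD1])
  have pb: "polynomially_bounded (\<lambda>y::'a. complex_of_real ((norm y)\<^sup>2))"
    by (rule polynomially_boundedI[of _ 1 2]) (simp add: power2_sum norm_power)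
  have i2: "integrable lborel (\<lambda>y. f y * of_real ((norm y)\<^sup>2))"
    by (rule integrable_rapidly_decreasing[OF _ rapidly_decreasing_mult[OF r pb]]) simp
  define K where "K = (LINT y|lborel. norm (f y * of_real ((norm y)\<^sup>2)))"
  have bound: "norm (fourier f (\<xi> + h) - fourier f \<xi> - ?D h) \<le> K * (norm h)\<^sup>2" for h
  proof -
    let ?e = "\<lambda>y. exp (- \<i> * complex_of_real (y \<bullet> \<xi>))"
    let ?r = "\<lambda>y. exp (- \<i> * complex_of_real (y \<bullet> (\<xi> + h))) * f y - ?e y * f y - ?e y * (- \<i> * of_real (y \<bullet> h) * f y)"
    have "norm (?r y) \<le> norm (f y * of_real ((norm y)\<^sup>2)) * (norm h)\<^sup>2" for y
    proof -
      let ?t = "- (y \<bullet> h)"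
      have "?r y = ?e y * f y * (iexp ?t - (1 + \<i> * of_real ?t))"
        by (simp add: inner_add_right exp_add[symmetric] algebra_simps)
      then have "norm (?r y) = norm (f y) * norm (iexp ?t - (1 + \<i> * of_real ?t))"
        by (simp add: norm_mult)
      also have "\<dots> \<le> norm (f y) * \<bar>?t\<bar> ^ 2"
      proof (rule mult_left_mono)
        have "norm (iexp ?t - (1 + \<i> * of_real ?t)) \<le> \<bar>?t\<bar> ^ 2 / 2"
          using iexp_approx1[of ?t 1] by (simp add: numeral_2_eq_2)
        then show "norm (iexp ?t - (1 + \<i> * of_real ?t)) \<le> \<bar>?t\<bar> ^ 2"
          using zero_le_power2[of "\<bar>?t\<bar>"] by linarith
      qed simp
      also have "\<dots> \<le> norm (f y) * (norm y * norm h) ^ 2"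
        using Cauchy_Schwarz_ineq2[of y h] by (intro mult_left_mono power_mono) auto
      finally show ?thesis by (simp add: norm_mult power_mult_distrib norm_power mult.assoc)
    qed
    then have *: "\<And>y. norm (?r y) \<le> norm (norm (f y * of_real ((norm y)\<^sup>2)) * (norm h)\<^sup>2)" by simp
    have ir: "integrable lborel ?r"
      by (intro Bochner_Integration.integrable_diff integrable_fourier i0 i1)
    have "(LINT y|lborel. ?r y) = (LINT y|lborel. exp (- \<i> * complex_of_real (y \<bullet> (\<xi> + h))) * f y - ?e y * f y) - ?D h"
      unfolding fourier_def
      by (intro Bochner_Integration.integral_diff Bochner_Integration.integrable_diff integrable_fourier i0 i1)
    moreover have "(LINT y|lborel. exp (- \<i> * complex_of_real (y \<bullet> (\<xi> + h))) * f y - ?e y * f y)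
        = fourier f (\<xi> + h) - fourier f \<xi>"
      unfolding fourier_def by (intro Bochner_Integration.integral_diff integrable_fourier i0)
    ultimately have "norm (fourier f (\<xi> + h) - fourier f \<xi> - ?D h) \<le> (LINT y|lborel. norm (?r y))"
      using integral_norm_bound[of lborel ?r] by simp
    also have "(LINT y|lborel. norm (?r y)) \<le> (LINT y|lborel. norm (f y * of_real ((norm y)\<^sup>2)) * (norm h)\<^sup>2)"
      using ir i2 * by (intro integral_mono) auto
    finally show ?thesis by (simp add: K_def)
  qed
  show ?thesis
    unfolding has_derivative_at
  proof (intro conjI bl)
    show "(\<lambda>h. norm (fourier f (\<xi> + h) - fourier f \<xi> - ?D h) / norm h) \<midarrow>0\<rightarrow> 0"
    proof (rule tendsto_sandwich[of "\<lambda>_. 0" _ _ "\<lambda>h. K * norm h"])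
      show "\<forall>\<^sub>F h in at 0. norm (fourier f (\<xi> + h) - fourier f \<xi> - ?D h) / norm h \<le> K * norm h"
        using bound by (intro eventually_at_filter[THEN iffD2] always_eventually)
          (auto simp: divide_le_eq power2_eq_square mult.assoc)
      show "(\<lambda>h. K * norm h) \<midarrow>0\<rightarrow> 0" by (auto intro!: tendsto_eq_intros)
    qed auto
  qed
qed

lemma fourier_coordinate:
  fixes f :: "'a::euclidean_space \<Rightarrow> complex"
  assumes "f \<in> schwartz"
  shows "(\<lambda>y. - \<i> * of_real (y \<bullet> b) * f y) \<in> schwartz"
  using schwartz_mult_moderate[OF assms moderate_affine_inner[of "- \<i>" b 0]]
  by (simp add: mult.commute)

lemma schwartz_line_derivative:
  fixes f :: "'a::euclidean_space \<Rightarrow> complex"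
  assumes "f \<in> schwartz"
  shows "((\<lambda>s. f (y + s *\<^sub>R b)) has_derivative (\<lambda>h. of_real h * partial b f (y + s *\<^sub>R b))) (at s)"
proof -
  have f: "(f has_derivative frechet_derivative f (at (y + s *\<^sub>R b))) (at (y + s *\<^sub>R b))"
    using schwartz_differentiable[OF assms] by (simp add: frechet_derivative_works)
  have "((\<lambda>s. y + s *\<^sub>R b) has_derivative (\<lambda>h. h *\<^sub>R b)) (at s)"
    by (auto intro!: derivative_eq_intros)
  from has_derivative_compose[OF this f] show ?thesis
    using linear_cmul[OF has_derivative_linear[OF f]] by (simp add: scaleR_conv_of_real)
qed

text \<open>Yields a majorant for the difference quotients in \<open>fourier_partial\<close> that is
  uniform over translations of length at most 1.\<close>

lemma weight_shift:
  assumes "norm v \<le> 1"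
  shows "weight (x + v) \<le> 2 ^ (2 * DIM('a)) * weight (x::'a::euclidean_space)"
proof -
  have "norm x \<le> norm (x + v) + norm v" using norm_triangle_ineq4[of "x + v" v] by simp
  then have "norm x \<le> norm (x + v) + 1" using assms by (meson add_left_mono order_trans)
  then have "1 + norm x \<le> 2 * (1 + norm (x + v))" using norm_ge_zero[of "x + v"] by argo
  then have "(1 + norm x) ^ (2 * DIM('a)) \<le> 2 ^ (2 * DIM('a)) * (1 + norm (x + v)) ^ (2 * DIM('a))"
    unfolding power_mult_distrib[symmetric] by (rule power_mono) simp
  moreover have "(1 + norm x) ^ (2 * DIM('a)) > 0" "(1 + norm (x + v)) ^ (2 * DIM('a)) > 0"
    by (simp_all add: add_pos_nonneg)
  ultimately show ?thesis unfolding weight_def by (simp add: field_simps)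
qed

text \<open>Difference quotients replace integration by parts: a translation multiplies the
  transform by an exponential, so the transformed quotient is explicit, and dominated convergence
  identifies its limit.\<close>

lemma fourier_partial:
  fixes f :: "'a::euclidean_space \<Rightarrow> complex"
  assumes f: "f \<in> schwartz" and b: "b \<in> Basis"
  shows "fourier (partial b f) \<xi> = \<i> * of_real (\<xi> \<bullet> b) * fourier f \<xi>"
proof -
  define t where "t n = inverse (real (Suc n))" for n
  have t: "t \<longlonglongrightarrow> 0" unfolding t_def by (rule LIMSEQ_inverse_real_of_nat)
  have t0: "0 < t n" "t n \<le> 1" for n by (auto simp: t_def inverse_le_1_iff)
  note [measurable] = schwartz_measurable[OF f] schwartz_measurable[OF schwartz_partial[OF f b]]
  let ?q = "\<lambda>n y. (f (y + t n *\<^sub>R b) - f y) / of_real (t n)"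
  obtain C where C: "0 \<le> C" "\<And>x. norm (partial b f x) \<le> C * weight x"
    using rapidly_decreasing_weight[OF schwartz_rapid[OF schwartz_partial[OF f b]]] by blast
  \<comment> \<open>Mean value inequality in direction b. As t n <= 1, \<open>weight_shift\<close>
    replaces the intermediate point by y and the bound becomes independent of n.\<close>
  have qb: "norm (?q n y) \<le> C * 2 ^ (2 * DIM('a)) * weight y" for n y
  proof -
    have "\<exists>s\<in>{0<..<t n}. norm (f (y + t n *\<^sub>R b) - f (y + 0 *\<^sub>R b))
        \<le> norm (of_real (t n - 0) * partial b f (y + s *\<^sub>R b))"
      by (intro mvt_general[where f = "\<lambda>s. f (y + s *\<^sub>R b)"] t0 schwartz_line_derivative[OF f]
          has_derivative_continuous_on[OF has_derivative_at_withinI[OF schwartz_line_derivative[OF f]]])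
    then obtain s where s: "0 < s" "s < t n"
      "norm (f (y + t n *\<^sub>R b) - f y) \<le> t n * norm (partial b f (y + s *\<^sub>R b))"
      using t0(1)[of n] by (auto simp: norm_mult)
    have "norm (partial b f (y + s *\<^sub>R b)) \<le> C * weight (y + s *\<^sub>R b)" by (rule C)
    also have "\<dots> \<le> C * (2 ^ (2 * DIM('a)) * weight y)"
      using s t0(2)[of n] b by (intro mult_left_mono weight_shift C(1)) auto
    finally have "norm (partial b f (y + s *\<^sub>R b)) \<le> C * 2 ^ (2 * DIM('a)) * weight y" by simp
    moreover have "norm (?q n y) \<le> norm (partial b f (y + s *\<^sub>R b))"
      using s(3) t0(1)[of n] by (simp add: norm_divide field_simps)
    ultimately show ?thesis by simp
  qed
  have ql: "(\<lambda>n. ?q n y) \<longlonglongrightarrow> partial b f y" for y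
  proof -
    have "((\<lambda>s. f (y + s *\<^sub>R b)) has_derivative (\<lambda>h. of_real h * partial b f y)) (at 0)"
      using schwartz_line_derivative[OF f, of y b 0] by simp
    then have "(\<lambda>h. norm (f (y + h *\<^sub>R b) - f y - of_real h * partial b f y) / norm h) \<midarrow>0\<rightarrow> 0"
      by (simp add: has_derivative_at)
    then have "(\<lambda>n. norm (f (y + t n *\<^sub>R b) - f y - of_real (t n) * partial b f y) / norm (t n)) \<longlonglongrightarrow> 0"
      by (rule tendsto_compose_eventually[OF _ t]) (use t0 in \<open>auto simp: less_le\<close>)
    moreover have "norm (f (y + t n *\<^sub>R b) - f y - of_real (t n) * partial b f y) / norm (t n)
        = norm (?q n y - partial b f y)" for n
    proof -
      have "?q n y - partial b f y = (f (y + t n *\<^sub>R b) - f y - of_real (t n) * partial b f y) / of_real (t n)"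
        using t0(1)[of n] by (simp add: field_simps)
      then show ?thesis by (simp add: norm_divide)
    qed
    ultimately have "(\<lambda>n. norm (?q n y - partial b f y)) \<longlonglongrightarrow> 0" by simp
    then show ?thesis by (simp add: tendsto_norm_zero_iff LIM_zero_iff)
  qed
  have "(\<lambda>n. fourier (?q n) \<xi>) \<longlonglongrightarrow> fourier (partial b f) \<xi>"
    unfolding fourier_def
  proof (rule integral_dominated_convergence[where w = "\<lambda>y. C * 2 ^ (2 * DIM('a)) * weight y"])
    show "integrable lborel (\<lambda>y::'a. C * 2 ^ (2 * DIM('a)) * weight y)"
      by (intro integrable_mult_right integrable_weight)
    show "AE y in lborel. (\<lambda>n. exp (- \<i> * of_real (y \<bullet> \<xi>)) * ?q n y)
        \<longlonglongrightarrow> exp (- \<i> * of_real (y \<bullet> \<xi>)) * partial b f y"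
      by (intro AE_I2 tendsto_intros ql)
    show "AE y in lborel. norm (exp (- \<i> * of_real (y \<bullet> \<xi>)) * ?q n y) \<le> C * 2 ^ (2 * DIM('a)) * weight y" for n
      using qb by (simp add: norm_mult del: times_divide_eq_right)
  qed measurable
  moreover have "fourier (?q n) \<xi> = (exp (\<i> * of_real (\<xi> \<bullet> b) * of_real (t n)) - 1) / of_real (t n) * fourier f \<xi>" for n
  proof -
    have "(\<lambda>x. f (1 *\<^sub>R x + t n *\<^sub>R b)) \<in> schwartz" by (rule schwartz_affine[OF f]) simp
    then have s: "(\<lambda>x. f (x + t n *\<^sub>R b)) \<in> schwartz" by simp
    have "?q n = (\<lambda>y. (1 / of_real (t n)) * (f (y + t n *\<^sub>R b) + (- 1) * f y))"
      by (simp add: diff_divide_distrib fun_eq_iff)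
    then have "fourier (?q n) \<xi> = (1 / of_real (t n)) * fourier (\<lambda>y. f (y + t n *\<^sub>R b) + (- 1) * f y) \<xi>"
      using fourier_cmult by metis
    also have "fourier (\<lambda>y. f (y + t n *\<^sub>R b) + (- 1) * f y) \<xi>
        = fourier (\<lambda>y. f (y + t n *\<^sub>R b)) \<xi> + fourier (\<lambda>y. (- 1) * f y) \<xi>"
      using schwartz_cmult[OF f, of "-1"] s by (intro fourier_add integrable_schwartz) auto
    also have "fourier (\<lambda>y. (- 1) * f y) \<xi> = - fourier f \<xi>"
      using fourier_cmult[of "-1" f] by simp
    also have "fourier (\<lambda>y. f (y + t n *\<^sub>R b)) \<xi> = exp (\<i> * of_real (\<xi> \<bullet> b) * of_real (t n)) * fourier f \<xi>"
      using fourier_affine[of 1 f "t n *\<^sub>R b" \<xi>] by (simp add: inner_commute mult_ac)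
    finally show ?thesis by (simp add: field_simps)
  qed
  moreover have "(\<lambda>n. (exp (\<i> * of_real (\<xi> \<bullet> b) * of_real (t n)) - 1) / of_real (t n) * fourier f \<xi>)
      \<longlonglongrightarrow> \<i> * of_real (\<xi> \<bullet> b) * fourier f \<xi>"
  proof (intro tendsto_mult_right)
    let ?c = "\<i> * complex_of_real (\<xi> \<bullet> b)"
    have "((\<lambda>z. exp (?c * z)) has_field_derivative ?c) (at 0)"
      by (auto intro!: derivative_eq_intros)
    then have "(\<lambda>z. (exp (?c * z) - 1) / z) \<midarrow>0\<rightarrow> ?c"
      by (simp add: DERIV_def)
    moreover have "(\<lambda>n. complex_of_real (t n)) \<longlonglongrightarrow> 0"
      using tendsto_of_real[OF t, where 'a = complex] by simp
    moreover have "\<forall>\<^sub>F n in sequentially. complex_of_real (t n) \<noteq> 0"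
      using t0(1) by (auto simp: less_le)
    ultimately show "(\<lambda>n. (exp (?c * of_real (t n)) - 1) / of_real (t n)) \<longlonglongrightarrow> ?c"
      using tendsto_compose_eventually by blast
  qed
  ultimately show ?thesis using LIMSEQ_unique by fastforce
qed

lemma norm_fourier_le: "norm (fourier f \<xi>) \<le> (LINT x|lborel. norm (f x))"
proof -
  have "norm (fourier f \<xi>) \<le> (LINT x|lborel. norm (exp (- \<i> * of_real (x \<bullet> \<xi>)) * f x))"
    unfolding fourier_def by (rule integral_norm_bound)
  then show ?thesis by (simp add: norm_mult)
qed

text \<open>One more power of norm \<xi> is at most the sum of the |\<xi> . b|, and each of these
  factors is traded for a partial derivative of f. Hence the induction runs over all Schwartz
  f.\<close>

lemma fourier_rapidly_decreasing:
  fixes f :: "'a::euclidean_space \<Rightarrow> complex"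
  assumes "f \<in> schwartz"
  shows "rapidly_decreasing (fourier f)"
proof -
  have "\<exists>C. \<forall>\<xi>. (1 + norm \<xi>) ^ k * norm (fourier f \<xi>) \<le> C" for k
    using assms
  proof (induction k arbitrary: f)
    case 0
    show ?case using norm_fourier_le[of f] by auto
  next
    case (Suc k)
    have "\<exists>C. \<forall>b\<in>Basis. \<forall>\<xi>. (1 + norm \<xi>) ^ k * norm (fourier (partial b f) \<xi>) \<le> C b"
      by (rule bchoice) (use Suc.IH[OF schwartz_partial[OF Suc.prems]] in blast)
    then obtain C where C: "\<And>b \<xi>. b \<in> Basis \<Longrightarrow> (1 + norm \<xi>) ^ k * norm (fourier (partial b f) \<xi>) \<le> C b"
      by blast
    obtain D where D: "\<And>\<xi>. (1 + norm \<xi>) ^ k * norm (fourier f \<xi>) \<le> D"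
      using Suc.IH[OF Suc.prems] by blast
    have "(1 + norm \<xi>) ^ Suc k * norm (fourier f \<xi>) \<le> D + sum C Basis" for \<xi>
    proof -
      let ?w = "(1 + norm \<xi>) ^ k * norm (fourier f \<xi>)"
      have "(1 + norm \<xi>) ^ Suc k * norm (fourier f \<xi>) = (1 + norm \<xi>) * ?w" by simp
      also have "\<dots> \<le> (1 + (\<Sum>b\<in>Basis. \<bar>\<xi> \<bullet> b\<bar>)) * ?w"
        by (intro mult_right_mono add_left_mono norm_le_l1) auto
      also have "\<dots> = ?w + (\<Sum>b\<in>Basis. (1 + norm \<xi>) ^ k * norm (fourier (partial b f) \<xi>))"
        using fourier_partial[OF Suc.prems]
        by (simp add: distrib_left sum_distrib_left norm_mult mult_ac)
      also have "\<dots> \<le> D + sum C Basis" by (intro add_mono D sum_mono C)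
      finally show ?thesis .
    qed
    then show ?case by blast
  qed
  then show ?thesis by (simp add: rapidly_decreasing_def)
qed

text \<open>The set of all transforms of Schwartz functions is itself stable under partials, since a
  derivative of a transform is the transform of a coordinate multiple.\<close>

theorem fourier_schwartz:
  assumes "f \<in> schwartz"
  shows "fourier f \<in> schwartz"
proof (rule schwartz_coinduct[of _ "fourier ` schwartz"])
  show "fourier f \<in> fourier ` schwartz" using assms by blast
next
  fix g :: "'a \<Rightarrow> complex" assume "g \<in> fourier ` schwartz"
  then obtain u where u: "u \<in> schwartz" "g = fourier u" by blast
  note D = fourier_has_derivative[OF schwartz_measurable[OF u(1)] schwartz_rapid[OF u(1)]]
  show "g differentiable_on UNIV"
    using D unfolding u(2) differentiable_on_def differentiable_def
    by (meson has_derivative_at_withinI)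
  show "rapidly_decreasing g" unfolding u(2) by (rule fourier_rapidly_decreasing[OF u(1)])
  show "partial b g \<in> fourier ` schwartz" for b
    unfolding u(2) partial_eq[OF D] using fourier_coordinate[OF u(1)] by blast
qed

lemma inv_fourier_schwartz:
  fixes f :: "'a::euclidean_space \<Rightarrow> complex"
  assumes "f \<in> schwartz"
  shows "inv_fourier f \<in> schwartz"
proof -
  have "(\<lambda>x. fourier f (-1 *\<^sub>R x + 0)) \<in> schwartz"
    by (rule schwartz_affine[OF fourier_schwartz[OF assms]]) simp
  then have "(\<lambda>x. of_real (1 / (2 * pi) ^ DIM('a)) * fourier f (- x)) \<in> schwartz"
    using schwartz_cmult by fastforce
  then show ?thesis unfolding inv_fourier_eq[abs_def] .
qed

lemma fourier_multiplication_formula: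
  fixes f g :: "'a::euclidean_space \<Rightarrow> complex"
  assumes f: "integrable lborel f" and g: "integrable lborel g"
  shows "(LINT x|lborel. fourier f x * g x) = (LINT y|lborel. f y * fourier g y)"
proof -
  note [measurable] = borel_measurable_integrable[OF f] borel_measurable_integrable[OF g]
  let ?k = "\<lambda>y x. exp (- \<i> * of_real (y \<bullet> x)) * f y * g x"
  have "integrable (lborel \<Otimes>\<^sub>M lborel) (\<lambda>(y, x). ?k y x)"
    by (rule integrable_pair_dominated[where A = "\<lambda>y. norm (f y)" and B = "\<lambda>x. norm (g x)"])
      (use f g in \<open>auto simp: norm_mult\<close>)
  then have fub: "(LINT x|lborel. (LINT y|lborel. ?k y x)) = (LINT y|lborel. (LINT x|lborel. ?k y x))"
    by (rule lborel_pair.Fubini_integral)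
  have x: "(LINT y|lborel. ?k y x) = fourier f x * g x" for x
    by (simp add: fourier_def)
  have y: "(LINT x|lborel. ?k y x) = f y * fourier g y" for y
  proof -
    have "(LINT x|lborel. ?k y x) = (LINT x|lborel. f y * (exp (- \<i> * of_real (x \<bullet> y)) * g x))"
      by (simp add: inner_commute mult_ac)
    then show ?thesis by (simp add: fourier_def)
  qed
  show ?thesis using fub unfolding x y .
qed

section \<open>The Gaussian and Fourier inversion\<close>

definition gaussian :: "'a::euclidean_space \<Rightarrow> complex" where
  "gaussian x = of_real (exp (- (norm x)\<^sup>2 / 2))"

lemma gaussian_measurable [measurable]: "gaussian \<in> borel_measurable borel"
  unfolding gaussian_def[abs_def] by measurable

lemma norm_gaussian_le: "norm (gaussian x) \<le> 1"
  by (simp add: gaussian_def)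

lemma gaussian_prod: "gaussian x = (\<Prod>b\<in>Basis. of_real (exp (- (x \<bullet> b)\<^sup>2 / 2)))"
proof -
  have "(norm x)\<^sup>2 = (\<Sum>b\<in>Basis. (x \<bullet> b)\<^sup>2)"
    unfolding power2_norm_eq_inner by (subst euclidean_inner) (simp add: power2_eq_square)
  then have "- (norm x)\<^sup>2 / 2 = (\<Sum>b\<in>Basis. - (x \<bullet> b)\<^sup>2 / 2)"
    by (simp add: sum_negf sum_divide_distrib)
  then show ?thesis by (simp add: gaussian_def exp_sum)
qed

text \<open>Up to sqrt(2 pi) the integrand contains the standard normal density, so the value is
  read off from its characteristic function.\<close>

lemma
  shows integrable_gaussian_1: "integrable lborel (\<lambda>t. exp (- \<i> * of_real (t * u)) * complex_of_real (exp (- t\<^sup>2 / 2)))"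
    and integral_gaussian_1: "(LINT t|lborel. exp (- \<i> * of_real (t * u)) * complex_of_real (exp (- t\<^sup>2 / 2)))
      = of_real (sqrt (2 * pi) * exp (- u\<^sup>2 / 2))"
proof -
  let ?f = "\<lambda>t. exp (- \<i> * of_real (t * u)) * complex_of_real (exp (- t\<^sup>2 / 2))"
  have e: "?f t = of_real (sqrt (2 * pi)) * (std_normal_density t *\<^sub>R iexp (- u * t))" for t
    by (simp add: normal_density_def scaleR_conv_of_real mult_ac)
  have i: "integrable lborel (\<lambda>t. std_normal_density t *\<^sub>R iexp (- u * t))"
    by (rule Bochner_Integration.integrable_bound[OF integrable_normal_density[of 1 0]]) auto
  show "integrable lborel ?f"
    unfolding e using i by (rule integrable_mult_right)
  have "(LINT t|lborel. ?f t) = of_real (sqrt (2 * pi)) * char std_normal_distribution (- u)"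
    unfolding e integral_mult_right_zero char_def
    by (subst integral_density) auto
  then show "(LINT t|lborel. ?f t) = of_real (sqrt (2 * pi) * exp (- u\<^sup>2 / 2))"
    by (simp add: char_std_normal_distribution)
qed

lemma fourier_kernel_prod:
  "exp (- \<i> * complex_of_real (x \<bullet> \<xi>)) * gaussian x =
    (\<Prod>b\<in>Basis. exp (- \<i> * of_real ((x \<bullet> b) * (\<xi> \<bullet> b))) * of_real (exp (- (x \<bullet> b)\<^sup>2 / 2)))"
proof -
  have "- \<i> * complex_of_real (x \<bullet> \<xi>) = (\<Sum>b\<in>Basis. - \<i> * of_real ((x \<bullet> b) * (\<xi> \<bullet> b)))"
    by (subst euclidean_inner) (simp add: sum_distrib_left)
  then have "exp (- \<i> * complex_of_real (x \<bullet> \<xi>)) = (\<Prod>b\<in>Basis. exp (- \<i> * of_real ((x \<bullet> b) * (\<xi> \<bullet> b))))"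
    by (simp only: exp_sum finite_Basis)
  then show ?thesis by (simp only: gaussian_prod prod.distrib)
qed

lemma integrable_gaussian: "integrable lborel (gaussian :: 'a::euclidean_space \<Rightarrow> complex)"
  using integrable_lborel_prod[where 'a='a, OF integrable_gaussian_1, of "\<lambda>_. 0"]
  by (simp add: gaussian_prod[abs_def])

lemma fourier_gaussian:
  "fourier gaussian (\<xi>::'a::euclidean_space) = of_real (sqrt (2 * pi) ^ DIM('a)) * gaussian \<xi>"
  unfolding fourier_def fourier_kernel_prod
  by (subst integral_lborel_prod[OF integrable_gaussian_1], unfold integral_gaussian_1)
    (simp only: of_real_mult prod.distrib prod_constant gaussian_prod of_real_power)

text \<open>Exchanging the integrals directly fails, as the double integral is not absolutely
  convergent. A Gaussian damping factor of width 1/\<epsilon> makes the multiplication formula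
  available and turns the left side into a Gaussian average of f near \<eta>; then \<epsilon> tends
  to 0.\<close>

theorem fourier_inversion:
  fixes f :: "'a::euclidean_space \<Rightarrow> complex"
  assumes f: "f \<in> schwartz"
  shows "(LINT x|lborel. exp (\<i> * of_real (x \<bullet> \<eta>)) * fourier f x) = of_real ((2 * pi) ^ DIM('a)) * f \<eta>"
proof -
  define \<epsilon> where "\<epsilon> n = inverse (real (Suc n))" for n
  have \<epsilon>: "\<epsilon> \<longlonglongrightarrow> 0" unfolding \<epsilon>_def by (rule LIMSEQ_inverse_real_of_nat)
  have \<epsilon>0: "0 < \<epsilon> n" for n by (auto simp: \<epsilon>_def)
  note Ff = fourier_schwartz[OF f]
  note [measurable] = schwartz_measurable[OF f] schwartz_measurable[OF Ff]
  \<comment> \<open>f reflected, rescaled by \<epsilon> and centred at \<eta>: up to a power of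
    \<epsilon>, its transform times the Gaussian becomes \<open>?h n\<close> under w = - x /
    \<epsilon>.\<close>
  let ?v = "\<lambda>n z. f ((- \<epsilon> n) *\<^sub>R z + \<eta>)"
  let ?h = "\<lambda>n w. exp (\<i> * of_real (w \<bullet> \<eta>)) * fourier f w * gaussian (\<epsilon> n *\<^sub>R w)"
  define K :: complex where "K = of_real (sqrt (2 * pi) ^ DIM('a))"
  have eq: "(LINT w|lborel. ?h n w) = (LINT z|lborel. ?v n z * (K * gaussian z))" for n
  proof -
    have v: "integrable lborel (?v n)"
      using \<epsilon>0[of n] by (intro integrable_schwartz schwartz_affine f) auto
    have "?h n (0 + (- inverse (\<epsilon> n)) *\<^sub>R x) = \<bar>\<epsilon> n\<bar> ^ DIM('a) *\<^sub>R (fourier (?v n) x * gaussian x)" for x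
    proof -
      have "fourier (?v n) x = (1 / \<bar>- \<epsilon> n\<bar> ^ DIM('a)) *\<^sub>R
          (exp (\<i> * of_real (\<eta> \<bullet> x / (- \<epsilon> n))) * fourier f (x /\<^sub>R (- \<epsilon> n)))"
        using \<epsilon>0[of n] by (intro fourier_affine) auto
      moreover have "gaussian (\<epsilon> n *\<^sub>R - (inverse (\<epsilon> n) *\<^sub>R x)) = gaussian x"
        using \<epsilon>0[of n] by (simp add: gaussian_def)
      ultimately show ?thesis
        using \<epsilon>0[of n] by (simp add: inner_commute divide_inverse mult_ac)
    qed
    moreover have "(LINT w|lborel. ?h n w)
        = \<bar>- inverse (\<epsilon> n)\<bar> ^ DIM('a) *\<^sub>R (LINT x|lborel. ?h n (0 + (- inverse (\<epsilon> n)) *\<^sub>R x))"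
      using \<epsilon>0[of n] by (intro integral_lborel_affine) auto
    ultimately have "(LINT w|lborel. ?h n w)
        = \<bar>- inverse (\<epsilon> n)\<bar> ^ DIM('a) *\<^sub>R (LINT x|lborel. \<bar>\<epsilon> n\<bar> ^ DIM('a) *\<^sub>R (fourier (?v n) x * gaussian x))"
      by simp
    also have "\<dots> = (LINT x|lborel. fourier (?v n) x * gaussian x)"
      using \<epsilon>0[of n] by (simp add: power_mult_distrib[symmetric] field_simps)
    also have "\<dots> = (LINT z|lborel. ?v n z * fourier gaussian z)"
      by (rule fourier_multiplication_formula[OF v integrable_gaussian])
    finally show ?thesis by (simp add: fourier_gaussian K_def)
  qed
  have g0: "(\<lambda>n. gaussian (\<epsilon> n *\<^sub>R w)) \<longlonglongrightarrow> 1" for w :: 'a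
  proof -
    have "(\<lambda>n. exp (- (\<epsilon> n * norm w)\<^sup>2 / 2)) \<longlonglongrightarrow> exp (- (0 * norm w)\<^sup>2 / 2)"
      by (intro tendsto_intros \<epsilon>) simp
    then have "(\<lambda>n. complex_of_real (exp (- (\<epsilon> n * norm w)\<^sup>2 / 2))) \<longlonglongrightarrow> of_real 1"
      by (intro tendsto_of_real) simp
    then show ?thesis using \<epsilon>0 by (simp add: gaussian_def less_imp_le)
  qed
  have "(\<lambda>n. LINT w|lborel. ?h n w) \<longlonglongrightarrow> (LINT w|lborel. exp (\<i> * of_real (w \<bullet> \<eta>)) * fourier f w)"
  proof (rule integral_dominated_convergence[where w = "\<lambda>w. norm (fourier f w)"])
    show "integrable lborel (\<lambda>w. norm (fourier f w))" using integrable_schwartz[OF Ff] by simp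
    show "AE w in lborel. (\<lambda>n. ?h n w) \<longlonglongrightarrow> exp (\<i> * of_real (w \<bullet> \<eta>)) * fourier f w"
      using tendsto_mult_left[OF g0] by (intro AE_I2) fastforce
    show "AE w in lborel. norm (?h n w) \<le> norm (fourier f w)" for n
      by (intro AE_I2) (simp add: norm_mult mult_left_le norm_gaussian_le)
  qed measurable
  moreover have "(\<lambda>n. LINT z|lborel. ?v n z * (K * gaussian z)) \<longlonglongrightarrow> (LINT z|lborel. f \<eta> * (K * gaussian (z::'a)))"
  proof -
    obtain C where C: "\<And>x. norm (f x) \<le> C" using schwartz_bound[OF f, of 0] by auto
    show ?thesis
    proof (rule integral_dominated_convergence[where w = "\<lambda>z. C * norm (K * gaussian z)"])
      show "integrable lborel (\<lambda>z::'a. C * norm (K * gaussian z))"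
        using integrable_gaussian by (intro integrable_mult_right integrable_norm) auto
      have "(\<lambda>n. ?v n z) \<longlonglongrightarrow> f \<eta>" for z
      proof -
        have "(\<lambda>n. (- \<epsilon> n) *\<^sub>R z + \<eta>) \<longlonglongrightarrow> (- 0) *\<^sub>R z + \<eta>" by (intro tendsto_intros \<epsilon>)
        moreover have "isCont f \<eta>" using schwartz_continuous[OF f, of UNIV] by (simp add: continuous_on_eq_continuous_at)
        ultimately show ?thesis using isCont_tendsto_compose by fastforce
      qed
      then show "AE z in lborel. (\<lambda>n. ?v n z * (K * gaussian z)) \<longlonglongrightarrow> f \<eta> * (K * gaussian z)"
        by (intro AE_I2 tendsto_intros)
      show "AE z in lborel. norm (?v n z * (K * gaussian z)) \<le> C * norm (K * gaussian z)" for n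
        unfolding norm_mult[of "?v n _"] using C by (intro AE_I2 mult_right_mono) auto
    qed measurable
  qed
  ultimately have "(LINT w|lborel. exp (\<i> * of_real (w \<bullet> \<eta>)) * fourier f w) = (LINT z|lborel. f \<eta> * (K * gaussian (z::'a)))"
    unfolding eq by (rule LIMSEQ_unique)
  also have "\<dots> = f \<eta> * (K * (LINT z|lborel. gaussian (z::'a)))" by simp
  also have "(LINT z|lborel. gaussian (z::'a)) = K"
    using fourier_gaussian[of "0::'a"] by (simp add: fourier_def K_def gaussian_def)
  also have "K * K = of_real ((2 * pi) ^ DIM('a))"
    unfolding K_def of_real_mult[symmetric] power_mult_distrib[symmetric] by simp
  finally show ?thesis by (simp add: mult.commute)
qed

lemma inv_fourier_fourier:
  assumes "f \<in> schwartz"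
  shows "inv_fourier (fourier f) = f"
proof
  fix x :: 'a
  have "of_real (1 / (2 * pi) ^ DIM('a)) * (of_real ((2 * pi) ^ DIM('a)) * f x) = f x"
    unfolding mult.assoc[symmetric] of_real_mult[symmetric] by simp
  then show "inv_fourier (fourier f) x = f x"
    using fourier_inversion[OF assms, of x] by (simp add: inv_fourier_def inner_commute)
qed

lemma fourier_sum:
  fixes f :: "'i \<Rightarrow> 'a::euclidean_space \<Rightarrow> complex"
  assumes "\<And>i. i \<in> I \<Longrightarrow> f i \<in> schwartz"
  shows "fourier (\<lambda>x. \<Sum>i\<in>I. f i x) \<xi> = (\<Sum>i\<in>I. fourier (f i) \<xi>)"
  unfolding fourier_def sum_distrib_left
  by (intro Bochner_Integration.integral_sum integrable_fourier integrable_schwartz assms)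

section \<open>Transforms of functions vanishing near the origin annihilate polynomials\<close>

definition schwartz_away :: "real \<Rightarrow> ('a::euclidean_space \<Rightarrow> complex) set" where
  "schwartz_away r = {u \<in> schwartz. \<forall>x\<in>ball 0 r. u x = 0}"

lemma schwartz_away_partial:
  assumes "u \<in> schwartz_away r" "b \<in> Basis"
  shows "partial b u \<in> schwartz_away r"
proof -
  have "(u has_derivative (\<lambda>h. 0)) (at x)" if "x \<in> ball 0 r" for x
    by (rule has_derivative_transform_within_open[OF has_derivative_const[of 0] open_ball that])
      (use assms in \<open>auto simp: schwartz_away_def\<close>)
  from partial_eq[OF this] show ?thesis
    using assms schwartz_partial by (auto simp: schwartz_away_def)
qed

lemma schwartz_away_combination:
  "u \<in> schwartz_away r \<Longrightarrow> v \<in> schwartz_away r \<Longrightarrow> (\<lambda>x. c * u x + d * v x) \<in> schwartz_away r"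
  by (auto simp: schwartz_away_def intro: schwartz_add schwartz_cmult)

text \<open>A coordinate of \<xi> becomes a partial derivative of u, and derivatives still vanish on
  the open ball where u does, so the radius never shrinks. Products of polynomials need the claim
  for all u.\<close>

lemma real_polynomial_mult_fourier:
  assumes "real_polynomial_function P" "u \<in> schwartz_away r"
  shows "\<exists>v\<in>schwartz_away r. \<forall>\<xi>. of_real (P \<xi>) * fourier u \<xi> = fourier v \<xi>"
  using assms
proof (induction arbitrary: u)
  case (linear P)
  let ?w = "\<lambda>b x. - \<i> * of_real (P b) * partial b u x"
  have u: "u \<in> schwartz" using linear by (simp add: schwartz_away_def)
  have w: "b \<in> Basis \<Longrightarrow> ?w b \<in> schwartz" for b
    by (intro schwartz_cmult schwartz_partial u)
  have "(\<lambda>x. \<Sum>b\<in>Basis. ?w b x) \<in> schwartz_away r"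
    using schwartz_away_partial[OF linear(2)] w by (auto simp: schwartz_away_def intro: schwartz_sum)
  moreover have "of_real (P \<xi>) * fourier u \<xi> = fourier (\<lambda>x. \<Sum>b\<in>Basis. ?w b x) \<xi>" for \<xi>
  proof -
    interpret bounded_linear P by fact
    have "P \<xi> = P (\<Sum>b\<in>Basis. (\<xi> \<bullet> b) *\<^sub>R b)" by (simp only: euclidean_representation)
    also have "\<dots> = (\<Sum>b\<in>Basis. (\<xi> \<bullet> b) * P b)" by (simp add: sum scaleR)
    finally have "of_real (P \<xi>) * fourier u \<xi> = (\<Sum>b\<in>Basis. of_real ((\<xi> \<bullet> b) * P b) * fourier u \<xi>)"
      by (simp add: sum_distrib_right)
    also have "\<dots> = (\<Sum>b\<in>Basis. fourier (?w b) \<xi>)"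
      by (intro sum.cong refl) (simp only: fourier_cmult fourier_partial[OF u], simp add: mult_ac)
    also have "\<dots> = fourier (\<lambda>x. \<Sum>b\<in>Basis. ?w b x) \<xi>" by (rule fourier_sum[symmetric]) (rule w)
    finally show ?thesis .
  qed
  ultimately show ?case by blast
next
  case (const c)
  have "(\<lambda>x. of_real c * u x) \<in> schwartz_away r"
    using const schwartz_cmult by (auto simp: schwartz_away_def)
  then show ?case by (rule rev_bexI) (simp add: fourier_cmult)
next
  case (add P Q)
  obtain v where v: "v \<in> schwartz_away r" "\<And>\<xi>. of_real (P \<xi>) * fourier u \<xi> = fourier v \<xi>"
    using add.IH(1)[OF add.prems] by blast
  obtain w where w: "w \<in> schwartz_away r" "\<And>\<xi>. of_real (Q \<xi>) * fourier u \<xi> = fourier w \<xi>"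
    using add.IH(2)[OF add.prems] by blast
  have "fourier (\<lambda>x. v x + w x) \<xi> = fourier v \<xi> + fourier w \<xi>" for \<xi>
    using v(1) w(1) by (intro fourier_add integrable_schwartz) (auto simp: schwartz_away_def)
  moreover have "(\<lambda>x. v x + w x) \<in> schwartz_away r"
    using schwartz_away_combination[OF v(1) w(1), of 1 1] by simp
  ultimately show ?case using v(2) w(2) by (metis distrib_right of_real_add)
next
  case (mult P Q)
  obtain v where v: "v \<in> schwartz_away r" "\<And>\<xi>. of_real (Q \<xi>) * fourier u \<xi> = fourier v \<xi>"
    using mult.IH(2)[OF mult.prems] by blast
  obtain w where "w \<in> schwartz_away r" "\<And>\<xi>. of_real (P \<xi>) * fourier v \<xi> = fourier w \<xi>"
    using mult.IH(1)[OF v(1)] by blast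
  then show ?case using v(2) by (metis mult.assoc of_real_mult)
qed

text \<open>Multiplying by P gives the transform of another function vanishing near 0, and by
  inversion its integral is a multiple of the value of that function at 0. In other words, the
  transform of P is supported at the origin.\<close>

theorem polynomial_fourier_away:
  fixes P :: "'a::euclidean_space \<Rightarrow> complex"
  assumes P: "polynomial_function P" and u: "u \<in> schwartz_away r" and r: "r > 0"
  shows "(LINT x|lborel. P x * fourier u x) = 0"
proof -
  have "real_polynomial_function (\<lambda>x. Re (P x))" "real_polynomial_function (\<lambda>x. Im (P x))"
    using P bounded_linear_Re bounded_linear_Im unfolding polynomial_function_def o_def by blast+
  then obtain v w where v: "v \<in> schwartz_away r" "\<And>\<xi>. of_real (Re (P \<xi>)) * fourier u \<xi> = fourier v \<xi>"
    and w: "w \<in> schwartz_away r" "\<And>\<xi>. of_real (Im (P \<xi>)) * fourier u \<xi> = fourier w \<xi>"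
    using real_polynomial_mult_fourier[OF _ u] by metis
  let ?z = "\<lambda>x. 1 * v x + \<i> * w x"
  have z: "?z \<in> schwartz_away r" by (rule schwartz_away_combination[OF v(1) w(1)])
  have "P \<xi> * fourier u \<xi> = fourier ?z \<xi>" for \<xi>
  proof -
    have "P \<xi> = of_real (Re (P \<xi>)) + \<i> * of_real (Im (P \<xi>))" by (rule complex_eq)
    then have "P \<xi> * fourier u \<xi> = fourier v \<xi> + \<i> * fourier w \<xi>"
      unfolding v(2)[symmetric] w(2)[symmetric] by (metis distrib_right mult.assoc)
    also have "\<dots> = fourier (\<lambda>x. v x + \<i> * w x) \<xi>"
      using v(1) w(1) unfolding fourier_cmult[symmetric]
      by (intro fourier_add[symmetric] integrable_schwartz schwartz_cmult) (auto simp: schwartz_away_def)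
    finally show ?thesis by simp
  qed
  moreover have "(LINT x|lborel. fourier ?z x) = of_real ((2 * pi) ^ DIM('a)) * ?z 0"
    using fourier_inversion[of ?z 0] z by (simp add: schwartz_away_def)
  moreover have "?z 0 = 0" using z r by (simp add: schwartz_away_def)
  ultimately show ?thesis by simp
qed

subsection \<open>Lebesgue norms\<close>

text \<open>For \<open>t \<ge> 0\<close> this says that the \<open>L\<^sup>p\<close> norm is at most \<open>t\<close>; working with upper bounds avoids
  all case distinctions on infinite norms.\<close>

definition lp_le :: "ereal \<Rightarrow> ('a::euclidean_space \<Rightarrow> complex) \<Rightarrow> real \<Rightarrow> bool" where
  "lp_le p g t \<longleftrightarrow>
     (if p = \<infinity> then AE x in lborel. norm (g x) \<le> t
      else (\<integral>\<^sup>+x. ennreal (norm (g x) powr real_of_ereal p) \<partial>lborel) \<le> ennreal (t powr real_of_ereal p))"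

definition inverse_exponent :: "ereal \<Rightarrow> real" where
  "inverse_exponent p = (if p = \<infinity> then 0 else 1 / real_of_ereal p)"

lemma ereal_exponent_cases:
  assumes "1 \<le> p"
  obtains "p = \<infinity>" | q where "p = ereal q" "1 \<le> q"
  using assms by (cases p) (auto simp: one_ereal_def)

lemma lp_norm_le_iff:
  assumes p: "1 \<le> p" and g [measurable]: "g \<in> borel_measurable borel" and t: "0 \<le> t"
  shows "lp_norm p g \<le> ennreal t \<longleftrightarrow> lp_le p g t"
  using p
proof (cases rule: ereal_exponent_cases)
  case 1
  have "esssup lborel (\<lambda>x. ennreal (norm (g x))) \<le> ennreal t \<longleftrightarrow> (AE x in lborel. ennreal (norm (g x)) \<le> ennreal t)"
  proof
    assume "esssup lborel (\<lambda>x. ennreal (norm (g x))) \<le> ennreal t"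
    moreover have "AE x in lborel. ennreal (norm (g x)) \<le> esssup lborel (\<lambda>x. ennreal (norm (g x)))"
      by (rule esssup_AE)
    ultimately show "AE x in lborel. ennreal (norm (g x)) \<le> ennreal t"
      by (auto elim: eventually_mono order_trans)
  next
    assume "AE x in lborel. ennreal (norm (g x)) \<le> ennreal t"
    then show "esssup lborel (\<lambda>x. ennreal (norm (g x))) \<le> ennreal t"
      by (intro esssup_I) auto
  qed
  then show ?thesis using 1 t by (simp add: lp_norm_def lp_le_def)
next
  case (2 q)
  let ?I = "\<integral>\<^sup>+x. ennreal (norm (g x) powr q) \<partial>lborel"
  show ?thesis
  proof (cases ?I)
    case (real r)
    have "r powr (1 / q) \<le> t \<longleftrightarrow> r \<le> t powr q"
    proof
      assume "r powr (1 / q) \<le> t"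
      then have "(r powr (1 / q)) powr q \<le> t powr q" using 2 by (intro powr_mono2) auto
      then show "r \<le> t powr q" using 2 real by (simp add: powr_powr)
    next
      assume "r \<le> t powr q"
      then have "r powr (1 / q) \<le> (t powr q) powr (1 / q)" using 2 real by (intro powr_mono2) auto
      then show "r powr (1 / q) \<le> t" using 2 t by (simp add: powr_powr)
    qed
    then show ?thesis using 2 real t by (simp add: lp_norm_def lp_le_def)
  next
    case top
    then show ?thesis using 2 by (simp add: lp_norm_def lp_le_def top_unique)
  qed
qed

lemma lp_le_zero: "1 \<le> p \<Longrightarrow> 0 \<le> t \<Longrightarrow> lp_le p (\<lambda>x. 0) t"
  by (simp add: lp_le_def)

lemma lp_le_mono:
  assumes "1 \<le> p" "lp_le p g t" "0 \<le> t" "t \<le> u"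
  shows "lp_le p g u"
  using assms(1)
proof (cases rule: ereal_exponent_cases)
  case 1
  then show ?thesis using assms by (auto simp: lp_le_def elim: eventually_mono)
next
  case (2 q)
  then have "ennreal (t powr q) \<le> ennreal (u powr q)" using assms by (intro ennreal_leI powr_mono2) auto
  then show ?thesis using 2 assms(2) by (auto simp: lp_le_def intro: order_trans)
qed

text \<open>The constant is not optimal, but a quasi-norm inequality suffices and avoids Minkowski's inequality.\<close>

lemma lp_le_add:
  assumes p: "1 \<le> p" and [measurable]: "f \<in> borel_measurable borel" "g \<in> borel_measurable borel"
    and f: "lp_le p f t" and g: "lp_le p g u" and tu: "0 \<le> t" "0 \<le> u"
  shows "lp_le p (\<lambda>x. f x + g x) (4 * (t + u))"
  using p
proof (cases rule: ereal_exponent_cases)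
  case 1
  have "AE x in lborel. norm (f x) \<le> t" "AE x in lborel. norm (g x) \<le> u"
    using f g 1 by (auto simp: lp_le_def)
  then have "AE x in lborel. norm (f x + g x) \<le> 4 * (t + u)"
  proof eventually_elim
    case (elim x)
    then show ?case using norm_triangle_ineq[of "f x" "g x"] tu by simp
  qed
  then show ?thesis using 1 by (simp add: lp_le_def)
next
  case (2 q)
  have le: "norm (f x + g x) powr q \<le> 2 powr q * (norm (f x) powr q + norm (g x) powr q)" for x
  proof -
    have "norm (f x + g x) \<le> 2 * max (norm (f x)) (norm (g x))"
      using norm_triangle_ineq[of "f x" "g x"] by linarith
    then have "norm (f x + g x) powr q \<le> (2 * max (norm (f x)) (norm (g x))) powr q"
      using 2 by (intro powr_mono2) auto
    also have "\<dots> = 2 powr q * max (norm (f x)) (norm (g x)) powr q"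
      by (rule powr_mult)
    also have "\<dots> \<le> 2 powr q * (norm (f x) powr q + norm (g x) powr q)"
      by (intro mult_left_mono) (auto simp: max_def)
    finally show ?thesis .
  qed
  have "(\<integral>\<^sup>+x. ennreal (norm (f x + g x) powr q) \<partial>lborel)
      \<le> (\<integral>\<^sup>+x. ennreal (2 powr q) * (ennreal (norm (f x) powr q) + ennreal (norm (g x) powr q)) \<partial>lborel)"
    using le by (intro nn_integral_mono) (auto simp flip: ennreal_plus ennreal_mult intro!: ennreal_leI)
  also have "\<dots> = ennreal (2 powr q) * ((\<integral>\<^sup>+x. ennreal (norm (f x) powr q) \<partial>lborel) + (\<integral>\<^sup>+x. ennreal (norm (g x) powr q) \<partial>lborel))"
    by (simp add: nn_integral_cmult nn_integral_add)
  also have "\<dots> \<le> ennreal (2 powr q) * (ennreal (t powr q) + ennreal (u powr q))"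
    using f g 2 by (intro mult_left_mono add_mono) (auto simp: lp_le_def)
  also have "\<dots> = ennreal (2 powr q * (t powr q + u powr q))"
    by (simp add: ennreal_mult)
  also have "\<dots> \<le> ennreal ((4 * (t + u)) powr q)"
  proof (rule ennreal_leI)
    \<comment> \<open>The constant 4 is 2 times 2: one \<open>2 powr q\<close> comes from the
      pointwise bound, the other absorbs the 2 of this sum because q >= 1.\<close>
    have "t powr q + u powr q \<le> 2 * (t + u) powr q"
      using tu 2 powr_mono2[of q t "t + u"] powr_mono2[of q u "t + u"] by simp
    also have "2 \<le> (2::real) powr q" using 2 powr_mono[of 1 q 2] by simp
    finally have "t powr q + u powr q \<le> 2 powr q * (t + u) powr q"
      by (simp add: mult_right_mono)
    then have "2 powr q * (t powr q + u powr q) \<le> 2 powr q * (2 powr q * (t + u) powr q)"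
      by (intro mult_left_mono) auto
    also have "\<dots> = (2 * (2 * (t + u))) powr q" using tu by (simp only: powr_mult zero_le_numeral zero_le_mult_iff add_nonneg_nonneg)
    finally show "2 powr q * (t powr q + u powr q) \<le> (4 * (t + u)) powr q" by simp
  qed
  finally show ?thesis using 2 by (simp add: lp_le_def)
qed

lemma AE_lborel_scale:
  assumes c: "c \<noteq> 0" and m: "{x. P x} \<in> sets borel" and "AE x in (lborel :: 'a::euclidean_space measure). P x"
  shows "AE x in (lborel :: 'a measure). P (c *\<^sub>R x)"
proof -
  have e: "lborel = density (distr lborel borel (\<lambda>x::'a. 0 + c *\<^sub>R x)) (\<lambda>_. ennreal (\<bar>c\<bar> ^ DIM('a)))"
    using lborel_affine[OF c, of 0] by simp
  have "AE x in density (distr lborel borel (\<lambda>x::'a. 0 + c *\<^sub>R x)) (\<lambda>_. ennreal (\<bar>c\<bar> ^ DIM('a))). P x"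
    by (subst e[symmetric]) (rule assms(3))
  then have "AE x in distr lborel borel (\<lambda>x::'a. 0 + c *\<^sub>R x). P x"
    using c by (simp add: AE_density)
  then show ?thesis using m by (subst (asm) AE_distr_iff) auto
qed

lemma nn_integral_lborel_scale:
  fixes f :: "'a::euclidean_space \<Rightarrow> ennreal"
  assumes c: "c \<noteq> 0" and [measurable]: "f \<in> borel_measurable borel"
  shows "(\<integral>\<^sup>+x. f x \<partial>lborel) = ennreal (\<bar>c\<bar> ^ DIM('a)) * (\<integral>\<^sup>+x. f (c *\<^sub>R x) \<partial>lborel)"
proof -
  have e: "lborel = density (distr lborel borel (\<lambda>x::'a. 0 + c *\<^sub>R x)) (\<lambda>_. ennreal (\<bar>c\<bar> ^ DIM('a)))"
    using lborel_affine[OF c, of 0] by simp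
  show ?thesis
    by (subst (1) e) (simp add: nn_integral_density nn_integral_distr nn_integral_cmult)
qed

lemma lp_le_scale:
  fixes h :: "'a::euclidean_space \<Rightarrow> complex"
  assumes p: "1 \<le> p" and [measurable]: "h \<in> borel_measurable borel" and h: "lp_le p h B"
    and r: "0 < r" and B: "0 \<le> B"
  shows "lp_le p (\<lambda>x. c * h (r *\<^sub>R x)) (norm c * r powr (- (DIM('a) * inverse_exponent p)) * B)"
  using p
proof (cases rule: ereal_exponent_cases)
  case 1
  have "AE x in lborel. norm (h (r *\<^sub>R x)) \<le> B"
    using h 1 r by (intro AE_lborel_scale) (auto simp: lp_le_def)
  then have "AE x in lborel. norm (c * h (r *\<^sub>R x)) \<le> norm c * B"
    by eventually_elim (auto simp: norm_mult intro: mult_left_mono)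
  then show ?thesis using 1 r by (simp add: lp_le_def inverse_exponent_def)
next
  case (2 q)
  have pos: "0 < r ^ DIM('a)" using r by simp
  have "ennreal (r ^ DIM('a)) * (\<integral>\<^sup>+x. ennreal (norm (h (r *\<^sub>R x)) powr q) \<partial>lborel)
      = (\<integral>\<^sup>+x. ennreal (norm (h x) powr q) \<partial>lborel)"
    using nn_integral_lborel_scale[of r "\<lambda>x. ennreal (norm (h x) powr q)"] r by simp
  also have "\<dots> \<le> ennreal (B powr q)" using h 2 by (simp add: lp_le_def)
  finally have le: "ennreal (r ^ DIM('a)) * (\<integral>\<^sup>+x. ennreal (norm (h (r *\<^sub>R x)) powr q) \<partial>lborel) \<le> ennreal (B powr q)" .
  have "(\<integral>\<^sup>+x. ennreal (norm (h (r *\<^sub>R x)) powr q) \<partial>lborel)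
     = ennreal (inverse (r ^ DIM('a))) * (ennreal (r ^ DIM('a)) * (\<integral>\<^sup>+x. ennreal (norm (h (r *\<^sub>R x)) powr q) \<partial>lborel))"
  proof -
    have "inverse (r ^ DIM('a)) * r ^ DIM('a) = 1"
      by (rule left_inverse) (use r in simp)
    then show ?thesis using pos by (simp add: mult.assoc[symmetric] flip: ennreal_mult)
  qed
  also have "\<dots> \<le> ennreal (inverse (r ^ DIM('a))) * ennreal (B powr q)"
    by (intro mult_left_mono le) auto
  finally have le': "(\<integral>\<^sup>+x. ennreal (norm (h (r *\<^sub>R x)) powr q) \<partial>lborel) \<le> ennreal (inverse (r ^ DIM('a)) * B powr q)"
    using pos by (simp add: ennreal_mult)
  have "(\<integral>\<^sup>+x. ennreal (norm (c * h (r *\<^sub>R x)) powr q) \<partial>lborel)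
      = (\<integral>\<^sup>+x. ennreal (norm c powr q) * ennreal (norm (h (r *\<^sub>R x)) powr q) \<partial>lborel)"
    by (simp add: norm_mult powr_mult ennreal_mult)
  also have "\<dots> = ennreal (norm c powr q) * (\<integral>\<^sup>+x. ennreal (norm (h (r *\<^sub>R x)) powr q) \<partial>lborel)"
    by (rule nn_integral_cmult) measurable
  also have "\<dots> \<le> ennreal (norm c powr q) * ennreal (inverse (r ^ DIM('a)) * B powr q)"
    by (intro mult_left_mono le') auto
  also have "\<dots> = ennreal ((norm c * r powr (- (DIM('a) / q)) * B) powr q)"
  proof -
    have "(r powr (- (DIM('a) / q))) powr q = inverse (r ^ DIM('a))"
    proof -
      have "(r powr (- (DIM('a) / q))) powr q = r powr (- real DIM('a))"
        using 2 by (simp only: powr_powr) simp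
      then show ?thesis using r by (simp add: powr_minus powr_realpow)
    qed
    then show ?thesis using B r pos by (simp add: powr_mult mult.assoc flip: ennreal_mult)
  qed
  finally show ?thesis using 2 by (simp add: lp_le_def inverse_exponent_def)
qed

lemma lp_le_schwartz:
  assumes p: "1 \<le> p" and h: "h \<in> schwartz"
  obtains B where "0 \<le> B" "lp_le p h B"
  using p
proof (cases rule: ereal_exponent_cases)
  case 1
  obtain C where "0 \<le> C" "\<And>x. (1 + norm x) ^ 0 * norm (h x) \<le> C" using schwartz_bound[OF h, where k = 0] by metis
  then show ?thesis using 1 by (intro that[of C]) (auto simp: lp_le_def)
next
  case (2 q)
  note [measurable] = schwartz_measurable[OF h]
  obtain C where C: "0 \<le> C" "\<And>x. (1 + norm x) ^ 0 * norm (h x) \<le> C" using schwartz_bound[OF h, where k = 0] by metis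
  have i: "integrable lborel (\<lambda>x. norm (h x) powr q)"
  proof (rule Bochner_Integration.integrable_bound)
    show "integrable lborel (\<lambda>x. C powr (q - 1) * norm (h x))"
      using integrable_schwartz[OF h] by (intro integrable_mult_right integrable_norm)
    \<comment> \<open>Boundedness handles q - 1 >= 0 of the powers; one power is kept for
      integrability.\<close>
    have "norm (h x) powr q \<le> C powr (q - 1) * norm (h x)" for x
    proof -
      have "norm (h x) powr q = norm (h x) powr (q - 1) * norm (h x)"
        by (cases "h x = 0") (simp_all add: powr_diff)
      also have "\<dots> \<le> C powr (q - 1) * norm (h x)"
        using C 2 by (intro mult_right_mono powr_mono2) auto
      finally show ?thesis .
    qed
    then show "AE x in lborel. norm (norm (h x) powr q) \<le> norm (C powr (q - 1) * norm (h x))"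
      by simp
  qed measurable
  define J where "J = (LINT x|lborel. norm (h x) powr q)"
  have J: "0 \<le> J" unfolding J_def by (rule integral_nonneg_AE) auto
  have "(\<integral>\<^sup>+x. ennreal (norm (h x) powr q) \<partial>lborel) = ennreal J"
    unfolding J_def by (rule nn_integral_eq_integral[OF i]) auto
  moreover have "(J powr (1 / q)) powr q = J" using 2 J by (simp add: powr_powr)
  ultimately show ?thesis using 2 by (intro that[of "J powr (1 / q)"]) (auto simp: lp_le_def)
qed

text \<open>Instead of Hoelder's inequality we use \<open>t \<le> \<lambda> + t\<^sup>q \<lambda>\<^bsup>1 - q\<^esup>\<close>, with \<open>\<lambda>\<close> chosen to balance the two terms.\<close>

lemma lp_le_pairing:
  fixes g w :: "'a::euclidean_space \<Rightarrow> complex"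
  assumes p: "1 \<le> p" and [measurable]: "g \<in> borel_measurable borel" and g: "lp_le p g t" and t: "0 < t"
    and w: "integrable lborel w" and wb: "\<And>x. norm (w x) \<le> r ^ DIM('a) * M" and r: "0 < r"
    and I: "(LINT x|lborel. norm (w x)) \<le> I" and M: "0 \<le> M"
  shows "norm (LINT x|lborel. g x * w x) \<le> r powr (DIM('a) * inverse_exponent p) * t * (I + M)"
  using p
proof (cases rule: ereal_exponent_cases)
  case 1
  note [measurable] = borel_measurable_integrable[OF w]
  have a: "AE x in lborel. norm (g x) \<le> t" using g 1 by (simp add: lp_le_def)
  have it: "integrable lborel (\<lambda>x. t * norm (w x))" using w by simp
  have le: "AE x in lborel. norm (g x * w x) \<le> t * norm (w x)"
    using a by eventually_elim (auto simp: norm_mult intro: mult_right_mono)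
  have "integrable lborel (\<lambda>x. g x * w x)"
    by (rule Bochner_Integration.integrable_bound[OF it, rotated])
      (use le t in \<open>auto elim: eventually_mono\<close>)
  then have "(LINT x|lborel. norm (g x * w x)) \<le> (LINT x|lborel. t * norm (w x))"
    by (intro integral_mono_AE it le) auto
  then have "norm (LINT x|lborel. g x * w x) \<le> (LINT x|lborel. t * norm (w x))"
    by (rule order_trans[OF integral_norm_bound])
  also have "\<dots> \<le> t * (I + M)"
    unfolding integral_mult_right_zero using I M t by (intro mult_left_mono) auto
  finally show ?thesis using 1 r by (simp add: inverse_exponent_def)
next
  case (2 q)
  note [measurable] = borel_measurable_integrable[OF w]
  \<comment> \<open>This value satisfies l^q = r^d t^q, so the second term below collapses to
    \<open>l * M\<close>.\<close>
  define l where "l = r powr (DIM('a) / q) * t"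
  have l: "l > 0" using r t by (simp add: l_def)
  let ?G = "\<lambda>x. norm (g x) powr q"
  have le: "(\<integral>\<^sup>+x. ennreal (?G x) \<partial>lborel) \<le> ennreal (t powr q)"
    using g 2 by (simp add: lp_le_def)
  have iG: "integrable lborel ?G"
    by (intro integrableI_bounded) (use le in \<open>auto intro: le_less_trans\<close>)
  have IG: "(LINT x|lborel. ?G x) \<le> t powr q"
    using le by (subst (asm) nn_integral_eq_integral[OF iG]) auto
  have b: "norm (g x * w x) \<le> l * norm (w x) + l powr (1 - q) * (r ^ DIM('a) * M) * ?G x" for x
  proof -
    have "norm (g x) \<le> l + l powr (1 - q) * ?G x"
    proof (cases "norm (g x) \<le> l")
      case True
      then show ?thesis by (simp add: add_increasing2)
    next
      case False
      \<comment> \<open>Above the threshold l, the factor (norm (g x) / l) powr (q - 1) is at least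
        1, so inserting it only enlarges the bound.\<close>
      then have "l powr (q - 1) \<le> norm (g x) powr (q - 1)"
        using l 2 by (intro powr_mono2) auto
      then have "1 \<le> l powr (1 - q) * norm (g x) powr (q - 1)"
      proof -
        have "l powr (1 - q) * l powr (q - 1) = 1" using l by (simp add: powr_add[symmetric])
        then show ?thesis
          using mult_left_mono[OF \<open>l powr (q - 1) \<le> _\<close>, of "l powr (1 - q)"] by simp
      qed
      then have "norm (g x) \<le> l powr (1 - q) * norm (g x) powr (q - 1) * norm (g x)"
        using mult_right_mono[of 1 _ "norm (g x)"] by simp
      also have "\<dots> = l powr (1 - q) * ?G x"
        using False l by (simp add: powr_diff)
      finally show ?thesis using l by simp
    qed
    then have "norm (g x * w x) \<le> (l + l powr (1 - q) * ?G x) * norm (w x)"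
      by (simp add: norm_mult mult_right_mono)
    also have "\<dots> = l * norm (w x) + l powr (1 - q) * ?G x * norm (w x)"
      by (simp add: distrib_right)
    also have "\<dots> \<le> l * norm (w x) + l powr (1 - q) * ?G x * (r ^ DIM('a) * M)"
      by (intro add_left_mono mult_left_mono wb) auto
    finally show ?thesis by (simp add: mult_ac)
  qed
  have "norm (LINT x|lborel. g x * w x)
      \<le> (LINT x|lborel. l * norm (w x) + l powr (1 - q) * (r ^ DIM('a) * M) * ?G x)"
  proof (rule Bochner_Integration.integral_norm_bound_integral)
    show i: "integrable lborel (\<lambda>x. l * norm (w x) + l powr (1 - q) * (r ^ DIM('a) * M) * ?G x)"
      using w iG by (intro Bochner_Integration.integrable_add integrable_mult_right integrable_norm)
    show "integrable lborel (\<lambda>x. g x * w x)"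
      by (rule Bochner_Integration.integrable_bound[OF i]) (use order_trans[OF b abs_ge_self] in auto)
  qed (use b in auto)
  also have "\<dots> = l * (LINT x|lborel. norm (w x)) + l powr (1 - q) * (r ^ DIM('a) * M) * (LINT x|lborel. ?G x)"
    using w iG by (subst Bochner_Integration.integral_add) auto
  also have "\<dots> \<le> l * I + l powr (1 - q) * (r ^ DIM('a) * M) * t powr q"
    using l I IG M r by (intro add_mono mult_left_mono) auto
  also have "l powr (1 - q) * (r ^ DIM('a) * M) * t powr q = l * M"
  proof -
    have "l powr q = r ^ DIM('a) * t powr q"
      using 2 r t by (simp add: l_def powr_mult powr_powr powr_realpow)
    moreover have "l powr (1 - q) = l / l powr q" using l by (simp add: powr_diff)
    ultimately show ?thesis using r t by simp
  qed
  finally show ?thesis using 2 by (simp add: l_def inverse_exponent_def algebra_simps)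
qed

subsection \<open>Tempered distributions given by functions\<close>

definition distribution_of :: "('a::euclidean_space \<Rightarrow> complex) \<Rightarrow> 'a functional" where
  "distribution_of g \<phi> = (LINT x|lborel. g x * \<phi> x)"

lemma schwartz_norm_upper:
  assumes "\<phi> \<in> schwartz"
  shows "(1 + norm x) ^ k * norm (\<phi> x) \<le> schwartz_norm k \<phi>"
proof -
  have "(\<lambda>(x, bs). (1 + norm x) ^ k * norm (iter_deriv bs \<phi> x)) (x, []) \<le> schwartz_norm k \<phi>"
    unfolding schwartz_norm_def by (rule cSUP_upper[OF _ schwartz_norm_bdd[OF assms]]) auto
  then show ?thesis by simp
qed

lemma represents_distribution_of:
  assumes "g \<in> borel_measurable borel" "polynomially_bounded g"
  shows "represents g (distribution_of g)"
  using assms integrable_poly_schwartz[OF assms] by (simp add: represents_def distribution_of_def)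

lemma tempered_distribution_of:
  fixes g :: "'a::euclidean_space \<Rightarrow> complex"
  assumes m: "g \<in> borel_measurable borel" and g: "polynomially_bounded g"
  shows "tempered (distribution_of g)"
  unfolding tempered_def
proof (intro conjI ballI allI)
  fix \<phi> \<psi> :: "'a \<Rightarrow> complex" and c assume "\<phi> \<in> schwartz" "\<psi> \<in> schwartz"
  then show "distribution_of g (\<lambda>x. \<phi> x + \<psi> x) = distribution_of g \<phi> + distribution_of g \<psi>"
    using integrable_poly_schwartz[OF m g] by (simp add: distribution_of_def distrib_left)
next
  fix \<phi> :: "'a \<Rightarrow> complex" and c
  show "distribution_of g (\<lambda>x. c * \<phi> x) = c * distribution_of g \<phi>"
    by (simp add: distribution_of_def mult.left_commute)
next
  obtain k C where C: "C \<ge> 0" "\<And>x. norm (g x) \<le> C * (1 + norm x) ^ k"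
    using g unfolding polynomially_bounded_def by blast
  \<comment> \<open>k powers absorb the growth of g; the remaining ones produce the integrable
    \<open>weight\<close>.\<close>
  let ?k = "2 * DIM('a) + k"
  let ?W = "LINT x|lborel. weight (x::'a)"
  have "norm (distribution_of g \<phi>) \<le> (C * ?W) * schwartz_norm ?k \<phi>" if \<phi>: "\<phi> \<in> schwartz" for \<phi>
  proof -
    have le: "norm (g x * \<phi> x) \<le> (C * schwartz_norm ?k \<phi>) * weight x" for x
    proof (rule weight_bound)
      have "(1 + norm x) ^ (2 * DIM('a)) * norm (g x * \<phi> x)
          \<le> (1 + norm x) ^ (2 * DIM('a)) * ((C * (1 + norm x) ^ k) * norm (\<phi> x))"
        unfolding norm_mult by (intro mult_left_mono mult_right_mono C) auto
      also have "\<dots> = C * ((1 + norm x) ^ ?k * norm (\<phi> x))"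
        by (simp add: power_add mult_ac)
      also have "\<dots> \<le> C * schwartz_norm ?k \<phi>"
        by (intro mult_left_mono schwartz_norm_upper \<phi> C)
      finally show "(1 + norm x) ^ (2 * DIM('a)) * norm (g x * \<phi> x) \<le> C * schwartz_norm ?k \<phi>" .
    qed
    have "norm (distribution_of g \<phi>) \<le> (LINT x|lborel. (C * schwartz_norm ?k \<phi>) * weight (x::'a))"
      unfolding distribution_of_def
      by (rule Bochner_Integration.integral_norm_bound_integral)
        (use le integrable_poly_schwartz[OF m g \<phi>] integrable_weight in auto)
    then show ?thesis by (simp add: mult_ac)
  qed
  then show "\<exists>k C. \<forall>\<phi>\<in>schwartz. norm (distribution_of g \<phi>) \<le> C * schwartz_norm k \<phi>" by blast
qed

subsection \<open>Tempered distributions modulo polynomials\<close>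

lemma poly_rel_tempered: "poly_rel T U \<Longrightarrow> tempered T \<and> tempered U"
  by (simp add: poly_rel_def)

text \<open>\<open>rep_class\<close> picks an arbitrary representative, so a round trip through the
  quotient returns T only up to a polynomial.\<close>

lemma poly_rel_rep_class: "tempered T \<Longrightarrow> poly_rel (rep_class (class_of T)) T"
  using Quotient3_tempered_mod_poly poly_rel_refl by (metis rep_abs_rsp_left)

lemma tempered_rep_class: "tempered (rep_class F)"
  using Quotient3_tempered_mod_poly unfolding Quotient3_def poly_rel_def by metis

lemma class_of_rep_class: "class_of (rep_class F) = F"
  using Quotient3_tempered_mod_poly unfolding Quotient3_def by metis

lemma class_of_eq: "poly_rel T U \<Longrightarrow> class_of T = class_of U"
  using Quotient3_tempered_mod_poly poly_rel_tempered poly_rel_refl unfolding Quotient3_def by metis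

lemma class_of_add:
  assumes "tempered T" "tempered U"
  shows "class_of (\<lambda>\<phi>. T \<phi> + U \<phi>) = class_of T + class_of U"
  using assms by (simp add: plus_tempered_mod_poly.abs_eq poly_rel_refl)

lemma poly_rel_rep_class_add: "poly_rel (rep_class (F + G)) (\<lambda>\<phi>. rep_class F \<phi> + rep_class G \<phi>)"
  using poly_rel_rep_class[OF tempered_add[OF tempered_rep_class tempered_rep_class], of F G]
  by (simp add: class_of_add tempered_rep_class class_of_rep_class)

lemma poly_rel_rep_class_zero: "poly_rel (rep_class 0) (\<lambda>\<phi>. 0)"
  using poly_rel_rep_class[OF tempered_0] by (simp add: zero_tempered_mod_poly.abs_eq)

subsection \<open>Dyadic blocks\<close>

locale dyadic =
  fixes chi :: "'a::euclidean_space \<Rightarrow> real"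
  assumes cutoff: "dyadic_cutoff chi"
begin

lemma chi_zero:
  assumes "2 < norm x"
  shows "chi x = 0"
proof (rule ccontr)
  assume "chi x \<noteq> 0"
  then have "x \<in> closure {x. chi x \<noteq> 0}" by (intro subsetD[OF closure_subset]) simp
  moreover have "closure {x. chi x \<noteq> 0} \<subseteq> cball 0 2" using cutoff unfolding dyadic_cutoff_def by (elim conjE)
  ultimately have "x \<in> cball 0 2" by (rule subsetD[rotated])
  then show False using assms by simp
qed

text \<open>By radiality a single boundary point suffices: the neighbourhood contains a ball around
  a unit vector e, and chi(x) = chi(|x| e). The margin \<delta> leaves room for a shell that only
  one block sees.\<close>

lemma chi_one: obtains \<delta> where "0 < \<delta>" "\<delta> \<le> 1" "\<And>x. norm x < 1 + \<delta> \<Longrightarrow> chi x = 1"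
proof -
  obtain U where U: "open U" "cball 0 1 \<subseteq> U" "\<And>x. x \<in> U \<Longrightarrow> chi x = 1"
    using cutoff unfolding dyadic_cutoff_def by blast
  obtain e :: 'a where e: "e \<in> Basis" by fastforce
  then have "e \<in> U" using U(2) by auto
  then obtain d where d: "d > 0" "ball e d \<subseteq> U" using U(1) open_contains_ball by blast
  have "chi x = 1" if x: "norm x < 1 + min d 1" for x
  proof (cases "norm x \<le> 1")
    case True
    then show ?thesis using U(2,3) by auto
  next
    case False
    then have "dist e (norm x *\<^sub>R e) = \<bar>1 - norm x\<bar>"
    proof -
      have "e - norm x *\<^sub>R e = (1 - norm x) *\<^sub>R e" by (simp add: scaleR_diff_left)
      then show ?thesis using e by (simp add: dist_norm)
    qed
    then have "norm x *\<^sub>R e \<in> U" using d x False by auto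
    moreover have "chi x = chi (norm x *\<^sub>R e)"
      proof -
      have "norm x = norm (norm x *\<^sub>R e)" using e by simp
      then show ?thesis using cutoff unfolding dyadic_cutoff_def by blast
    qed
    ultimately show ?thesis using U(3) by simp
  qed
  then show ?thesis using that[of "min d 1"] d(1) by simp
qed

lemma chi_one_le: "norm x \<le> 1 \<Longrightarrow> chi x = 1"
proof -
  assume "norm x \<le> 1"
  moreover obtain \<delta> where "0 < \<delta>" "\<And>x. norm x < 1 + \<delta> \<Longrightarrow> chi x = 1" using chi_one by blast
  ultimately show ?thesis by simp
qed

text \<open>Along every ray chi is nonincreasing and eventually 0.\<close>

lemma chi_nonneg: "0 \<le> chi x"
proof (cases "x = 0")
  case True
  then show ?thesis using chi_one_le[of x] by simp
next
  case False
  let ?e = "x /\<^sub>R norm x"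
  have "antimono_on {0..} (\<lambda>r. chi (r *\<^sub>R ?e))"
  proof -
    have "norm ?e = 1" using False by simp
    then show ?thesis using cutoff unfolding dyadic_cutoff_def by blast
  qed
  then have "chi ((norm x + 3) *\<^sub>R ?e) \<le> chi (norm x *\<^sub>R ?e)"
    by (rule monotone_onD) auto
  moreover have "chi ((norm x + 3) *\<^sub>R ?e) = 0"
  proof (rule chi_zero)
    have "norm ((norm x + 3) *\<^sub>R ?e) = norm x + 3" using False by (simp add: field_simps)
    then show "2 < norm ((norm x + 3) *\<^sub>R ?e)" using norm_ge_zero[of x] by linarith
  qed
  ultimately show ?thesis using False by simp
qed

lemma chi_schwartz:
  assumes c: "c \<noteq> 0"
  shows "(\<lambda>x. complex_of_real (chi (c *\<^sub>R x + a))) \<in> schwartz"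
proof -
  have "smooth chi" using cutoff unfolding dyadic_cutoff_def by (elim conjE)
  then have "(\<lambda>x. complex_of_real (chi x)) \<in> schwartz"
    by (intro schwartz_compact_support[where r = 2] smooth_of_real) (simp_all add: chi_zero)
  from schwartz_affine[OF this c] show ?thesis .
qed

lemma chi_scale_schwartz: "c \<noteq> 0 \<Longrightarrow> (\<lambda>x. complex_of_real (chi (c *\<^sub>R x))) \<in> schwartz"
  using chi_schwartz[of c 0] by simp

definition annulus :: "int \<Rightarrow> 'a \<Rightarrow> complex" where
  "annulus m \<xi> = of_real (annulus_fn chi ((2 powi (- m)) *\<^sub>R \<xi>))"

lemma annulus_schwartz: "annulus m \<in> schwartz"
proof -
  have "annulus m = (\<lambda>\<xi>. of_real (chi ((2 powi (- m)) *\<^sub>R \<xi>)) + (- 1) * of_real (chi ((2 * 2 powi (- m)) *\<^sub>R \<xi>)))"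
    by (simp add: annulus_def annulus_fn_def fun_eq_iff)
  then show ?thesis
    using chi_scale_schwartz[of "2 powi (- m)"] chi_scale_schwartz[of "2 * 2 powi (- m)"]
    by (simp only:) (intro schwartz_add schwartz_cmult; simp)
qed

lemma annulus_away: "annulus m \<in> schwartz_away (2 powi m / 2)"
proof -
  have "annulus m x = 0" if "norm x < 2 powi m / 2" for x
  proof -
    have "2 powi (- m) * norm x < 1 / 2"
      using that by (simp add: power_int_minus field_simps)
    then show ?thesis by (simp add: annulus_def annulus_fn_def chi_one_le)
  qed
  then show ?thesis using annulus_schwartz by (simp add: schwartz_away_def)
qed

text \<open>By duality the block acts on the test function: pairing a block of T with \<psi> means
  applying T to the Fourier transform of this function, which vanishes near 0.\<close>

definition block_test :: "int \<Rightarrow> ('a \<Rightarrow> complex) \<Rightarrow> 'a \<Rightarrow> complex" where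
  "block_test m \<psi> \<xi> = annulus m \<xi> * inv_fourier \<psi> \<xi>"

lemma dyadic_block_eq: "dyadic_block chi m T \<psi> = T (fourier (block_test m \<psi>))"
  by (simp add: dyadic_block_def fourier_multiplier_def inv_fourier_dist_def mult_dist_def fourier_dist_def
      block_test_def[abs_def] annulus_def)

lemma block_test_away:
  assumes "\<psi> \<in> schwartz"
  shows "block_test m \<psi> \<in> schwartz_away (2 powi m / 2)"
proof -
  have "block_test m \<psi> \<in> schwartz"
    unfolding block_test_def[abs_def] by (intro schwartz_mult annulus_schwartz inv_fourier_schwartz assms)
  then show ?thesis using annulus_away[of m] by (simp add: schwartz_away_def block_test_def)
qed

lemma block_test_fourier_schwartz: "\<psi> \<in> schwartz \<Longrightarrow> fourier (block_test m \<psi>) \<in> schwartz"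
  using block_test_away by (intro fourier_schwartz) (auto simp: schwartz_away_def)

text \<open>T and U differ by a polynomial, which the transform of
  \<open>block_test m \<psi>\<close> annihilates. This makes the arbitrary choice in
  \<open>rep_class\<close> harmless.\<close>

lemma dyadic_block_cong:
  assumes TU: "poly_rel T U" and \<psi>: "\<psi> \<in> schwartz"
  shows "dyadic_block chi m T \<psi> = dyadic_block chi m U \<psi>"
proof -
  obtain P where P: "polynomial_function P" "represents P (\<lambda>\<phi>. T \<phi> - U \<phi>)"
    using TU unfolding poly_rel_def by blast
  have "T (fourier (block_test m \<psi>)) - U (fourier (block_test m \<psi>)) = (LINT x|lborel. P x * fourier (block_test m \<psi>) x)"
    using P(2) block_test_fourier_schwartz[OF \<psi>] unfolding represents_def by blast
  also have "\<dots> = 0"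
    by (rule polynomial_fourier_away[OF P(1) block_test_away[OF \<psi>]]) simp
  finally show ?thesis by (simp add: dyadic_block_eq)
qed

definition block :: "int \<Rightarrow> 'a tempered_mod_poly \<Rightarrow> 'a functional" where
  "block m F = dyadic_block chi m (rep_class F)"

lemma block_class_of:
  "tempered T \<Longrightarrow> \<psi> \<in> schwartz \<Longrightarrow> block m (class_of T) \<psi> = T (fourier (block_test m \<psi>))"
  unfolding block_def dyadic_block_eq[symmetric] by (rule dyadic_block_cong[OF poly_rel_rep_class])

lemma block_add: "\<psi> \<in> schwartz \<Longrightarrow> block m (F + G) \<psi> = block m F \<psi> + block m G \<psi>"
  using dyadic_block_cong[OF poly_rel_rep_class_add[of F G], of \<psi> m] by (simp add: block_def dyadic_block_eq)

lemma block_zero: "\<psi> \<in> schwartz \<Longrightarrow> block m 0 \<psi> = 0"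
  using dyadic_block_cong[OF poly_rel_rep_class_zero, of \<psi> m] by (simp add: block_def dyadic_block_eq)

end

lemma represents_cong:
  "(\<And>\<psi>. \<psi> \<in> schwartz \<Longrightarrow> T \<psi> = U \<psi>) \<Longrightarrow> represents g T \<longleftrightarrow> represents g U"
  by (simp add: represents_def)

lemma represents_measurable: "represents g T \<Longrightarrow> g \<in> borel_measurable borel"
  by (simp add: represents_def)

text \<open>Bernstein's inequality in dual form: the test function is a dilation normalised in L^1,
  and passing from L^p to a pointwise value costs c^(d/p).\<close>

lemma represents_norm_le:
  fixes T :: "'a::euclidean_space functional"
  assumes p: "1 \<le> p" and g: "represents g T" "lp_le p g t" and t: "0 < t" and \<psi>: "\<psi> \<in> schwartz" and c: "0 < c"
    and wb: "\<And>x. norm (\<psi> x) \<le> M"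
  shows "norm (T (\<lambda>x. of_real (c ^ DIM('a)) * \<psi> (c *\<^sub>R x)))
    \<le> c powr (DIM('a) * inverse_exponent p) * t * ((LINT x|lborel. norm (\<psi> x)) + M)"
proof -
  let ?w = "\<lambda>x. of_real (c ^ DIM('a)) * \<psi> (c *\<^sub>R x)"
  note [measurable] = schwartz_measurable[OF \<psi>]
  have w: "?w \<in> schwartz" using schwartz_affine[OF \<psi>, of c 0] c by (intro schwartz_cmult) auto
  have I: "(LINT x|lborel. norm (?w x)) = (LINT x|lborel. norm (\<psi> x))"
    using integral_lborel_affine[of c "\<lambda>x. norm (\<psi> x)" 0] c by (simp add: norm_mult norm_power)
  have M: "0 \<le> M" using order_trans[OF norm_ge_zero wb] .
  have "T ?w = (LINT x|lborel. g x * ?w x)" using g(1) w unfolding represents_def by blast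
  then show ?thesis
    using lp_le_pairing[OF p represents_measurable[OF g(1)] g(2) t integrable_schwartz[OF w] _ c eq_refl[OF I] M]
      c wb by (simp add: norm_mult norm_power mult_left_mono)
qed

locale besov_setting = dyadic chi for chi :: "'a::euclidean_space \<Rightarrow> real" +
  fixes s :: real and p :: ereal
  assumes p: "1 \<le> p" and s: "DIM('a) * inverse_exponent p \<le> s"
begin

abbreviation bnorm :: "'a tempered_mod_poly \<Rightarrow> ennreal" where
  "bnorm \<equiv> besov_norm chi s p"

text \<open>The norm of a block is an infimum over representing functions, so a strict bound is what
  produces an actual g. For this reason later estimates take \<open>bnorm F < ennreal t\<close> as
  input.\<close>

lemma besov_normD:
  assumes F: "bnorm F < ennreal t" and t: "0 < t"
  obtains g where "represents g (block m F)" "lp_le p g (2 powr (- (of_int m * s)) * t)"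
proof -
  let ?a = "2 powr (of_int m * s)"
  let ?N = "lp_norm_dist p (block m F)"
  have "ennreal ?a * ?N \<le> bnorm F"
    unfolding besov_norm_def block_def by (rule SUP_upper) simp
  also note F
  finally have lt: "ennreal ?a * ?N < ennreal t" .
  have "?N < ennreal (2 powr (- (of_int m * s)) * t)"
  proof -
    have "?N = ennreal (2 powr (- (of_int m * s))) * (ennreal ?a * ?N)"
      by (simp add: mult.assoc[symmetric] powr_add[symmetric] flip: ennreal_mult)
    also have "\<dots> < ennreal (2 powr (- (of_int m * s))) * ennreal t"
      by (intro ennreal_mult_strict_left_mono lt) auto
    also have "\<dots> = ennreal (2 powr (- (of_int m * s)) * t)" using t by (simp add: ennreal_mult)
    finally show ?thesis .
  qed
  then obtain g where g: "represents g (block m F)" "lp_norm p g < ennreal (2 powr (- (of_int m * s)) * t)"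
    unfolding lp_norm_dist_def INF_less_iff by blast
  then show ?thesis
    using that lp_norm_le_iff[OF p represents_measurable[OF g(1)], of "2 powr (- (of_int m * s)) * t"] t
    by (simp add: less_imp_le)
qed

lemma besov_normI:
  assumes "\<And>m. \<exists>g. represents g (block m F) \<and> lp_le p g (2 powr (- (of_int m * s)) * t)" and t: "0 \<le> t"
  shows "bnorm F \<le> ennreal t"
  unfolding besov_norm_def block_def[symmetric]
proof (rule SUP_least)
  fix m
  obtain g where g: "represents g (block m F)" "lp_le p g (2 powr (- (of_int m * s)) * t)"
    using assms(1) by blast
  have "lp_norm_dist p (block m F) \<le> lp_norm p g"
    unfolding lp_norm_dist_def by (rule INF_lower) (use g in simp)
  also have "\<dots> \<le> ennreal (2 powr (- (of_int m * s)) * t)"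
    using g(2) t lp_norm_le_iff[OF p represents_measurable[OF g(1)]] by simp
  finally have "ennreal (2 powr (of_int m * s)) * lp_norm_dist p (block m F)
      \<le> ennreal (2 powr (of_int m * s)) * ennreal (2 powr (- (of_int m * s)) * t)"
    by (rule mult_left_mono) simp
  also have "\<dots> = ennreal t"
    using t by (simp add: mult.assoc[symmetric] powr_add[symmetric] flip: ennreal_mult)
  finally show "ennreal (2 powr (of_int m * s)) * lp_norm_dist p (block m F) \<le> ennreal t" .
qed

text \<open>The factor 4 is inherited from \<open>lp_le_add\<close>; the closure arguments below
  leave room for it.\<close>

lemma bnorm_add:
  assumes F: "bnorm F < ennreal t" and G: "bnorm G < ennreal u" and t: "0 < t" and u: "0 < u"
  shows "bnorm (F + G) \<le> ennreal (4 * (t + u))"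
proof (rule besov_normI)
  fix m
  obtain f where f: "represents f (block m F)" "lp_le p f (2 powr (- (of_int m * s)) * t)"
    using besov_normD[OF F t] .
  obtain g where g: "represents g (block m G)" "lp_le p g (2 powr (- (of_int m * s)) * u)"
    using besov_normD[OF G u] .
  have "represents (\<lambda>x. f x + g x) (block m (F + G))"
    using represents_add[OF f(1) g(1)] by (subst represents_cong[OF block_add])
  moreover have "lp_le p (\<lambda>x. f x + g x) (2 powr (- (of_int m * s)) * (4 * (t + u)))"
    using lp_le_add[OF p represents_measurable[OF f(1)] represents_measurable[OF g(1)] f(2) g(2)] t u
    by (simp add: algebra_simps)
  ultimately show "\<exists>h. represents h (block m (F + G)) \<and> lp_le p h (2 powr (- (of_int m * s)) * (4 * (t + u)))"
    by blast
qed (use t u in simp)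

lemma bnorm_zero: "bnorm 0 = 0"
proof -
  have "bnorm 0 \<le> ennreal 0"
  proof (rule besov_normI)
    show "\<exists>g. represents g (block m 0) \<and> lp_le p g (2 powr (- (of_int m * s)) * 0)" for m
      by (intro exI conjI, subst represents_cong[OF block_zero]) (auto intro: represents_0 lp_le_zero[OF p])
  qed simp
  then show ?thesis by simp
qed

end

subsection \<open>Evaluation functionals at low frequencies\<close>

lemma tempered_diff:
  assumes T: "tempered T" and f: "f \<in> schwartz" and g: "g \<in> schwartz"
  shows "T (\<lambda>x. f x + (- 1) * g x) = T f - T g"
proof -
  have "T (\<lambda>x. f x + (- 1) * g x) = T f + T (\<lambda>x. (- 1) * g x)"
    by (rule bspec[OF bspec[OF T[unfolded tempered_def, THEN conjunct1] f] schwartz_cmult[OF g]])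
  moreover have "T (\<lambda>x. (- 1) * g x) = (- 1) * T g"
    by (rule bspec[OF spec[OF T[unfolded tempered_def, THEN conjunct2, THEN conjunct1]] g])
  ultimately show ?thesis by simp
qed

context besov_setting
begin

text \<open>The cutoff chi(2^n \<xi>) equals 1 on the support of the annulus of order - (n + 1).
  Pairing that block with this function thus gives a meaning to its value at the origin.\<close>

definition test_function :: "nat \<Rightarrow> 'a \<Rightarrow> complex" where
  "test_function n = fourier (\<lambda>\<xi>. of_real (chi (2 ^ n *\<^sub>R \<xi>)))"

definition excess :: real where
  "excess = s - DIM('a) * inverse_exponent p"

lemma excess_nonneg: "0 \<le> excess"
  using s by (simp add: excess_def)

text \<open>Up to normalisation, the value at the origin of the block of order \<open>- (n + 1)\<close>.\<close>

definition low_value :: "nat \<Rightarrow> 'a tempered_mod_poly \<Rightarrow> complex" where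
  "low_value n F = of_real (2 powr (- (real (Suc n) * excess))) * block (- int (Suc n)) F (test_function n)"

lemma test_function_schwartz: "test_function n \<in> schwartz"
  unfolding test_function_def by (intro fourier_schwartz chi_scale_schwartz) simp

lemma block_test_test_function: "block_test (- int (Suc n)) (test_function n) = annulus (- int (Suc n))"
proof
  fix \<xi>
  have "inv_fourier (test_function n) \<xi> = of_real (chi (2 ^ n *\<^sub>R \<xi>))"
    unfolding test_function_def by (subst inv_fourier_fourier) (simp_all add: chi_scale_schwartz)
  moreover have "annulus (- int (Suc n)) \<xi> = 0" if "1 < norm (2 ^ n *\<^sub>R \<xi>)"
  proof -
    have e: "2 powi int (Suc n) = (2::real) * 2 ^ n" by (simp add: power_int_of_nat del: of_nat_Suc)
    have "2 < norm ((2 powi int (Suc n)) *\<^sub>R \<xi>)"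
      unfolding e using that by simp
    moreover from this have "2 < norm (2 *\<^sub>R (2 powi int (Suc n)) *\<^sub>R \<xi>)"
      unfolding norm_scaleR[of 2] by simp
    ultimately have "2 < norm ((2 powi int (Suc n)) *\<^sub>R \<xi>)" "2 < norm (2 *\<^sub>R (2 powi int (Suc n)) *\<^sub>R \<xi>)" .
    then show ?thesis unfolding annulus_def annulus_fn_def minus_minus by (simp only: chi_zero) simp
  qed
  ultimately show "block_test (- int (Suc n)) (test_function n) \<xi> = annulus (- int (Suc n)) \<xi>"
    unfolding block_test_def using chi_one_le[of "2 ^ n *\<^sub>R \<xi>"] by (cases "norm (2 ^ n *\<^sub>R \<xi>) \<le> 1") auto
qed

lemma low_value_class_of:
  "tempered T \<Longrightarrow> low_value n (class_of T) =
    of_real (2 powr (- (real (Suc n) * excess))) * T (fourier (annulus (- int (Suc n))))"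
  unfolding low_value_def
  by (simp only: block_class_of[OF _ test_function_schwartz] block_test_test_function)

lemma low_value_add: "low_value n (F + G) = low_value n F + low_value n G"
  by (simp add: low_value_def block_add test_function_schwartz distrib_left)

lemma low_value_zero: "low_value n 0 = 0"
  by (simp add: low_value_def block_zero test_function_schwartz)

lemma low_value_bounded:
  obtains M where "0 < M" "\<And>F t n. bnorm F < ennreal t \<Longrightarrow> 0 < t \<Longrightarrow> norm (low_value n F) \<le> M * t"
proof -
  let ?\<theta> = "\<lambda>\<xi>. complex_of_real (chi (1 *\<^sub>R \<xi>))"
  have \<theta>: "?\<theta> \<in> schwartz" by (rule chi_scale_schwartz) simp
  define \<psi> where "\<psi> = fourier ?\<theta>"
  have \<psi>: "\<psi> \<in> schwartz" unfolding \<psi>_def by (rule fourier_schwartz[OF \<theta>])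
  obtain C where C: "0 \<le> C" "\<And>x. (1 + norm x) ^ 0 * norm (\<psi> x) \<le> C"
    using schwartz_bound[OF \<psi>, where k = 0] by metis
  let ?d = "DIM('a) * inverse_exponent p"
  define K where "K = (LINT x|lborel. norm (\<psi> x)) + C"
  have K: "0 \<le> K" unfolding K_def using C by (simp add: integral_nonneg_AE)
  have tf: "test_function n = (\<lambda>x. of_real ((1 / 2 ^ n) ^ DIM('a)) * \<psi> ((1 / 2 ^ n) *\<^sub>R x))" for n
  proof
    fix x
    have "test_function n x = fourier (\<lambda>\<xi>. ?\<theta> (2 ^ n *\<^sub>R \<xi> + 0)) x" by (simp add: test_function_def)
    also have "\<dots> = (1 / \<bar>2 ^ n\<bar> ^ DIM('a)) *\<^sub>R (exp (\<i> * of_real (0 \<bullet> x / 2 ^ n)) * \<psi> (x /\<^sub>R 2 ^ n))"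
      unfolding \<psi>_def by (rule fourier_affine[OF _ schwartz_measurable[OF \<theta>]]) simp
    finally show "test_function n x = of_real ((1 / 2 ^ n) ^ DIM('a)) * \<psi> ((1 / 2 ^ n) *\<^sub>R x)"
      by (simp add: scaleR_conv_of_real inverse_eq_divide power_divide)
  qed
  have "norm (low_value n F) \<le> (2 powr ?d * K) * t" if F: "bnorm F < ennreal t" and t: "0 < t" for F t n
  proof -
    let ?m = "- int (Suc n)"
    let ?t = "2 powr (- (of_int ?m * s)) * t"
    obtain g where g: "represents g (block ?m F)" "lp_le p g ?t" using besov_normD[OF F t] .
    have "norm (block ?m F (test_function n)) \<le> (1 / 2 ^ n) powr ?d * ?t * K"
      unfolding tf K_def using represents_norm_le[OF p g _ \<psi>, of "1 / 2 ^ n" C] C t by simp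
    then have "norm (low_value n F) \<le> 2 powr (- (real (Suc n) * excess)) * ((1 / 2 ^ n) powr ?d * ?t * K)"
      by (simp add: low_value_def norm_mult mult_left_mono)
    also have "(1 / 2 ^ n) powr ?d = (2::real) powr (- (real n * ?d))"
      by (simp add: powr_divide powr_realpow[symmetric] powr_powr powr_minus_divide)
    also have "2 powr (- (real (Suc n) * excess)) * (2 powr (- (real n * ?d)) * ?t * K)
        = (2 powr (- (real (Suc n) * excess)) * 2 powr (- (real n * ?d)) * 2 powr (- (of_int ?m * s))) * K * t"
      by (simp only: mult_ac)
    \<comment> \<open>The exponents -(n + 1)(s - d/p), -n d/p and (n + 1) s add up to d/p, free of
      n.\<close>
    also have "2 powr (- (real (Suc n) * excess)) * 2 powr (- (real n * ?d)) * 2 powr (- (of_int ?m * s)) = 2 powr ?d"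
      unfolding powr_add[symmetric] by (simp add: excess_def algebra_simps)
    finally show ?thesis .
  qed
  \<comment> \<open>Adding 1 makes the constant strictly positive, so that it can be divided by
    later.\<close>
  moreover have "(2 powr ?d * K) * t \<le> (2 powr ?d * K + 1) * t" if "0 < t" for t
    using that by (intro mult_right_mono) auto
  moreover have "0 < 2 powr ?d * K + 1" using K by (simp add: add_nonneg_pos)
  ultimately show ?thesis using that order_trans by meson
qed

text \<open>A block of order - (n + 1) is the difference of the low-frequency cutoffs with \<lambda>
  = 2^(n+1) and \<lambda> = 2^(n+2), and both tend to 0 by definition of \<open>S'h\<close>. Here s
  >= d/p enters: it keeps the weight in \<open>low_value\<close> at most 1.\<close>

lemma low_value_S'h:
  assumes T: "T \<in> S'h chi"
  shows "(\<lambda>n. low_value n (class_of T)) \<longlonglongrightarrow> 0"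
proof -
  let ?chi = "\<lambda>\<xi>. complex_of_real (chi \<xi>)"
  have chi: "?chi \<in> schwartz" using chi_scale_schwartz[of 1] by simp
  have temp: "tempered T" using T by (simp add: S'h_def)
  let ?u = "\<lambda>t \<xi>. complex_of_real (chi (t *\<^sub>R \<xi>)) * ?chi \<xi>"
  have u: "?u t \<in> schwartz" if "t \<noteq> 0" for t
    by (intro schwartz_mult chi_scale_schwartz chi that)
  have "((\<lambda>t. T (fourier (?u t))) \<longlongrightarrow> 0) at_top"
    using T chi unfolding S'h_def by (auto simp: mult_dist_def fourier_dist_def)
  moreover have "filterlim (\<lambda>n. 2 ^ Suc n :: real) at_top sequentially"
    "filterlim (\<lambda>n. 2 ^ Suc (Suc n) :: real) at_top sequentially"
    by (rule filterlim_at_top_mono[OF filterlim_real_sequentially],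
        use of_nat_less_two_power[where 'a = real] in \<open>auto intro!: always_eventually less_imp_le less_trans[OF of_nat_less_two_power]\<close>)+
  ultimately have lim: "(\<lambda>n. T (fourier (?u (2 ^ Suc n)))) \<longlonglongrightarrow> 0" "(\<lambda>n. T (fourier (?u (2 ^ Suc (Suc n))))) \<longlonglongrightarrow> 0"
    using filterlim_compose[where f = "\<lambda>n. 2 ^ Suc n"] filterlim_compose[where f = "\<lambda>n. 2 ^ Suc (Suc n)"] by blast+
  have eq: "T (fourier (annulus (- int (Suc n)))) = T (fourier (?u (2 ^ Suc n))) - T (fourier (?u (2 ^ Suc (Suc n))))" for n
  proof -
    let ?v = "?u (2 ^ Suc n)" and ?w = "?u (2 ^ Suc (Suc n))"
    \<comment> \<open>The definition of \<open>S'h\<close> tests against a fixed function, here chi.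
      The extra factor is harmless: it is 1 on the unit ball, and outside that ball both dilated
      cutoffs vanish.\<close>
    have "annulus (- int (Suc n)) = (\<lambda>\<xi>. ?v \<xi> + (- 1) * ?w \<xi>)"
    proof
      fix \<xi>
      have e: "2 powi int (Suc n) = (2::real) ^ Suc n" by (simp only: power_int_of_nat)
      have r: "annulus (- int (Suc n)) \<xi> = of_real (chi (2 ^ Suc n *\<^sub>R \<xi>)) - of_real (chi (2 ^ Suc (Suc n) *\<^sub>R \<xi>))"
        unfolding annulus_def annulus_fn_def minus_minus e by simp
      show "annulus (- int (Suc n)) \<xi> = ?v \<xi> + (- 1) * ?w \<xi>"
      proof (cases "norm \<xi> \<le> 1")
        case True
        then show ?thesis unfolding r by (simp add: chi_one_le)
      next
        case False
        have "(1::real) \<le> 2 ^ n" by simp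
        then have "1 * 1 < 2 ^ n * norm \<xi>" using False by (intro mult_le_less_imp_less) auto
        moreover from this have "1 < 2 * (norm \<xi> * 2 ^ n)" unfolding mult.commute[of "2 ^ n"] by linarith
        ultimately have "2 < norm (2 ^ Suc n *\<^sub>R \<xi>)" "2 < norm (2 ^ Suc (Suc n) *\<^sub>R \<xi>)" by simp_all
        then show ?thesis unfolding r by (simp only: chi_zero) simp
      qed
    qed
    then have "fourier (annulus (- int (Suc n))) = (\<lambda>x. fourier ?v x + (- 1) * fourier ?w x)"
      using u by (simp only: fourier_cmult[symmetric]) (intro ext fourier_add integrable_schwartz schwartz_cmult; simp)
    moreover have "fourier ?v \<in> schwartz" "fourier ?w \<in> schwartz" by (intro fourier_schwartz u; simp)+
    ultimately show ?thesis using tempered_diff[OF temp] by (simp only:)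
  qed
  have lim0: "(\<lambda>n. T (fourier (annulus (- int (Suc n))))) \<longlonglongrightarrow> 0"
    unfolding eq using tendsto_diff[OF lim] by simp
  show ?thesis
  proof (rule Lim_null_comparison[OF always_eventually tendsto_norm_zero[OF lim0]], intro allI)
    fix n
    have "2 powr (- (real (Suc n) * excess)) \<le> 2 powr 0"
      using excess_nonneg by (intro powr_mono) auto
    then show "norm (low_value n (class_of T)) \<le> norm (T (fourier (annulus (- int (Suc n)))))"
      unfolding low_value_class_of[OF temp] norm_mult by (simp add: mult_left_le_one_le)
  qed
qed

subsection \<open>The closure of the low-frequency class\<close>

abbreviation Sh_closure :: "'a tempered_mod_poly set" where
  "Sh_closure \<equiv> besov_closure_Sh chi s p"

lemma besov_bound:
  assumes "F \<in> besov chi s p"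
  obtains t where "0 < t" "bnorm F < ennreal t"
proof -
  have "bnorm F < \<infinity>" using assms by (simp add: besov_def)
  then obtain r where "0 \<le> r" "bnorm F = ennreal r" by (cases "bnorm F") auto
  then show ?thesis using that[of "r + 1"] by (simp add: ennreal_less_iff)
qed

lemma besovI: "bnorm F \<le> ennreal t \<Longrightarrow> F \<in> besov chi s p"
  using le_less_trans[OF _ ennreal_less_top] by (simp add: besov_def)

lemma besov_add: "F \<in> besov chi s p \<Longrightarrow> G \<in> besov chi s p \<Longrightarrow> F + G \<in> besov chi s p"
  by (meson besov_bound besovI bnorm_add)

lemma besov_zero: "0 \<in> besov chi s p"
  by (simp add: besov_def bnorm_zero)

lemma Sh_subset_closure: "besov_Sh chi s p \<subseteq> Sh_closure"
  unfolding besov_closure_Sh_def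
  by (rule closure_of_subset) (auto simp: besov_Sh_def topspace_besov_topology)

text \<open>The bound in \<open>low_value_bounded\<close> is uniform in n, so convergence of the low
  values to 0 survives limits in the Besov norm: \<open>?D\<close> is closed and contains
  \<open>besov_Sh\<close>.\<close>

lemma low_value_closure:
  assumes "F \<in> Sh_closure"
  shows "(\<lambda>n. low_value n F) \<longlonglongrightarrow> 0"
proof -
  let ?X = "besov_topology chi s p"
  let ?D = "{F \<in> besov chi s p. (\<lambda>n. low_value n F) \<longlonglongrightarrow> 0}"
  obtain M where M: "0 < M" "\<And>F t n. bnorm F < ennreal t \<Longrightarrow> 0 < t \<Longrightarrow> norm (low_value n F) \<le> M * t"
    using low_value_bounded by blast
  have "openin ?X (topspace ?X - ?D)"
    unfolding openin_besov_topology topspace_besov_topology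
  proof (intro conjI ballI)
    fix F assume F: "F \<in> besov chi s p - ?D"
    then obtain e where e: "e > 0" "\<not> (\<forall>\<^sub>F n in sequentially. norm (low_value n F) < e)"
      by (auto simp: tendsto_iff)
    have "G \<in> besov chi s p - ?D" if G: "G \<in> besov chi s p" "bnorm (G - F) < ennreal (e / (2 * M))" for G
    proof (rule ccontr)
      assume "G \<notin> besov chi s p - ?D"
      then have "(\<lambda>n. low_value n G) \<longlonglongrightarrow> 0" using G by simp
      then have "\<forall>\<^sub>F n in sequentially. norm (low_value n G) < e / 2"
        using e(1) by (auto simp: tendsto_iff dest: spec[of _ "e / 2"])
      then have "\<forall>\<^sub>F n in sequentially. norm (low_value n F) < e"
      proof eventually_elim
        case (elim n)
        have "low_value n G = low_value n (G - F) + low_value n F"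
          using low_value_add[of n "G - F" F] by simp
        moreover have "norm (low_value n (G - F)) \<le> M * (e / (2 * M))"
          using e(1) M(1) by (intro M(2) G(2)) simp
        moreover have "M * (e / (2 * M)) = e / 2" using M(1) by simp
        ultimately show ?case
          using elim norm_triangle_ineq4[of "low_value n G" "low_value n (G - F)"] by simp
      qed
      then show False using e(2) by blast
    qed
    moreover have "e / (2 * M) > 0" using e(1) M(1) by simp
    ultimately show "\<exists>r>0. {G \<in> besov chi s p. bnorm (G - F) < ennreal r} \<subseteq> besov chi s p - ?D"
      by blast
  qed blast
  then have "closedin ?X ?D" by (auto simp: closedin_def topspace_besov_topology)
  moreover have "besov_Sh chi s p \<subseteq> ?D" using low_value_S'h by (auto simp: besov_Sh_def)
  ultimately have "Sh_closure \<subseteq> ?D" unfolding besov_closure_Sh_def by (rule closure_of_minimal[rotated])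
  then show ?thesis using assms by blast
qed

text \<open>The topology is defined through balls that have not been shown to be open, so the metric
  description of the closure is recovered from the quasi-triangle inequality
  \<open>bnorm_add\<close>.\<close>

lemma closure_iff:
  "F \<in> Sh_closure \<longleftrightarrow> F \<in> besov chi s p \<and> (\<forall>r>0. \<exists>G\<in>besov_Sh chi s p. bnorm (G - F) < ennreal r)"
proof
  let ?X = "besov_topology chi s p" and ?S = "besov_Sh chi s p"
  let ?D = "{F \<in> besov chi s p. \<forall>r>0. \<exists>G\<in>?S. bnorm (G - F) < ennreal r}"
  have "openin ?X (topspace ?X - ?D)"
    unfolding openin_besov_topology topspace_besov_topology
  proof (intro conjI ballI)
    fix F assume F: "F \<in> besov chi s p - ?D"
    then obtain r where r: "r > 0" "\<And>G. G \<in> ?S \<Longrightarrow> \<not> bnorm (G - F) < ennreal r" by auto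
    \<comment> \<open>Two errors below r/16 combine to at most 4 (r/16 + r/16) = r/2.\<close>
    have "H \<notin> ?D" if H: "bnorm (H - F) < ennreal (r / 16)" for H
    proof
      assume "H \<in> ?D"
      moreover have "r / 16 > 0" using r(1) by simp
      ultimately obtain G where G: "G \<in> ?S" "bnorm (G - H) < ennreal (r / 16)" by blast
      have "bnorm ((G - H) + (H - F)) \<le> ennreal (4 * (r / 16 + r / 16))"
        using r(1) by (intro bnorm_add G H) auto
      also have "\<dots> < ennreal r" using r(1) by (intro ennreal_lessI) auto
      finally show False using r(2)[OF G(1)] by simp
    qed
    then have "{G \<in> besov chi s p. bnorm (G - F) < ennreal (r / 16)} \<subseteq> besov chi s p - ?D" by blast
    moreover have "r / 16 > 0" using r(1) by simp
    ultimately show "\<exists>r>0. {G \<in> besov chi s p. bnorm (G - F) < ennreal r} \<subseteq> besov chi s p - ?D" by blast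
  qed blast
  then have c: "closedin ?X ?D" by (auto simp: closedin_def topspace_besov_topology)
  have "?S \<subseteq> ?D"
  proof
    fix F assume F: "F \<in> ?S"
    have "bnorm (F - F) < ennreal r" if "r > 0" for r using that bnorm_zero by simp
    then show "F \<in> ?D" using F unfolding besov_Sh_def by blast
  qed
  then have sub: "Sh_closure \<subseteq> ?D" unfolding besov_closure_Sh_def using c by (rule closure_of_minimal)
  show "F \<in> besov chi s p \<and> (\<forall>r>0. \<exists>G\<in>?S. bnorm (G - F) < ennreal r)" if "F \<in> Sh_closure"
    using that sub by blast
  assume F: "F \<in> besov chi s p \<and> (\<forall>r>0. \<exists>G\<in>?S. bnorm (G - F) < ennreal r)"
  show "F \<in> Sh_closure"
    unfolding besov_closure_Sh_def in_closure_of topspace_besov_topology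
  proof (intro conjI allI impI)
    fix U assume U: "F \<in> U \<and> openin ?X U"
    then obtain r where r: "r > 0" "{G \<in> besov chi s p. bnorm (G - F) < ennreal r} \<subseteq> U"
      unfolding openin_besov_topology by blast
    then obtain G where "G \<in> ?S" "bnorm (G - F) < ennreal r" using F by blast
    then show "\<exists>y. y \<in> ?S \<and> y \<in> U" using r(2) by (auto simp: besov_Sh_def)
  qed (use F in blast)
qed

lemma besov_Sh_add:
  assumes "F \<in> besov_Sh chi s p" "G \<in> besov_Sh chi s p"
  shows "F + G \<in> besov_Sh chi s p"
proof -
  obtain T U where T: "T \<in> S'h chi" "F = class_of T" and U: "U \<in> S'h chi" "G = class_of U"
    using assms by (auto simp: besov_Sh_def)
  have "(\<lambda>\<phi>. T \<phi> + U \<phi>) \<in> S'h chi"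
    using T(1) U(1) unfolding S'h_def
    by (auto simp: mult_dist_def fourier_dist_def intro: tempered_add tendsto_add_zero)
  moreover have "F + G = class_of (\<lambda>\<phi>. T \<phi> + U \<phi>)"
    using T U by (simp add: class_of_add S'h_def)
  ultimately have "F + G \<in> class_of ` S'h chi" by blast
  moreover have "F + G \<in> besov chi s p" using assms by (intro besov_add) (auto simp: besov_Sh_def)
  ultimately show ?thesis by (simp add: besov_Sh_def)
qed

text \<open>Used to add two decompositions componentwise, which makes the projection
  additive.\<close>

lemma closure_add:
  assumes F: "F \<in> Sh_closure" and G: "G \<in> Sh_closure"
  shows "F + G \<in> Sh_closure"
  unfolding closure_iff
proof (intro conjI allI impI)
  show "F + G \<in> besov chi s p" using F G closure_iff besov_add by blast
  fix r :: real assume r: "r > 0"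
  then have r16: "r / 16 > 0" by simp
  obtain F' where F': "F' \<in> besov_Sh chi s p" "bnorm (F' - F) < ennreal (r / 16)"
    using F r16 unfolding closure_iff by blast
  obtain G' where G': "G' \<in> besov_Sh chi s p" "bnorm (G' - G) < ennreal (r / 16)"
    using G r16 unfolding closure_iff by blast
  have "bnorm ((F' - F) + (G' - G)) \<le> ennreal (4 * (r / 16 + r / 16))"
    by (intro bnorm_add F' G' r16)
  also have "\<dots> < ennreal r" using r by (intro ennreal_lessI) auto
  finally have "bnorm ((F' + G') - (F + G)) < ennreal r" by (simp add: algebra_simps)
  then show "\<exists>H\<in>besov_Sh chi s p. bnorm (H - (F + G)) < ennreal r"
    using besov_Sh_add[OF F'(1) G'(1)] by blast
qed

lemma closure_zero: "0 \<in> Sh_closure"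
proof -
  have "(\<lambda>\<phi>. 0) \<in> S'h chi"
    by (simp add: S'h_def tempered_0 mult_dist_def fourier_dist_def)
  then have "0 \<in> besov_Sh chi s p"
    using besov_zero by (auto simp: besov_Sh_def zero_tempered_mod_poly.abs_eq)
  then show ?thesis using Sh_subset_closure by blast
qed

end

subsection \<open>Embedding bounded sequences\<close>

text \<open>On the shell 1 < |\<xi>| < 1 + \<delta> one has chi(\<xi>) = 1 and chi(2 \<xi>) = 0.
  Higher dyadic multiples meet only zeros of chi and lower ones only the value 1, so exactly one
  annulus function is nonzero there. The bump is a rescaled translate of chi.\<close>

lemma (in dyadic) bump_exists:
  obtains \<kappa> :: "'a \<Rightarrow> real" where "(\<lambda>\<xi>. complex_of_real (\<kappa> \<xi>)) \<in> schwartz" "\<And>\<xi>. 0 \<le> \<kappa> \<xi>"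
    "0 < (LINT \<xi>|lborel. \<kappa> \<xi>)" "\<And>\<xi>. \<kappa> \<xi> \<noteq> 0 \<Longrightarrow> 1 < norm \<xi>"
    "\<And>\<xi> j. \<kappa> \<xi> \<noteq> 0 \<Longrightarrow> annulus_fn chi ((2 powi j) *\<^sub>R \<xi>) = (if j = 0 then 1 else 0)"
proof -
  obtain \<delta> where \<delta>: "0 < \<delta>" "\<delta> \<le> 1" "\<And>x. norm x < 1 + \<delta> \<Longrightarrow> chi x = 1" using chi_one by blast
  obtain e :: 'a where e: "e \<in> Basis" by fastforce
  \<comment> \<open>chi(R (\<xi> - z)) lives within 2/R = \<delta>/4 of the point z of norm 1 +
    \<delta>/2, hence inside the shell.\<close>
  define R where "R = 8 / \<delta>"
  define z where "z = (1 + \<delta> / 2) *\<^sub>R e"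
  have R: "R > 0" using \<delta> by (simp add: R_def)
  have nz: "norm z = 1 + \<delta> / 2" using e \<delta> by (simp add: z_def)
  define \<kappa> where "\<kappa> \<xi> = chi (R *\<^sub>R \<xi> + (- R) *\<^sub>R z)" for \<xi>
  have arg: "R *\<^sub>R \<xi> + (- R) *\<^sub>R z = R *\<^sub>R (\<xi> - z)" for \<xi> by (simp add: scaleR_diff_right)
  have S: "(\<lambda>\<xi>. complex_of_real (\<kappa> \<xi>)) \<in> schwartz"
    unfolding \<kappa>_def by (rule chi_schwartz) (use R in simp)
  have supp: "1 < norm \<xi> \<and> norm \<xi> < 1 + \<delta>" if "\<kappa> \<xi> \<noteq> 0" for \<xi>
  proof -
    have "\<not> 2 < norm (R *\<^sub>R (\<xi> - z))" using that chi_zero unfolding \<kappa>_def arg by blast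
    then have "R * norm (\<xi> - z) \<le> 2" using R by simp
    then have "norm (\<xi> - z) \<le> \<delta> / 4" using \<delta>(1) by (simp add: R_def field_simps)
    moreover have "norm \<xi> \<le> norm z + norm (\<xi> - z)" using norm_triangle_ineq[of z "\<xi> - z"] by simp
    moreover have "norm z \<le> norm \<xi> + norm (\<xi> - z)" using norm_triangle_ineq4[of \<xi> "\<xi> - z"] by simp
    ultimately show ?thesis using nz \<delta>(1) by simp
  qed
  have "0 < measure lborel (ball z (1 / R))"
    using content_ball_pos[of "1 / R" z] R by simp
  also have "\<dots> = (LINT \<xi>|lborel. indicator (ball z (1 / R)) \<xi>)"
    by simp
  also have "\<dots> \<le> (LINT \<xi>|lborel. \<kappa> \<xi>)"
  proof (rule integral_mono)
    show "integrable lborel (indicator (ball z (1 / R)) :: 'a \<Rightarrow> real)"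
      using emeasure_lborel_ball_finite[of z "1 / R"] by (simp add: integrable_indicator_iff)
    have "integrable lborel (\<lambda>\<xi>. complex_of_real (\<kappa> \<xi>))" by (rule integrable_schwartz[OF S])
    then show "integrable lborel \<kappa>" by (simp add: complex_of_real_integrable_eq)
    show "indicator (ball z (1 / R)) \<xi> \<le> \<kappa> \<xi>" for \<xi>
    proof (cases "\<xi> \<in> ball z (1 / R)")
      case True
      then have "R * norm (\<xi> - z) \<le> 1" using R by (simp add: dist_norm norm_minus_commute field_simps)
      then have "norm (R *\<^sub>R (\<xi> - z)) \<le> 1" using R by simp
      then have "\<kappa> \<xi> = 1" unfolding \<kappa>_def arg by (rule chi_one_le)
      then show ?thesis by (simp add: indicator_def)
    next
      case False
      then show ?thesis using chi_nonneg by (simp add: \<kappa>_def)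
    qed
  qed
  finally have pos: "0 < (LINT \<xi>|lborel. \<kappa> \<xi>)" .
  have ann: "annulus_fn chi ((2 powi j) *\<^sub>R \<xi>) = (if j = 0 then 1 else 0)" if "\<kappa> \<xi> \<noteq> 0" for \<xi> j
  proof -
    have n: "1 < norm \<xi>" "norm \<xi> < 1 + \<delta>" using supp[OF that] by auto
    consider "j = 0" | "1 \<le> j" | "j \<le> -1" by linarith
    then show ?thesis
    proof cases
      case 1
      then show ?thesis using n by (simp add: annulus_fn_def \<delta>(3) chi_zero)
    next
      case 2
      then have "(2::real) powi 1 \<le> 2 powi j" by (intro power_int_increasing) auto
      then have "2 * 1 < 2 powi j * norm \<xi>" using n by (intro mult_le_less_imp_less) auto
      then have "2 < norm ((2 powi j) *\<^sub>R \<xi>)" by simp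
      moreover from this have "2 < norm (2 *\<^sub>R (2 powi j) *\<^sub>R \<xi>)" unfolding norm_scaleR[of 2] by simp
      ultimately show ?thesis using 2 unfolding annulus_fn_def by (simp only: chi_zero) simp
    next
      case 3
      then have "(2::real) powi j \<le> 2 powi (-1)" by (intro power_int_increasing) auto
      then have "2 * 2 powi j * norm \<xi> \<le> 1 * norm \<xi>" by (intro mult_right_mono) (auto simp: power_int_minus)
      then have "norm (2 *\<^sub>R (2 powi j) *\<^sub>R \<xi>) < 1 + \<delta>" using n by simp
      moreover from this have "norm ((2 powi j) *\<^sub>R \<xi>) < 1 + \<delta>"
        unfolding norm_scaleR[of 2] using norm_ge_zero[of "(2 powi j) *\<^sub>R \<xi>"] by linarith
      ultimately show ?thesis using 3 unfolding annulus_fn_def by (simp only: \<delta>(3)) simp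
    qed
  qed
  show ?thesis
    using that[of \<kappa>] S chi_nonneg pos supp ann by (auto simp: \<kappa>_def)
qed

section \<open>Polynomial moments and Taylor remainders\<close>

lemma polynomial_function_of_real:
  assumes "real_polynomial_function P"
  shows "polynomial_function (\<lambda>x. complex_of_real (P x))"
  unfolding polynomial_function_def
proof (intro allI impI)
  fix f :: "complex \<Rightarrow> real" assume "bounded_linear f"
  then interpret bounded_linear f .
  have "f (complex_of_real t) = t * f 1" for t
    using scaleR[of t 1] by (simp add: scaleR_conv_of_real)
  then have "f \<circ> (\<lambda>x. complex_of_real (P x)) = (\<lambda>x. P x * f 1)" by (simp add: o_def)
  then show "real_polynomial_function (f \<circ> (\<lambda>x. complex_of_real (P x)))"
    using assms by (auto intro: real_polynomial_function.intros)
qed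

lemma real_polynomial_function_inner: "real_polynomial_function (\<lambda>x. x \<bullet> y)"
  by (intro real_polynomial_function.intros(1) bounded_linear_inner_left)

lemma polynomial_function_inner_power: "polynomial_function (\<lambda>x. c * complex_of_real ((x \<bullet> y) ^ k))"
  by (intro polynomial_function_cmult polynomial_function_of_real real_polynomial_function_power
      real_polynomial_function_inner)

lemma polynomially_bounded_inner_power:
  "polynomially_bounded (\<lambda>\<xi>. complex_of_real (((x::'a::euclidean_space) \<bullet> \<xi>) ^ l))"
proof (rule polynomially_boundedI[of _ "norm x ^ l" l])
  fix \<xi>
  have "\<bar>x \<bullet> \<xi>\<bar> ^ l \<le> (norm x * norm \<xi>) ^ l" by (intro power_mono Cauchy_Schwarz_ineq2) auto
  also have "\<dots> \<le> (norm x * (1 + norm \<xi>)) ^ l" by (intro power_mono mult_left_mono) auto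
  finally show "norm (complex_of_real ((x \<bullet> \<xi>) ^ l)) \<le> norm x ^ l * (1 + norm \<xi>) ^ l"
    by (simp add: power_mult_distrib power_abs norm_power)
qed

lemma integrable_schwartz_inner_power:
  fixes g :: "'a::euclidean_space \<Rightarrow> complex"
  assumes "g \<in> schwartz"
  shows "integrable lborel (\<lambda>\<xi>. g \<xi> * complex_of_real ((x \<bullet> \<xi>) ^ l))"
  using integrable_poly_schwartz[OF _ polynomially_bounded_inner_power assms, of x l]
  by (simp add: mult.commute)

text \<open>Expanding one factor x . \<xi> in coordinates moves \<xi> . b into g, which stays
  Schwartz; the induction therefore runs over all g.\<close>

lemma polynomial_function_moment:
  fixes g :: "'a::euclidean_space \<Rightarrow> complex"
  assumes "g \<in> schwartz"
  shows "polynomial_function (\<lambda>x. LINT \<xi>|lborel. g \<xi> * complex_of_real ((x \<bullet> \<xi>) ^ l))"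
  using assms
proof (induction l arbitrary: g)
  case 0
  then show ?case by simp
next
  case (Suc l)
  let ?g = "\<lambda>b \<xi>. g \<xi> * of_real (\<xi> \<bullet> b)"
  have g: "?g b \<in> schwartz" for b by (intro schwartz_mult_moderate Suc.prems moderate_inner)
  have "(LINT \<xi>|lborel. g \<xi> * complex_of_real ((x \<bullet> \<xi>) ^ Suc l))
      = (\<Sum>b\<in>Basis. (x \<bullet> b) *\<^sub>R (LINT \<xi>|lborel. ?g b \<xi> * complex_of_real ((x \<bullet> \<xi>) ^ l)))" for x
  proof -
    have "g \<xi> * complex_of_real ((x \<bullet> \<xi>) ^ Suc l)
        = (\<Sum>b\<in>Basis. (x \<bullet> b) *\<^sub>R (?g b \<xi> * complex_of_real ((x \<bullet> \<xi>) ^ l)))" for \<xi>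
    proof -
      have "complex_of_real (x \<bullet> \<xi>) = (\<Sum>b\<in>Basis. of_real (x \<bullet> b) * of_real (\<xi> \<bullet> b))"
        by (subst euclidean_inner) simp
      then show ?thesis
        by (simp add: sum_distrib_left sum_distrib_right scaleR_conv_of_real mult_ac)
    qed
    then show ?thesis
      using integrable_schwartz_inner_power[OF g]
      by (simp only:) (subst Bochner_Integration.integral_sum; simp)
  qed
  then show ?case
    using Suc.IH[OF g] real_polynomial_function_inner
    by (auto intro!: polynomial_function_sum polynomial_function_mult simp: real_polynomial_function_eq)
qed

definition exp_remainder :: "nat \<Rightarrow> real \<Rightarrow> complex" where
  "exp_remainder N u = iexp u - (\<Sum>k\<le>N. (\<i> * u) ^ k / fact k)"

lemma exp_remainder_measurable [measurable]: "exp_remainder N \<in> borel_measurable borel"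
  unfolding exp_remainder_def[abs_def] by measurable

lemma norm_exp_remainder_le: "norm (exp_remainder N u) \<le> \<bar>u\<bar> ^ Suc N"
proof -
  have "norm (exp_remainder N u) \<le> \<bar>u\<bar> ^ Suc N / fact (Suc N)"
    unfolding exp_remainder_def by (rule iexp_approx1)
  also have "\<dots> \<le> \<bar>u\<bar> ^ Suc N"
  proof -
    have "\<bar>u\<bar> ^ Suc N / fact (Suc N) \<le> \<bar>u\<bar> ^ Suc N / 1" by (intro divide_left_mono fact_ge_1) auto
    then show ?thesis by simp
  qed
  finally show ?thesis .
qed

text \<open>Functionals carry arbitrary values off \<open>schwartz\<close>, so equality of classes
  has to be drawn from agreement on \<open>schwartz\<close> alone.\<close>

lemma class_of_eqI:
  assumes "tempered T" "tempered U" "\<And>\<phi>. \<phi> \<in> schwartz \<Longrightarrow> T \<phi> = U \<phi>"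
  shows "class_of T = class_of U"
proof (rule class_of_eq)
  have "represents (\<lambda>x. 0) (\<lambda>\<phi>. T \<phi> - U \<phi>)" using assms(3) by (simp add: represents_def)
  then show "poly_rel T U" using assms(1,2) unfolding poly_rel_def by (auto intro: exI[of _ "\<lambda>x. 0"])
qed

text \<open>\<kappa> is the bump of \<open>bump_exists\<close>. The Taylor order N is large enough
  for N + 1 powers of the scale to beat the growth with exponent \<open>excess\<close>.\<close>

locale besov_bump = besov_setting chi s p for chi :: "'a::euclidean_space \<Rightarrow> real" and s p +
  fixes \<kappa> :: "'a \<Rightarrow> real" and N :: nat
  assumes \<kappa>_schwartz: "(\<lambda>\<xi>. complex_of_real (\<kappa> \<xi>)) \<in> schwartz" and \<kappa>_nonneg: "0 \<le> \<kappa> \<xi>"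
    and \<kappa>_pos: "0 < (LINT \<xi>|lborel. \<kappa> \<xi>)" and \<kappa>_support: "\<kappa> \<xi> \<noteq> 0 \<Longrightarrow> 1 < norm \<xi>"
    and \<kappa>_annulus: "\<kappa> \<xi> \<noteq> 0 \<Longrightarrow> annulus_fn chi ((2 powi j) *\<^sub>R \<xi>) = (if j = 0 then 1 else 0)"
    and N: "excess < real (Suc N)"
begin

text \<open>The function h of the overview: the inverse Fourier transform of \<kappa> up to a power
  of 2 pi.\<close>

definition wave :: "'a \<Rightarrow> complex" where
  "wave y = (LINT \<xi>|lborel. of_real (\<kappa> \<xi>) * iexp (y \<bullet> \<xi>))"

text \<open>Subtracting the Taylor polynomial changes \<^term>\<open>wave\<close> only by a polynomial and makes the low-frequency
  series below converge.\<close>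

definition layer :: "'a \<Rightarrow> complex" where
  "layer y = (LINT \<xi>|lborel. of_real (\<kappa> \<xi>) * exp_remainder N (y \<bullet> \<xi>))"

text \<open>Index n stands for the dyadic order m = - (n + 1), so this is 2^m, and
  \<open>amplitude n\<close> below is 2^(-m \<sigma>), the reciprocal of the weight in
  \<open>low_value\<close>.\<close>

definition scale :: "nat \<Rightarrow> real" where
  "scale n = (1 / 2) ^ Suc n"

definition amplitude :: "nat \<Rightarrow> real" where
  "amplitude n = 2 powr (real (Suc n) * excess)"

definition low_series_term :: "(nat \<Rightarrow> real) \<Rightarrow> nat \<Rightarrow> 'a \<Rightarrow> complex" where
  "low_series_term a n x = of_real (a n * amplitude n) * layer (scale n *\<^sub>R x)"

definition low_series :: "(nat \<Rightarrow> real) \<Rightarrow> 'a \<Rightarrow> complex" where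
  "low_series a x = (\<Sum>n. low_series_term a n x)"

definition embed :: "(nat \<Rightarrow> real) \<Rightarrow> 'a tempered_mod_poly" where
  "embed a = class_of (distribution_of (low_series a))"

section \<open>Convergence of the low-frequency series\<close>

lemma scale_pos: "0 < scale n"
  by (simp add: scale_def)

lemma \<kappa>_measurable [measurable]: "\<kappa> \<in> borel_measurable borel"
  using measurable_compose[OF schwartz_measurable[OF \<kappa>_schwartz] borel_measurable_Re] by simp

lemma integrable_\<kappa>_moment: "integrable lborel (\<lambda>\<xi>. \<kappa> \<xi> * norm \<xi> ^ k)"
proof -
  have "polynomially_bounded (\<lambda>\<xi>::'a. complex_of_real (norm \<xi> ^ k))"
    by (rule polynomially_boundedI[of _ 1 k]) (simp add: norm_power power_mono)
  then have "integrable lborel (\<lambda>\<xi>. complex_of_real (norm \<xi> ^ k) * complex_of_real (\<kappa> \<xi>))"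
    by (intro integrable_poly_schwartz \<kappa>_schwartz) auto
  then have "integrable lborel (\<lambda>\<xi>. complex_of_real (norm \<xi> ^ k * \<kappa> \<xi>))" by simp
  then have "integrable lborel (\<lambda>\<xi>. norm \<xi> ^ k * \<kappa> \<xi>)" by (simp only: complex_of_real_integrable_eq)
  then show ?thesis by (simp add: mult.commute)
qed

lemma norm_exp_remainder_inner_le:
  "norm (complex_of_real (\<kappa> \<xi>) * exp_remainder N (y \<bullet> \<xi>)) \<le> norm y ^ Suc N * (\<kappa> \<xi> * norm \<xi> ^ Suc N)"
proof -
  have "norm (exp_remainder N (y \<bullet> \<xi>)) \<le> \<bar>y \<bullet> \<xi>\<bar> ^ Suc N" by (rule norm_exp_remainder_le)
  also have "\<dots> \<le> (norm y * norm \<xi>) ^ Suc N" by (intro power_mono Cauchy_Schwarz_ineq2) auto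
  finally have "\<kappa> \<xi> * norm (exp_remainder N (y \<bullet> \<xi>)) \<le> \<kappa> \<xi> * (norm y * norm \<xi>) ^ Suc N"
    using \<kappa>_nonneg by (rule mult_left_mono)
  then show ?thesis using \<kappa>_nonneg[of \<xi>] by (simp add: norm_mult power_mult_distrib mult_ac del: power_Suc)
qed

definition moment :: real where
  "moment = (LINT \<xi>|lborel. \<kappa> \<xi> * norm \<xi> ^ Suc N)"

lemma moment_nonneg: "0 \<le> moment"
  unfolding moment_def using \<kappa>_nonneg by (intro integral_nonneg_AE) auto

lemma integrable_layer: "integrable lborel (\<lambda>\<xi>. complex_of_real (\<kappa> \<xi>) * exp_remainder N (y \<bullet> \<xi>))"
proof (rule Bochner_Integration.integrable_bound)
  show "integrable lborel (\<lambda>\<xi>. norm y ^ Suc N * (\<kappa> \<xi> * norm \<xi> ^ Suc N))"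
    by (intro integrable_mult_right integrable_\<kappa>_moment)
  show "AE \<xi> in lborel. norm (complex_of_real (\<kappa> \<xi>) * exp_remainder N (y \<bullet> \<xi>)) \<le> norm (norm y ^ Suc N * (\<kappa> \<xi> * norm \<xi> ^ Suc N))"
    using order_trans[OF norm_exp_remainder_inner_le abs_ge_self] by (intro AE_I2) (simp only: real_norm_def)
qed measurable

lemma norm_layer_le: "norm (layer y) \<le> moment * norm y ^ Suc N"
proof -
  have "norm (layer y) \<le> (LINT \<xi>|lborel. norm y ^ Suc N * (\<kappa> \<xi> * norm \<xi> ^ Suc N))"
    unfolding layer_def
    by (rule Bochner_Integration.integral_norm_bound_integral[OF integrable_layer])
      (intro integrable_mult_right integrable_\<kappa>_moment norm_exp_remainder_inner_le)+
  then show ?thesis by (simp only: integral_mult_right_zero moment_def mult.commute)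
qed

lemma layer_measurable [measurable]: "layer \<in> borel_measurable borel"
  unfolding layer_def[abs_def] by measurable

definition ratio :: real where
  "ratio = 2 powr (excess - real (Suc N))"

lemma ratio: "0 < ratio" "ratio < 1"
  using N powr_less_mono[of "excess - real (Suc N)" 0 2] by (simp_all add: ratio_def)

text \<open>The growth 2^((n+1) \<sigma>) against the N + 1 powers of 2^(-(n+1)) gained from the
  Taylor remainder leaves a convergent geometric sequence.\<close>

lemma amplitude_scale: "amplitude n * scale n ^ Suc N = ratio ^ Suc n"
proof -
  have "scale n ^ Suc N = 2 powr (- (real (Suc n) * real (Suc N)))"
    by (simp only: scale_def power_one_over power_mult[symmetric] powr_minus of_nat_mult[symmetric] powr_realpow
        zero_less_numeral inverse_eq_divide mult.commute)
  then have "amplitude n * scale n ^ Suc N = 2 powr (real (Suc n) * excess + - (real (Suc n) * real (Suc N)))"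
    by (simp only: amplitude_def powr_add)
  also have "real (Suc n) * excess + - (real (Suc n) * real (Suc N)) = real (Suc n) * (excess - real (Suc N))"
    by (simp only: right_diff_distrib add_uminus_conv_diff)
  also have "2 powr \<dots> = ratio ^ Suc n"
    unfolding powr_realpow[OF ratio(1), symmetric] by (simp only: ratio_def powr_powr mult.commute)
  finally show ?thesis .
qed

lemma norm_low_series_term_le:
  assumes "\<And>n. \<bar>a n\<bar> \<le> A"
  shows "norm (low_series_term a n x) \<le> (A * moment * norm x ^ Suc N) * ratio ^ Suc n"
proof -
  have A: "0 \<le> A" using order_trans[OF abs_ge_zero assms] .
  have "norm (low_series_term a n x) = \<bar>a n\<bar> * (amplitude n * norm (layer (scale n *\<^sub>R x)))"
    by (simp add: low_series_term_def norm_mult amplitude_def)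
  also have "\<dots> \<le> A * (amplitude n * (moment * norm (scale n *\<^sub>R x) ^ Suc N))"
    using A by (intro mult_mono assms mult_left_mono norm_layer_le) (auto simp: amplitude_def)
  also have "\<dots> = (A * moment * norm x ^ Suc N) * (amplitude n * scale n ^ Suc N)"
    using scale_pos[of n] by (simp add: power_mult_distrib del: power_Suc)
  finally show ?thesis by (simp only: amplitude_scale)
qed

lemma ratio_summable: "summable (\<lambda>n. C * ratio ^ Suc n)"
  using ratio by (intro summable_mult) (subst summable_Suc_iff, simp add: summable_geometric)

lemma low_series_term_summable:
  assumes "\<And>n. \<bar>a n\<bar> \<le> A"
  shows "summable (\<lambda>n. norm (low_series_term a n x))"
  by (rule summable_comparison_test'[OF ratio_summable, where N = 0])
    (use norm_low_series_term_le[OF assms] in simp)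

lemma low_series_term_measurable [measurable]: "low_series_term a n \<in> borel_measurable borel"
  unfolding low_series_term_def[abs_def] by measurable

lemma low_series_measurable: "low_series a \<in> borel_measurable borel"
  unfolding low_series_def[abs_def] by measurable

lemma low_series_polynomially_bounded:
  assumes "\<And>n. \<bar>a n\<bar> \<le> A"
  shows "polynomially_bounded (low_series a)"
proof (rule polynomially_boundedI)
  fix x
  have A: "0 \<le> A" using order_trans[OF abs_ge_zero assms] .
  have "norm (low_series a x) \<le> (\<Sum>n. (A * moment * norm x ^ Suc N) * ratio ^ Suc n)"
    unfolding low_series_def by (rule norm_suminf_le[OF norm_low_series_term_le[OF assms] ratio_summable])
  also have "\<dots> = (A * moment * norm x ^ Suc N) * (\<Sum>n. ratio ^ Suc n)"
    using ratio_summable[of 1] by (intro suminf_mult) simp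
  also have "\<dots> = (A * moment * (\<Sum>n. ratio ^ Suc n)) * norm x ^ Suc N" by (simp only: mult_ac)
  also have "\<dots> \<le> (A * moment * (\<Sum>n. ratio ^ Suc n)) * (1 + norm x) ^ Suc N"
    using A moment_nonneg ratio ratio_summable[of 1]
    by (intro mult_left_mono power_mono mult_nonneg_nonneg suminf_nonneg) auto
  finally show "norm (low_series a x) \<le> (A * moment * (\<Sum>n. ratio ^ Suc n)) * (1 + norm x) ^ Suc N" .
qed

lemma tempered_low_series:
  assumes "\<And>n. \<bar>a n\<bar> \<le> A"
  shows "tempered (distribution_of (low_series a))"
  by (intro tempered_distribution_of low_series_measurable low_series_polynomially_bounded[OF assms])

text \<open>Sum and integral commute because the terms are dominated by |x|^(N+1) |\<phi>| times a
  geometric sequence.\<close>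

lemma distribution_of_low_series:
  assumes a: "\<And>n. \<bar>a n\<bar> \<le> A" and \<phi>: "\<phi> \<in> schwartz"
  shows "distribution_of (low_series a) \<phi> =
    (\<Sum>n. of_real (a n * amplitude n) * distribution_of (\<lambda>x. layer (scale n *\<^sub>R x)) \<phi>)"
proof -
  have A: "0 \<le> A" using order_trans[OF abs_ge_zero a] .
  note [measurable] = schwartz_measurable[OF \<phi>]
  have "polynomially_bounded (\<lambda>x::'a. complex_of_real (norm x ^ Suc N))"
    by (rule polynomially_boundedI[of _ 1 "Suc N"]) (simp add: norm_power power_mono del: power_Suc)
  then have i: "integrable lborel (\<lambda>x. complex_of_real (norm x ^ Suc N) * \<phi> x)"
    by (intro integrable_poly_schwartz \<phi>) auto
  have le: "norm (low_series_term a n x * \<phi> x) \<le> (A * moment * ratio ^ Suc n) * norm (complex_of_real (norm x ^ Suc N) * \<phi> x)" for n x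
  proof -
    have "norm (low_series_term a n x * \<phi> x) \<le> ((A * moment * norm x ^ Suc N) * ratio ^ Suc n) * norm (\<phi> x)"
      unfolding norm_mult[of "low_series_term a n x"] by (intro mult_right_mono norm_low_series_term_le a) auto
    also have "\<dots> = (A * moment * ratio ^ Suc n) * norm (complex_of_real (norm x ^ Suc N) * \<phi> x)"
      by (simp add: norm_mult norm_power mult_ac)
    finally show ?thesis .
  qed
  have it: "integrable lborel (\<lambda>x. low_series_term a n x * \<phi> x)" for n
  proof (rule Bochner_Integration.integrable_bound)
    show "integrable lborel (\<lambda>x. (A * moment * ratio ^ Suc n) * norm (complex_of_real (norm x ^ Suc N) * \<phi> x))"
      using i by (intro integrable_mult_right integrable_norm)
    show "AE x in lborel. norm (low_series_term a n x * \<phi> x) \<le> norm ((A * moment * ratio ^ Suc n) * norm (complex_of_real (norm x ^ Suc N) * \<phi> x))"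
      using order_trans[OF le abs_ge_self] by (intro AE_I2) (simp only: real_norm_def)
  qed measurable
  define J where "J = (LINT x|lborel. norm (complex_of_real (norm x ^ Suc N) * \<phi> x))"
  have "(LINT x|lborel. (\<Sum>n. low_series_term a n x * \<phi> x)) = (\<Sum>n. (LINT x|lborel. low_series_term a n x * \<phi> x))"
  proof (rule integral_suminf[OF it])
    show "AE x in lborel. summable (\<lambda>n. norm (low_series_term a n x * \<phi> x))"
      using low_series_term_summable[OF a] by (intro AE_I2) (simp add: norm_mult summable_mult2)
    show "summable (\<lambda>n. LINT x|lborel. norm (low_series_term a n x * \<phi> x))"
    proof (rule summable_comparison_test'[OF ratio_summable, where N = 0])
      fix n
      have "(LINT x|lborel. norm (low_series_term a n x * \<phi> x))
          \<le> (LINT x|lborel. (A * moment * ratio ^ Suc n) * norm (complex_of_real (norm x ^ Suc N) * \<phi> x))"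
        using le it i by (intro integral_mono integrable_mult_right integrable_norm) auto
      also have "\<dots> = (A * moment * J) * ratio ^ Suc n" by (simp only: integral_mult_right_zero J_def mult_ac)
      finally show "norm (LINT x|lborel. norm (low_series_term a n x * \<phi> x)) \<le> (A * moment * J) * ratio ^ Suc n"
        by (simp add: integral_nonneg_AE)
    qed
  qed
  moreover have "(\<Sum>n. low_series_term a n x * \<phi> x) = low_series a x * \<phi> x" for x
    unfolding low_series_def using summable_norm_cancel[OF low_series_term_summable[OF a]] by (rule suminf_mult2[symmetric])
  moreover have "(LINT x|lborel. low_series_term a n x * \<phi> x) = of_real (a n * amplitude n) * distribution_of (\<lambda>x. layer (scale n *\<^sub>R x)) \<phi>" for n
    unfolding low_series_term_def distribution_of_def mult.assoc integral_mult_right_zero ..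
  ultimately show ?thesis unfolding distribution_of_def[of "low_series a"] by (simp only:)
qed

section \<open>Pairings with test functions and the dyadic blocks of the series\<close>

lemma wave_eq: "wave y = fourier (\<lambda>\<xi>. of_real (\<kappa> \<xi>)) (- y)"
  unfolding wave_def fourier_def by (simp add: inner_commute mult_ac)

lemma wave_schwartz: "wave \<in> schwartz"
proof -
  have "(\<lambda>y. fourier (\<lambda>\<xi>. of_real (\<kappa> \<xi>)) ((-1) *\<^sub>R y + 0)) \<in> schwartz"
    by (rule schwartz_affine[OF fourier_schwartz[OF \<kappa>_schwartz]]) simp
  then show ?thesis unfolding wave_eq[abs_def] by simp
qed

lemma wave_scale_schwartz: "(\<lambda>x. wave (scale n *\<^sub>R x)) \<in> schwartz"
  using schwartz_affine[OF wave_schwartz, of "scale n" 0] scale_pos[of n] by simp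

text \<open>After Fubini the inner integral runs over x for fixed \<xi>. There the Taylor part is a
  polynomial in x, annihilated by the transform of u, and inversion evaluates the exponential
  part.\<close>

lemma layer_scale_pairing:
  assumes u: "u \<in> schwartz_away r" and r: "0 < r"
  shows "distribution_of (\<lambda>x. layer (scale n *\<^sub>R x)) (fourier u) =
    of_real ((2 * pi) ^ DIM('a)) * (LINT \<xi>|lborel. of_real (\<kappa> \<xi>) * u (scale n *\<^sub>R \<xi>))"
proof -
  have us: "u \<in> schwartz" using u by (simp add: schwartz_away_def)
  note F = fourier_schwartz[OF us]
  note [measurable] = schwartz_measurable[OF F]
  let ?k = "\<lambda>\<xi> x. of_real (\<kappa> \<xi>) * exp_remainder N ((scale n *\<^sub>R x) \<bullet> \<xi>) * fourier u x"
  have "polynomially_bounded (\<lambda>x::'a. complex_of_real (norm (scale n *\<^sub>R x) ^ Suc N))"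
  proof (rule polynomially_boundedI)
    fix x :: 'a
    have "norm (scale n *\<^sub>R x) \<le> scale n * (1 + norm x)" using scale_pos[of n] by simp
    then have "norm (scale n *\<^sub>R x) ^ Suc N \<le> (scale n * (1 + norm x)) ^ Suc N" by (intro power_mono) auto
    then show "norm (complex_of_real (norm (scale n *\<^sub>R x) ^ Suc N)) \<le> scale n ^ Suc N * (1 + norm x) ^ Suc N"
      by (simp only: norm_of_real power_mult_distrib abs_power_minus abs_of_nonneg norm_ge_zero zero_le_power)
  qed
  then have i: "integrable lborel (\<lambda>x. complex_of_real (norm (scale n *\<^sub>R x) ^ Suc N) * fourier u x)"
    by (intro integrable_poly_schwartz F) auto
  have "integrable (lborel \<Otimes>\<^sub>M lborel) (\<lambda>(\<xi>, x). ?k \<xi> x)"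
  proof (rule integrable_pair_dominated)
    show "integrable lborel (\<lambda>\<xi>. \<kappa> \<xi> * norm \<xi> ^ Suc N)" by (rule integrable_\<kappa>_moment)
    show "integrable lborel (\<lambda>x. norm (complex_of_real (norm (scale n *\<^sub>R x) ^ Suc N) * fourier u x))"
      using i by (rule integrable_norm)
    fix \<xi> x
    have "norm (?k \<xi> x) \<le> (norm (scale n *\<^sub>R x) ^ Suc N * (\<kappa> \<xi> * norm \<xi> ^ Suc N)) * norm (fourier u x)"
      unfolding norm_mult[of _ "fourier u x"] by (intro mult_right_mono norm_exp_remainder_inner_le) auto
    also have "\<dots> = (\<kappa> \<xi> * norm \<xi> ^ Suc N) * norm (complex_of_real (norm (scale n *\<^sub>R x) ^ Suc N) * fourier u x)"
      by (simp only: norm_mult norm_of_real abs_of_nonneg norm_ge_zero zero_le_power mult_ac)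
    finally show "norm (case (\<xi>, x) of (\<xi>, x) \<Rightarrow> ?k \<xi> x) \<le> (\<kappa> \<xi> * norm \<xi> ^ Suc N) * norm (complex_of_real (norm (scale n *\<^sub>R x) ^ Suc N) * fourier u x)"
      by simp
  qed measurable
  then have fub: "(LINT x|lborel. (LINT \<xi>|lborel. ?k \<xi> x)) = (LINT \<xi>|lborel. (LINT x|lborel. ?k \<xi> x))"
    by (rule lborel_pair.Fubini_integral)
  have outer: "(LINT \<xi>|lborel. ?k \<xi> x) = layer (scale n *\<^sub>R x) * fourier u x" for x
    unfolding layer_def by (rule integral_mult_left_zero)
  have inner: "(LINT x|lborel. ?k \<xi> x) = of_real ((2 * pi) ^ DIM('a)) * (of_real (\<kappa> \<xi>) * u (scale n *\<^sub>R \<xi>))" for \<xi>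
  proof -
    let ?P = "\<lambda>x. \<Sum>k\<le>N. (\<i> * complex_of_real ((scale n *\<^sub>R x) \<bullet> \<xi>)) ^ k / fact k"
    let ?e = "\<lambda>x. exp (\<i> * complex_of_real (x \<bullet> (scale n *\<^sub>R \<xi>)))"
    have sc: "(scale n *\<^sub>R x) \<bullet> \<xi> = x \<bullet> (scale n *\<^sub>R \<xi>)" for x by simp
    have P: "polynomial_function ?P"
    proof (rule polynomial_function_sum)
      fix k
      have "(\<i> * complex_of_real ((scale n *\<^sub>R x) \<bullet> \<xi>)) ^ k / fact k = (\<i> ^ k / fact k) * complex_of_real ((x \<bullet> (scale n *\<^sub>R \<xi>)) ^ k)" for x
        unfolding sc by (simp add: power_mult_distrib)
      then show "polynomial_function (\<lambda>x. (\<i> * complex_of_real ((scale n *\<^sub>R x) \<bullet> \<xi>)) ^ k / fact k)"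
        by (simp only: polynomial_function_inner_power)
    qed simp
    have ie: "integrable lborel (\<lambda>x. ?e x * fourier u x)"
      by (rule Bochner_Integration.integrable_bound[OF integrable_schwartz[OF F]])
        (auto simp: norm_mult)
    have ip: "integrable lborel (\<lambda>x. ?P x * fourier u x)"
    proof -
      have "(\<i> * complex_of_real ((scale n *\<^sub>R x) \<bullet> \<xi>)) ^ k / fact k * fourier u x
          = (\<i> ^ k / fact k) * (fourier u x * complex_of_real (((scale n *\<^sub>R \<xi>) \<bullet> x) ^ k))" for k x
        unfolding sc by (simp add: power_mult_distrib inner_commute)
      then show ?thesis
        unfolding sum_distrib_right
        by (simp only:) (intro Bochner_Integration.integrable_sum integrable_mult_right integrable_schwartz_inner_power F)
    qed
    have "(LINT x|lborel. ?k \<xi> x) = of_real (\<kappa> \<xi>) * (LINT x|lborel. exp_remainder N ((scale n *\<^sub>R x) \<bullet> \<xi>) * fourier u x)"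
      unfolding mult.assoc by (rule integral_mult_right_zero)
    also have "(LINT x|lborel. exp_remainder N ((scale n *\<^sub>R x) \<bullet> \<xi>) * fourier u x)
        = (LINT x|lborel. ?e x * fourier u x - ?P x * fourier u x)"
      unfolding exp_remainder_def left_diff_distrib sc ..
    also have "\<dots> = (LINT x|lborel. ?e x * fourier u x) - (LINT x|lborel. ?P x * fourier u x)"
      by (rule Bochner_Integration.integral_diff[OF ie ip])
    also have "(LINT x|lborel. ?P x * fourier u x) = 0" by (rule polynomial_fourier_away[OF P u r])
    also have "(LINT x|lborel. ?e x * fourier u x) = of_real ((2 * pi) ^ DIM('a)) * u (scale n *\<^sub>R \<xi>)"
      by (rule fourier_inversion[OF us])
    finally show ?thesis by (simp add: mult_ac)
  qed
  show ?thesis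
    using fub unfolding outer inner distribution_of_def integral_mult_right_zero .
qed

text \<open>Companion of \<open>layer_scale_pairing\<close>: comparing the right-hand sides shows
  that a block cannot tell a layer from the dilated wave it comes from.\<close>

lemma wave_scale_pairing:
  assumes \<psi>: "\<psi> \<in> schwartz"
  shows "distribution_of (\<lambda>x. wave (scale n *\<^sub>R x)) \<psi> =
    of_real ((2 * pi) ^ DIM('a)) * (LINT \<xi>|lborel. of_real (\<kappa> \<xi>) * inv_fourier \<psi> (scale n *\<^sub>R \<xi>))"
proof -
  note [measurable] = schwartz_measurable[OF \<psi>]
  let ?k = "\<lambda>\<xi> x. of_real (\<kappa> \<xi>) * iexp ((scale n *\<^sub>R x) \<bullet> \<xi>) * \<psi> x"
  have "integrable (lborel \<Otimes>\<^sub>M lborel) (\<lambda>(\<xi>, x). ?k \<xi> x)"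
  proof (rule integrable_pair_dominated)
    show "integrable lborel (\<lambda>\<xi>. norm (complex_of_real (\<kappa> \<xi>)))" "integrable lborel (\<lambda>x. norm (\<psi> x))"
      by (intro integrable_norm integrable_schwartz \<kappa>_schwartz \<psi>)+
  qed (auto simp: norm_mult)
  then have fub: "(LINT x|lborel. (LINT \<xi>|lborel. ?k \<xi> x)) = (LINT \<xi>|lborel. (LINT x|lborel. ?k \<xi> x))"
    by (rule lborel_pair.Fubini_integral)
  have outer: "(LINT \<xi>|lborel. ?k \<xi> x) = wave (scale n *\<^sub>R x) * \<psi> x" for x
    unfolding wave_def by (rule integral_mult_left_zero)
  have inner: "(LINT x|lborel. ?k \<xi> x) = of_real ((2 * pi) ^ DIM('a)) * (of_real (\<kappa> \<xi>) * inv_fourier \<psi> (scale n *\<^sub>R \<xi>))" for \<xi>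
  proof -
    have "(LINT x|lborel. ?k \<xi> x) = of_real (\<kappa> \<xi>) * (LINT x|lborel. iexp ((scale n *\<^sub>R x) \<bullet> \<xi>) * \<psi> x)"
      unfolding mult.assoc by (rule integral_mult_right_zero)
    also have "(LINT x|lborel. iexp ((scale n *\<^sub>R x) \<bullet> \<xi>) * \<psi> x) = of_real ((2 * pi) ^ DIM('a)) * inv_fourier \<psi> (scale n *\<^sub>R \<xi>)"
      unfolding inv_fourier_def by (simp add: inner_commute mult.assoc[symmetric] flip: of_real_mult)
    finally show ?thesis by (simp add: mult_ac)
  qed
  show ?thesis
    using fub unfolding outer inner distribution_of_def integral_mult_right_zero .
qed

text \<open>On the support of \<kappa> the annulus function is evaluated at 2^(-m - n - 1) \<xi>, so
  by \<open>\<kappa>_annulus\<close> layer n is visible to exactly one block.\<close>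

lemma annulus_scale: "of_real (\<kappa> \<xi>) * annulus m (scale n *\<^sub>R \<xi>) = (if m = - int (Suc n) then of_real (\<kappa> \<xi>) else 0)"
proof (cases "\<kappa> \<xi> = 0")
  case False
  have "scale n = 2 powi (- int (Suc n))"
    by (simp only: scale_def power_int_minus power_int_of_nat power_one_over inverse_eq_divide)
  then have "2 powi (- m) * scale n = 2 powi (- m - int (Suc n))"
  proof -
    have "(2::real) powi (- m + - int (Suc n)) = 2 powi (- m) * 2 powi (- int (Suc n))"
      by (rule power_int_add) simp
    then show ?thesis using \<open>scale n = _\<close> by (simp only: diff_conv_add_uminus)
  qed
  then show ?thesis
    using \<kappa>_annulus[OF False, of "- m - int (Suc n)"] by (auto simp: annulus_def)
qed simp

text \<open>The annulus factor of v kills all layers but one, so the series collapses. The cofactor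
  w stays free for two uses: \<open>inv_fourier \<psi>\<close> for the blocks and the constant 1 for
  \<open>low_value\<close>.\<close>

lemma low_series_fourier_pairing:
  assumes a: "\<And>n. \<bar>a n\<bar> \<le> A" and v: "v \<in> schwartz_away r" and r: "0 < r"
    and vm: "\<And>\<xi>. v \<xi> = annulus (- int (Suc k)) \<xi> * w \<xi>"
  shows "distribution_of (low_series a) (fourier v) =
    of_real (a k * amplitude k) * (of_real ((2 * pi) ^ DIM('a)) * (LINT \<xi>|lborel. of_real (\<kappa> \<xi>) * w (scale k *\<^sub>R \<xi>)))"
proof -
  let ?t = "\<lambda>n. of_real (a n * amplitude n) * distribution_of (\<lambda>x. layer (scale n *\<^sub>R x)) (fourier v)"
  have e: "(LINT \<xi>|lborel. of_real (\<kappa> \<xi>) * v (scale n *\<^sub>R \<xi>))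
      = (if n = k then (LINT \<xi>|lborel. of_real (\<kappa> \<xi>) * w (scale n *\<^sub>R \<xi>)) else 0)" for n
    unfolding vm mult.assoc[symmetric] annulus_scale by auto
  have "fourier v \<in> schwartz" using v by (intro fourier_schwartz) (simp add: schwartz_away_def)
  then have "distribution_of (low_series a) (fourier v) = (\<Sum>n. ?t n)" by (rule distribution_of_low_series[OF a])
  also have "\<dots> = (\<Sum>n\<in>{k}. ?t n)"
    by (rule suminf_finite) (auto simp: layer_scale_pairing[OF v r] e)
  also have "\<dots> = ?t k" by simp
  finally show ?thesis unfolding layer_scale_pairing[OF v r] e by simp
qed

lemma low_series_fourier_pairing_zero:
  assumes a: "\<And>n. \<bar>a n\<bar> \<le> A" and v: "v \<in> schwartz_away r" and r: "0 < r"
    and vm: "\<And>\<xi>. v \<xi> = annulus m \<xi> * w \<xi>" and m: "0 \<le> m"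
  shows "distribution_of (low_series a) (fourier v) = 0"
proof -
  have e: "(LINT \<xi>|lborel. of_real (\<kappa> \<xi>) * v (scale n *\<^sub>R \<xi>)) = 0" for n
    unfolding vm mult.assoc[symmetric] annulus_scale using m by auto
  have "fourier v \<in> schwartz" using v by (intro fourier_schwartz) (simp add: schwartz_away_def)
  from distribution_of_low_series[OF a this] show ?thesis by (simp add: layer_scale_pairing[OF v r] e)
qed

lemma block_embed:
  assumes a: "\<And>n. \<bar>a n\<bar> \<le> A" and \<psi>: "\<psi> \<in> schwartz"
  shows "block (- int (Suc k)) (embed a) \<psi> = distribution_of (\<lambda>x. of_real (a k * amplitude k) * wave (scale k *\<^sub>R x)) \<psi>"
proof -
  have "block (- int (Suc k)) (embed a) \<psi> = distribution_of (low_series a) (fourier (block_test (- int (Suc k)) \<psi>))"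
    unfolding embed_def by (rule block_class_of[OF tempered_low_series[OF a] \<psi>])
  also have "\<dots> = of_real (a k * amplitude k) * distribution_of (\<lambda>x. wave (scale k *\<^sub>R x)) \<psi>"
    unfolding wave_scale_pairing[OF \<psi>]
    by (rule low_series_fourier_pairing[OF a block_test_away[OF \<psi>]]) (auto simp: block_test_def)
  finally show ?thesis by (simp add: distribution_of_def mult.assoc)
qed

lemma block_embed_zero:
  assumes a: "\<And>n. \<bar>a n\<bar> \<le> A" and \<psi>: "\<psi> \<in> schwartz" and m: "0 \<le> m"
  shows "block m (embed a) \<psi> = 0"
proof -
  have "block m (embed a) \<psi> = distribution_of (low_series a) (fourier (block_test m \<psi>))"
    unfolding embed_def by (rule block_class_of[OF tempered_low_series[OF a] \<psi>])
  then show ?thesis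
    using low_series_fourier_pairing_zero[OF a block_test_away[OF \<psi>] _ block_test_def m] by simp
qed

lemma low_value_embed:
  assumes a: "\<And>n. \<bar>a n\<bar> \<le> A"
  shows "low_value k (embed a) = of_real ((2 * pi) ^ DIM('a) * (LINT \<xi>|lborel. \<kappa> \<xi>)) * of_real (a k)"
proof -
  have "distribution_of (low_series a) (fourier (annulus (- int (Suc k))))
      = of_real (a k * amplitude k) * (of_real ((2 * pi) ^ DIM('a)) * (LINT \<xi>|lborel. of_real (\<kappa> \<xi>) * 1))"
    by (rule low_series_fourier_pairing[OF a annulus_away]) auto
  moreover have "complex_of_real (2 powr (- (real (Suc k) * excess))) * of_real (amplitude k) = 1"
    unfolding amplitude_def of_real_mult[symmetric] powr_add[symmetric] by simp
  moreover have "b * (complex_of_real (x * y) * (c * (LINT \<xi>|lborel. of_real (\<kappa> \<xi>) * 1)))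
      = (b * of_real y) * (c * of_real (LINT \<xi>|lborel. \<kappa> \<xi>)) * of_real x" for b c x y
    by simp
  ultimately show ?thesis
    unfolding embed_def low_value_class_of[OF tempered_low_series[OF a]] by (simp only:) simp
qed

text \<open>Every block of negative order is a single dilated wave and the others vanish, so the
  supremum of |a| controls the norm: L^p scaling exactly compensates the Besov weight.\<close>

lemma bnorm_embed:
  obtains B where "0 \<le> B" "\<And>a A. (\<And>n. \<bar>a n\<bar> \<le> A) \<Longrightarrow> bnorm (embed a) \<le> ennreal (A * B)"
proof -
  obtain B where B: "0 \<le> B" "lp_le p wave B" using lp_le_schwartz[OF p wave_schwartz] by blast
  have "bnorm (embed a) \<le> ennreal (A * B)" if a: "\<And>n. \<bar>a n\<bar> \<le> A" for a A
  proof (rule besov_normI)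
    have A: "0 \<le> A" using order_trans[OF abs_ge_zero a] .
    then show "0 \<le> A * B" using B by simp
    fix m
    show "\<exists>g. represents g (block m (embed a)) \<and> lp_le p g (2 powr (- (of_int m * s)) * (A * B))"
    proof (cases "0 \<le> m")
      case True
      have "represents (\<lambda>x. 0) (block m (embed a))"
        by (subst represents_cong[OF block_embed_zero[OF a _ True]]) (auto intro: represents_0)
      then show ?thesis using lp_le_zero[OF p, of "2 powr (- (of_int m * s)) * (A * B)"] A B by auto
    next
      case False
      \<comment> \<open>Solves m = - (k + 1); since m < 0, the subtraction does not
        truncate.\<close>
      define k where "k = nat (- m) - 1"
      have m: "m = - int (Suc k)" using False by (simp add: k_def)
      let ?g = "\<lambda>x. complex_of_real (a k * amplitude k) * wave (scale k *\<^sub>R x)"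
      have gs: "?g \<in> schwartz" by (intro schwartz_cmult wave_scale_schwartz)
      have "represents ?g (block m (embed a))"
        unfolding m by (subst represents_cong[OF block_embed[OF a]])
          (auto intro!: represents_distribution_of schwartz_measurable moderate_polynomially_bounded
            subsetD[OF schwartz_subset_moderate] simp: gs simp del: of_real_mult)
      moreover have "lp_le p ?g (2 powr (- (of_int m * s)) * (A * B))"
      proof (rule lp_le_mono[OF p lp_le_scale[OF p schwartz_measurable[OF wave_schwartz] B(2) scale_pos B(1)]])
        let ?d = "DIM('a) * inverse_exponent p"
        have "scale k powr (- ?d) = 2 powr (real (Suc k) * ?d)"
        proof -
          have "scale k = 2 powr (- real (Suc k))"
            by (simp only: scale_def power_one_over powr_minus powr_realpow zero_less_numeral inverse_eq_divide)
          then show ?thesis by (simp only: powr_powr minus_mult_minus)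
        qed
        \<comment> \<open>The exponents (k + 1)(s - d/p) and (k + 1) d/p add up to (k + 1) s = - m
          s.\<close>
        then have "amplitude k * scale k powr (- ?d) = 2 powr (- (of_int m * s))"
          by (simp only: amplitude_def powr_add[symmetric] m excess_def) (simp add: algebra_simps)
        moreover have "norm (complex_of_real (a k * amplitude k)) = \<bar>a k\<bar> * amplitude k"
          by (simp add: norm_mult amplitude_def)
        ultimately have e: "norm (complex_of_real (a k * amplitude k)) * scale k powr (- ?d) * B = 2 powr (- (of_int m * s)) * (\<bar>a k\<bar> * B)"
          by (simp only: mult.assoc mult.left_commute)
        show "0 \<le> norm (complex_of_real (a k * amplitude k)) * scale k powr (- ?d) * B" using B by simp
        show "norm (complex_of_real (a k * amplitude k)) * scale k powr (- ?d) * B \<le> 2 powr (- (of_int m * s)) * (A * B)"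
          unfolding e using B a[of k] by (intro mult_left_mono mult_right_mono) auto
      qed
      ultimately show ?thesis by blast
    qed
  qed
  then show ?thesis using that B by blast
qed

lemma embed_in_besov: "(\<And>n. \<bar>a n\<bar> \<le> A) \<Longrightarrow> embed a \<in> besov chi s p"
  using bnorm_embed besovI by metis

lemma embed_add:
  assumes a: "\<And>n. \<bar>a n\<bar> \<le> A" and b: "\<And>n. \<bar>b n\<bar> \<le> B"
  shows "embed (\<lambda>n. a n + b n) = embed a + embed b"
proof -
  have ab: "\<bar>a n + b n\<bar> \<le> A + B" for n using a[of n] b[of n] by linarith
  note sa = summable_norm_cancel[OF low_series_term_summable[OF a]]
  note sb = summable_norm_cancel[OF low_series_term_summable[OF b]]
  have "low_series_term (\<lambda>n. a n + b n) n x = low_series_term a n x + low_series_term b n x" for n x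
    by (simp add: low_series_term_def distrib_right)
  then have f: "low_series (\<lambda>n. a n + b n) x = low_series a x + low_series b x" for x
    unfolding low_series_def by (simp add: suminf_add[OF sa sb])
  have "class_of (distribution_of (low_series (\<lambda>n. a n + b n)))
      = class_of (\<lambda>\<phi>. distribution_of (low_series a) \<phi> + distribution_of (low_series b) \<phi>)"
  proof (rule class_of_eqI)
    fix \<phi> :: "'a \<Rightarrow> complex" assume "\<phi> \<in> schwartz"
    then have "integrable lborel (\<lambda>x. low_series a x * \<phi> x)" "integrable lborel (\<lambda>x. low_series b x * \<phi> x)"
      by (intro integrable_poly_schwartz low_series_measurable low_series_polynomially_bounded[OF a] low_series_polynomially_bounded[OF b]; assumption)+
    then show "distribution_of (low_series (\<lambda>n. a n + b n)) \<phi> = distribution_of (low_series a) \<phi> + distribution_of (low_series b) \<phi>"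
      by (simp add: distribution_of_def f distrib_right)
  qed (intro tempered_add tempered_low_series[OF ab] tempered_low_series[OF a] tempered_low_series[OF b])+
  then show ?thesis
    unfolding embed_def by (simp add: class_of_add tempered_low_series[OF a] tempered_low_series[OF b])
qed

text \<open>\<kappa> vanishes on the unit ball, so cutting the spectrum of a dilated wave down to a
  small enough ball leaves exactly 0.\<close>

lemma wave_scale_S'h: "distribution_of (\<lambda>x. c * wave (scale n *\<^sub>R x)) \<in> S'h chi"
proof -
  let ?g = "\<lambda>x. c * wave (scale n *\<^sub>R x)"
  have gs: "?g \<in> schwartz" by (intro schwartz_cmult wave_scale_schwartz)
  then have "tempered (distribution_of ?g)"
    by (intro tempered_distribution_of schwartz_measurable moderate_polynomially_bounded subsetD[OF schwartz_subset_moderate])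
  moreover have "((\<lambda>t. mult_dist (\<lambda>\<xi>. chi (t *\<^sub>R \<xi>)) (fourier_dist (distribution_of ?g)) \<phi>) \<longlongrightarrow> 0) at_top"
    if \<phi>: "\<phi> \<in> schwartz" for \<phi>
  proof (rule tendsto_eventually)
    \<comment> \<open>Once t >= 2 / \<open>scale n\<close>, the cutoff is evaluated at norm greater
      than 2 wherever \<kappa> is nonzero, because there norm \<xi> > 1.\<close>
    show "\<forall>\<^sub>F t in at_top. mult_dist (\<lambda>\<xi>. chi (t *\<^sub>R \<xi>)) (fourier_dist (distribution_of ?g)) \<phi> = 0"
      using eventually_ge_at_top[of "2 / scale n"]
    proof eventually_elim
      case (elim t)
      then have t: "2 \<le> t * scale n" "0 < t"
        using scale_pos[of n] by (auto simp: field_simps intro: less_le_trans[of 0 "2 / scale n"])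
      let ?u = "\<lambda>\<xi>. complex_of_real (chi (t *\<^sub>R \<xi>)) * \<phi> \<xi>"
      have us: "?u \<in> schwartz" using t by (intro schwartz_mult chi_scale_schwartz \<phi>) auto
      have z: "of_real (\<kappa> \<xi>) * ?u (scale n *\<^sub>R \<xi>) = 0" for \<xi>
      proof (cases "\<kappa> \<xi> = 0")
        case False
        have "2 * 1 < (t * scale n) * norm \<xi>"
          using t \<kappa>_support[OF False] by (intro mult_le_less_imp_less) auto
        then have "2 < norm (t *\<^sub>R scale n *\<^sub>R \<xi>)" using t scale_pos[of n] by simp
        then show ?thesis by (simp only: chi_zero) simp
      qed simp
      have "mult_dist (\<lambda>\<xi>. chi (t *\<^sub>R \<xi>)) (fourier_dist (distribution_of ?g)) \<phi> = c * distribution_of (\<lambda>x. wave (scale n *\<^sub>R x)) (fourier ?u)"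
        by (simp add: mult_dist_def fourier_dist_def distribution_of_def mult.assoc)
      then show ?case
        unfolding wave_scale_pairing[OF fourier_schwartz[OF us]] inv_fourier_fourier[OF us] z by simp
    qed
  qed
  ultimately show ?thesis by (simp add: S'h_def)
qed

lemma wave_minus_layer: "wave y - layer y = (\<Sum>l\<le>N. (\<i> ^ l / fact l) * (LINT \<xi>|lborel. of_real (\<kappa> \<xi>) * complex_of_real ((y \<bullet> \<xi>) ^ l)))"
proof -
  let ?q = "\<lambda>l \<xi>. (\<i> ^ l / fact l) * (of_real (\<kappa> \<xi>) * complex_of_real ((y \<bullet> \<xi>) ^ l))"
  have iq: "integrable lborel (?q l)" for l
    by (intro integrable_mult_right integrable_schwartz_inner_power \<kappa>_schwartz)
  have "of_real (\<kappa> \<xi>) * iexp (y \<bullet> \<xi>) = of_real (\<kappa> \<xi>) * exp_remainder N (y \<bullet> \<xi>) + (\<Sum>l\<le>N. ?q l \<xi>)" for \<xi>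
    by (simp add: exp_remainder_def power_mult_distrib sum_distrib_left right_diff_distrib mult_ac)
  then have "wave y = layer y + (LINT \<xi>|lborel. (\<Sum>l\<le>N. ?q l \<xi>))"
    unfolding wave_def layer_def
    by (simp only:) (intro Bochner_Integration.integral_add integrable_layer Bochner_Integration.integrable_sum iq)
  also have "(LINT \<xi>|lborel. (\<Sum>l\<le>N. ?q l \<xi>)) = (\<Sum>l\<le>N. (LINT \<xi>|lborel. ?q l \<xi>))"
    by (intro Bochner_Integration.integral_sum iq)
  finally show ?thesis by (simp only: integral_mult_right_zero add_diff_cancel_left')
qed

text \<open>The subtracted Taylor part integrates to a combination of moments of \<kappa>, each
  polynomial in x.\<close>

lemma polynomial_function_wave_minus_layer: "polynomial_function (\<lambda>x. wave (c *\<^sub>R x) - layer (c *\<^sub>R x))"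
proof -
  have "wave (c *\<^sub>R x) - layer (c *\<^sub>R x) = (\<Sum>l\<le>N. (\<i> ^ l / fact l * of_real (c ^ l)) *
      (LINT \<xi>|lborel. of_real (\<kappa> \<xi>) * complex_of_real ((x \<bullet> \<xi>) ^ l)))" for x
  proof -
    have "(LINT \<xi>|lborel. of_real (\<kappa> \<xi>) * complex_of_real (((c *\<^sub>R x) \<bullet> \<xi>) ^ l))
        = of_real (c ^ l) * (LINT \<xi>|lborel. of_real (\<kappa> \<xi>) * complex_of_real ((x \<bullet> \<xi>) ^ l))" for l
      unfolding integral_mult_right_zero[symmetric]
      by (intro Bochner_Integration.integral_cong refl) (simp add: power_mult_distrib mult_ac)
    then show ?thesis unfolding wave_minus_layer by (simp only: mult.assoc)
  qed
  then show ?thesis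
    by (simp only:) (intro polynomial_function_sum polynomial_function_cmult polynomial_function_moment \<kappa>_schwartz finite_atMost)
qed

text \<open>A single layer equals a dilated wave modulo polynomials, and the wave is a
  representative in \<open>S'h chi\<close>. By additivity of the projection this covers all finite
  index sets.\<close>

lemma embed_single: "embed (\<lambda>n. if n = k then 1 else 0) \<in> Sh_closure"
proof -
  let ?a = "\<lambda>n. if n = k then 1 else 0 :: real"
  have a: "\<bar>?a n\<bar> \<le> 1" for n by simp
  let ?g = "\<lambda>x. complex_of_real (amplitude k) * wave (scale k *\<^sub>R x)"
  have S: "distribution_of ?g \<in> S'h chi" by (rule wave_scale_S'h)
  have gs: "?g \<in> schwartz" by (intro schwartz_cmult wave_scale_schwartz)
  have f: "low_series ?a x = of_real (amplitude k) * layer (scale k *\<^sub>R x)" for x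
  proof -
    have "low_series ?a x = (\<Sum>n\<in>{k}. low_series_term ?a n x)"
      unfolding low_series_def by (rule suminf_finite) (auto simp: low_series_term_def)
    then show ?thesis by (simp add: low_series_term_def)
  qed
  have "poly_rel (distribution_of ?g) (distribution_of (low_series ?a))"
    unfolding poly_rel_def
  proof (intro conjI exI)
    show "tempered (distribution_of ?g)" using S by (simp add: S'h_def)
    show "tempered (distribution_of (low_series ?a))" by (rule tempered_low_series[OF a])
    show "polynomial_function (\<lambda>x. of_real (amplitude k) * (wave (scale k *\<^sub>R x) - layer (scale k *\<^sub>R x)))"
      by (intro polynomial_function_cmult polynomial_function_wave_minus_layer)
    have "represents (\<lambda>x. ?g x + (- 1) * low_series ?a x) (\<lambda>\<phi>. distribution_of ?g \<phi> + (- 1) * distribution_of (low_series ?a) \<phi>)"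
      by (intro represents_add represents_cmult represents_distribution_of low_series_measurable low_series_polynomially_bounded[OF a]
          schwartz_measurable gs moderate_polynomially_bounded subsetD[OF schwartz_subset_moderate])
    then show "represents (\<lambda>x. of_real (amplitude k) * (wave (scale k *\<^sub>R x) - layer (scale k *\<^sub>R x)))
        (\<lambda>\<phi>. distribution_of ?g \<phi> - distribution_of (low_series ?a) \<phi>)"
      by (simp add: f right_diff_distrib)
  qed
  then have "embed ?a = class_of (distribution_of ?g)" unfolding embed_def by (rule class_of_eq[symmetric])
  then have "embed ?a \<in> besov_Sh chi s p" using S embed_in_besov[where a = ?a and A = 1] a by (auto simp: besov_Sh_def)
  then show ?thesis using Sh_subset_closure by blast
qed

end

subsection \<open>Finitely additive functions vanishing on finite sets\<close>

text \<open>D x collects codes of the dyadic truncations of the real number x. The precision k is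
  part of the code, which makes D x infinite; distinct reals share only finitely many
  truncations.\<close>

lemma almost_disjoint_family:
  obtains D :: "real \<Rightarrow> nat set" where "\<And>x. infinite (D x)" "\<And>x y. x \<noteq> y \<Longrightarrow> finite (D x \<inter> D y)"
proof -
  define c where "c x k = prod_encode (k, int_encode \<lfloor>2 ^ k * x\<rfloor>)" for x :: real and k
  have inj: "c x k = c y l \<longleftrightarrow> k = l \<and> \<lfloor>2 ^ k * x\<rfloor> = \<lfloor>2 ^ l * y\<rfloor>" for x y k l
    by (simp add: c_def prod_encode_eq int_encode_eq)
  have "infinite (range (c x))" for x
    by (intro range_inj_infinite) (auto simp: inj_on_def inj)
  moreover have "finite (range (c x) \<inter> range (c y))" if "x \<noteq> y" for x y
  proof -
    \<comment> \<open>From precision n on, 2^k x and 2^k y are more than 1 apart, so their floors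
      differ.\<close>
    obtain n where n: "1 / \<bar>x - y\<bar> < 2 ^ n" using real_arch_pow[of 2] by auto
    have "k < n" if "\<lfloor>2 ^ k * x\<rfloor> = \<lfloor>2 ^ k * y\<rfloor>" for k
    proof (rule ccontr)
      assume "\<not> k < n"
      then have "(2::real) ^ n \<le> 2 ^ k" by (intro power_increasing) auto
      with n have "1 / \<bar>x - y\<bar> < 2 ^ k" by (rule less_le_trans)
      then have "1 < 2 ^ k * \<bar>x - y\<bar>" using \<open>x \<noteq> y\<close> by (simp add: field_simps)
      also have "2 ^ k * \<bar>x - y\<bar> = \<bar>2 ^ k * x - 2 ^ k * y\<bar>"
        by (simp add: right_diff_distrib[symmetric] abs_mult)
      finally show False using that by linarith
    qed
    then have "range (c x) \<inter> range (c y) \<subseteq> c x ` {..<n}" using inj by auto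
    then show ?thesis by (rule finite_subset) simp
  qed
  ultimately show ?thesis using that[of "\<lambda>x. range (c x)"] by blast
qed

text \<open>Finite overlaps are null, so \<mu> is additive along finitely many members of the
  family. Infinitely many values beyond e in absolute value would contain N of one sign, whose union
  has mass at least N e > K.\<close>

lemma additive_real_null_countable:
  fixes \<mu> :: "nat set \<Rightarrow> real" and D :: "'i \<Rightarrow> nat set"
  assumes add: "\<And>A B. A \<inter> B = {} \<Longrightarrow> \<mu> (A \<union> B) = \<mu> A + \<mu> B"
    and bounded: "\<And>A. \<bar>\<mu> A\<bar> \<le> K" and fin: "\<And>A. finite A \<Longrightarrow> \<mu> A = 0"
    and D: "\<And>x y. x \<noteq> y \<Longrightarrow> finite (D x \<inter> D y)"
  shows "countable {x. \<mu> (D x) \<noteq> 0}"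
proof -
  have diff: "\<mu> (A - F) = \<mu> A" if "finite F" for A F
  proof -
    have "\<mu> ((A - F) \<union> (A \<inter> F)) = \<mu> (A - F) + \<mu> (A \<inter> F)" by (rule add) blast
    moreover have "(A - F) \<union> (A \<inter> F) = A" by blast
    ultimately show ?thesis using fin[of "A \<inter> F"] that by simp
  qed
  have union: "\<mu> (\<Union>x\<in>I. D x) = (\<Sum>x\<in>I. \<mu> (D x))" if "finite I" for I
    using that
  proof induction
    case empty
    then show ?case by (simp add: fin)
  next
    case (insert x I)
    have "finite (D x \<inter> (\<Union>y\<in>I. D y))"
    proof -
      have "D x \<inter> (\<Union>y\<in>I. D y) = (\<Union>y\<in>I. D x \<inter> D y)" by blast
      moreover have "finite \<dots>" using insert(1,2) by (intro finite_UN_I D) auto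
      ultimately show ?thesis by simp
    qed
    then have "\<mu> (D x - (D x \<inter> (\<Union>y\<in>I. D y))) = \<mu> (D x)" by (rule diff)
    moreover have "(\<Union>y\<in>insert x I. D y) = (D x - (D x \<inter> (\<Union>y\<in>I. D y))) \<union> (\<Union>y\<in>I. D y)" by blast
    moreover have "\<mu> ((D x - (D x \<inter> (\<Union>y\<in>I. D y))) \<union> (\<Union>y\<in>I. D y)) = \<mu> (D x - (D x \<inter> (\<Union>y\<in>I. D y))) + \<mu> (\<Union>y\<in>I. D y)"
      by (rule add) blast
    ultimately show ?case using insert by simp
  qed
  have small: "finite {x. \<bar>\<mu> (D x)\<bar> > e}" if e: "e > 0" for e
  proof (rule ccontr)
    assume "infinite {x. \<bar>\<mu> (D x)\<bar> > e}"
    moreover have "{x. \<bar>\<mu> (D x)\<bar> > e} = {x. \<mu> (D x) > e} \<union> {x. - \<mu> (D x) > e}" by (auto simp: abs_real_def)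
    ultimately have "infinite {x. \<mu> (D x) > e} \<or> infinite {x. - \<mu> (D x) > e}" by simp
    moreover obtain N where N: "K < real N * e" using reals_Archimedean3[OF e] by blast
    \<comment> \<open>The sign \<sigma> treats large positive and large negative values at
      once.\<close>
    have False if inf: "infinite {x. \<sigma> * \<mu> (D x) > e}" and \<sigma>: "\<bar>\<sigma>\<bar> = 1" for \<sigma>
    proof -
      obtain I where I: "finite I" "card I = N" "I \<subseteq> {x. \<sigma> * \<mu> (D x) > e}"
        using infinite_arbitrarily_large[OF inf] by metis
      have "real N * e = (\<Sum>x\<in>I. e)" using I by simp
      also have "\<dots> \<le> (\<Sum>x\<in>I. \<sigma> * \<mu> (D x))" using I(3) by (intro sum_mono) auto
      also have "\<dots> = \<sigma> * \<mu> (\<Union>x\<in>I. D x)" by (simp add: union[OF I(1)] sum_distrib_left)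
      also have "\<dots> \<le> \<bar>\<sigma>\<bar> * \<bar>\<mu> (\<Union>x\<in>I. D x)\<bar>" by (simp add: abs_mult[symmetric])
      also have "\<dots> \<le> K" using bounded \<sigma> by simp
      finally show False using N by simp
    qed
    from this[of 1] this[of "-1"] have "finite {x. \<mu> (D x) > e}" "finite {x. - \<mu> (D x) > e}" by auto
    ultimately show False by blast
  qed
  have "{x. \<mu> (D x) \<noteq> 0} \<subseteq> (\<Union>n. {x. \<bar>\<mu> (D x)\<bar> > inverse (real (Suc n))})"
  proof
    fix x assume "x \<in> {x. \<mu> (D x) \<noteq> 0}"
    then have "0 < \<bar>\<mu> (D x)\<bar>" by simp
    then obtain n where "inverse (real (Suc n)) < \<bar>\<mu> (D x)\<bar>" using reals_Archimedean by blast
    then show "x \<in> (\<Union>n. {x. \<bar>\<mu> (D x)\<bar> > inverse (real (Suc n))})" by blast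
  qed
  moreover have "countable (\<Union>n. {x. \<bar>\<mu> (D x)\<bar> > inverse (real (Suc n))})"
    by (intro countable_UN countableI_type countable_finite small positive_imp_inverse_positive) simp
  ultimately show ?thesis by (rule countable_subset)
qed

text \<open>Whitley's argument for the Phillips--Sobczyk theorem.\<close>

lemma additive_common_null_set:
  fixes \<mu> :: "nat \<Rightarrow> nat set \<Rightarrow> complex"
  assumes add: "\<And>n A B. A \<inter> B = {} \<Longrightarrow> \<mu> n (A \<union> B) = \<mu> n A + \<mu> n B"
    and bounded: "\<And>n. \<exists>K. \<forall>A. norm (\<mu> n A) \<le> K" and single: "\<And>n k. \<mu> n {k} = 0"
  obtains A where "infinite A" "\<And>n. \<mu> n A = 0"
proof -
  have empty: "\<mu> n {} = 0" for n using add[of "{}" "{}" n] by simp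
  have fin: "\<mu> n A = 0" if "finite A" for n A
    using that
  proof induction
    case (insert x A)
    then show ?case using add[of "{x}" A n] single by simp
  qed (rule empty)
  obtain D :: "real \<Rightarrow> nat set" where D: "\<And>x. infinite (D x)" "\<And>x y. x \<noteq> y \<Longrightarrow> finite (D x \<inter> D y)"
    using almost_disjoint_family by blast
  have c: "countable {x. \<mu> n (D x) \<noteq> 0}" for n
  proof -
    obtain K where K: "\<And>A. norm (\<mu> n A) \<le> K" using bounded by blast
    have "countable {x. Re (\<mu> n (D x)) \<noteq> 0}"
      by (rule additive_real_null_countable[where K = K])
        (use add fin D(2) order_trans[OF abs_Re_le_cmod K] in auto)
    moreover have "countable {x. Im (\<mu> n (D x)) \<noteq> 0}"
      by (rule additive_real_null_countable[where K = K])
        (use add fin D(2) order_trans[OF abs_Im_le_cmod K] in auto)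
    moreover have "{x. \<mu> n (D x) \<noteq> 0} = {x. Re (\<mu> n (D x)) \<noteq> 0} \<union> {x. Im (\<mu> n (D x)) \<noteq> 0}"
      by (auto simp: complex_eq_iff)
    ultimately show ?thesis by simp
  qed
  then have "countable (\<Union>n. {x. \<mu> n (D x) \<noteq> 0})" by (intro countable_UN) auto
  \<comment> \<open>Each n excludes only countably many real indices, so some index survives for all
    n simultaneously.\<close>
  then have "(\<Union>n. {x. \<mu> n (D x) \<noteq> 0}) \<noteq> UNIV" using uncountable_UNIV_real by metis
  then obtain x where "\<And>n. \<mu> n (D x) = 0" by blast
  then show ?thesis using that D(1) by blast
qed

subsection \<open>The main theorem\<close>

context besov_bump
begin

text \<open>Q kills finite sequences, so \<open>low_value n (Q (embed (indicator S)))\<close> is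
  bounded, additive in S and null on singletons. For an infinite S annihilated by all n, the low
  values of \<open>embed (indicator S)\<close> are those of its component in the closure and tend to
  0, yet they equal a fixed positive constant along S.\<close>

lemma not_complemented: "\<not> complemented_in (besov_topology chi s p) Sh_closure"
proof
  let ?X = "besov_topology chi s p" and ?C = "Sh_closure"
  assume "complemented_in ?X ?C"
  then obtain G where G: "tmp.subspace G" "G \<subseteq> besov chi s p" "topological_direct_sum ?X ?C G"
    unfolding complemented_in_def topspace_besov_topology by blast
  have ex: "\<exists>c g. c \<in> ?C \<and> g \<in> G \<and> F = c + g" if "F \<in> besov chi s p" for F
    using G(3) that unfolding topological_direct_sum_def topspace_besov_topology by blast
  obtain Q where Q: "continuous_map ?X ?X Q" "\<And>c g. c \<in> ?C \<Longrightarrow> g \<in> G \<Longrightarrow> Q (c + g) = g"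
    using G(3) unfolding topological_direct_sum_def by blast
  have G0: "0 \<in> G" using G(1) by (rule tmp.subspace_0)
  \<comment> \<open>The definition of a direct sum gives no additivity of Q; it follows by adding
    decompositions.\<close>
  have Qadd: "Q (F + H) = Q F + Q H" if FH: "F \<in> besov chi s p" "H \<in> besov chi s p" for F H
  proof -
    obtain c g c' g' where *: "c \<in> ?C" "g \<in> G" "F = c + g" "c' \<in> ?C" "g' \<in> G" "H = c' + g'"
      using ex[OF FH(1)] ex[OF FH(2)] by blast
    have "Q ((c + c') + (g + g')) = g + g'"
      using * by (intro Q(2) closure_add tmp.subspace_add[OF G(1)])
    moreover have "F + H = (c + c') + (g + g')" using * by (simp add: algebra_simps)
    moreover have "Q F = g" "Q H = g'" using * Q(2) by simp_all
    ultimately show ?thesis by (simp only:)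
  qed
  have QC: "Q F = 0" if "F \<in> ?C" for F using Q(2)[OF that G0] by simp
  obtain M where M: "0 < M" "\<And>F t n. bnorm F < ennreal t \<Longrightarrow> 0 < t \<Longrightarrow> norm (low_value n F) \<le> M * t"
    using low_value_bounded by blast
  obtain B where B: "0 \<le> B" "\<And>a A. (\<And>n. \<bar>a n\<bar> \<le> A) \<Longrightarrow> bnorm (embed a) \<le> ennreal (A * B)"
    using bnorm_embed by blast
  let ?L = "\<lambda>n a. low_value n (Q (embed a))"
  have Ladd: "?L n (\<lambda>k. a k + b k) = ?L n a + ?L n b"
    if ab: "\<And>k. \<bar>a k\<bar> \<le> A" "\<And>k. \<bar>b k\<bar> \<le> A'" for a b n A A'
    using embed_add[OF ab] Qadd[OF embed_in_besov[OF ab(1)] embed_in_besov[OF ab(2)]]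
    by (simp add: low_value_add)
  have ind: "\<bar>indicator S k\<bar> \<le> (1::real)" for S :: "nat set" and k by (simp add: indicator_def)
  let ?\<mu> = "\<lambda>n S. ?L n (indicator S)"
  \<comment> \<open>Continuity of Q is purely topological. A bound comes from the preimage under Q
    of the open set where |\<open>low_value n\<close>| < 1, which is a neighbourhood of 0.\<close>
  have bounded: "\<exists>K. \<forall>S. norm (?\<mu> n S) \<le> K" for n
  proof -
    have "openin ?X {F \<in> besov chi s p. norm (low_value n F) < 1}"
      unfolding openin_besov_topology
    proof (intro conjI ballI)
      fix F assume F: "F \<in> {F \<in> besov chi s p. norm (low_value n F) < 1}"
      define r where "r = (1 - norm (low_value n F)) / (2 * M)"
      have r: "r > 0" using F M(1) by (simp add: r_def)
      have "norm (low_value n H) < 1" if H: "bnorm (H - F) < ennreal r" for H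
      proof -
        have "low_value n H = low_value n (H - F) + low_value n F" using low_value_add[of n "H - F" F] by simp
        then have "norm (low_value n H) \<le> norm (low_value n (H - F)) + norm (low_value n F)"
          using norm_triangle_ineq by metis
        also have "\<dots> \<le> M * r + norm (low_value n F)" using M(2)[OF H r] by simp
        also have "M * r = (1 - norm (low_value n F)) / 2" using M(1) by (simp add: r_def)
        also have "(1 - norm (low_value n F)) / 2 + norm (low_value n F) < 1"
          using F by (simp add: field_simps)
        finally show ?thesis .
      qed
      then show "\<exists>r>0. {H \<in> besov chi s p. bnorm (H - F) < ennreal r} \<subseteq> {F \<in> besov chi s p. norm (low_value n F) < 1}"
        using r by blast
    qed blast
    then have "openin ?X {F \<in> topspace ?X. Q F \<in> {F \<in> besov chi s p. norm (low_value n F) < 1}}"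
      by (rule openin_continuous_map_preimage[OF Q(1)])
    moreover have "0 \<in> {F \<in> topspace ?X. Q F \<in> {F \<in> besov chi s p. norm (low_value n F) < 1}}"
      using besov_zero QC[OF closure_zero] by (simp add: topspace_besov_topology low_value_zero)
    ultimately obtain \<delta> where \<delta>: "\<delta> > 0" "{H \<in> besov chi s p. bnorm (H - 0) < ennreal \<delta>}
        \<subseteq> {F \<in> topspace ?X. Q F \<in> {F \<in> besov chi s p. norm (low_value n F) < 1}}"
      unfolding openin_besov_topology by blast
    \<comment> \<open>Dividing an indicator by N moves its image into the neighbourhood of 0;
      additivity then multiplies the bound 1 back by N, uniformly in S.\<close>
    obtain N where N: "B < real N * \<delta>" using reals_Archimedean3[OF \<delta>(1)] by blast
    then have N0: "N > 0" using B(1) by (cases N) auto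
    have "norm (?\<mu> n S) \<le> real N" for S
    proof -
      let ?a = "\<lambda>k. indicator S k / real N"
      have a: "\<bar>?a k\<bar> \<le> 1 / real N" for k using ind[of S k] N0 by (simp add: divide_right_mono)
      have "bnorm (embed ?a) \<le> ennreal (1 / real N * B)" using a by (rule B(2))
      also have "\<dots> < ennreal \<delta>" using N N0 \<delta>(1) by (intro ennreal_lessI) (auto simp: field_simps)
      finally have "norm (?L n ?a) < 1" using \<delta>(2) embed_in_besov[where a = ?a, OF a] by auto
      moreover have "?L n (\<lambda>k. real j * ?a k) = of_nat j * ?L n ?a" for j
      proof (induction j)
        case 0
        have "?L n (\<lambda>k. 0 + 0) = ?L n (\<lambda>k. 0) + ?L n (\<lambda>k. 0)" by (rule Ladd[where A = 0 and A' = 0]) auto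
        then show ?case by simp
      next
        case (Suc j)
        have "\<bar>real j * ?a k\<bar> \<le> real j * (1 / real N)" for k
          unfolding abs_mult using a[of k] by (intro mult_mono) auto
        from Ladd[OF this a] Suc show ?case by (simp add: distrib_right add.commute add_divide_distrib)
      qed
      from this[of N] have "?\<mu> n S = of_nat N * ?L n ?a" using N0 by simp
      ultimately show ?thesis using N0 by (simp add: norm_mult mult_left_le)
    qed
    then show ?thesis by blast
  qed
  have add: "?\<mu> n (S \<union> T) = ?\<mu> n S + ?\<mu> n T" if "S \<inter> T = {}" for n S T
  proof -
    have "indicator (S \<union> T) = (\<lambda>k. indicator S k + (indicator T k :: real))"
      using that by (auto simp: indicator_def fun_eq_iff)
    then show ?thesis using Ladd[OF ind ind] by simp
  qed
  have single: "?\<mu> n {k} = 0" for n k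
  proof -
    have "indicator {k} = (\<lambda>n. if n = k then 1 else 0 :: real)" by (auto simp: indicator_def)
    then show ?thesis using QC[OF embed_single[of k]] by (simp add: low_value_zero)
  qed
  obtain S where S: "infinite S" "\<And>n. ?\<mu> n S = 0"
    using additive_common_null_set[of ?\<mu>, OF add bounded single] by blast
  let ?F = "embed (indicator S)"
  obtain c g where cg: "c \<in> ?C" "g \<in> G" "?F = c + g" using ex[OF embed_in_besov[where a = "indicator S", OF ind]] by blast
  have "low_value n g = 0" for n using S(2)[of n] Q(2)[OF cg(1,2)] cg(3) by simp
  then have "low_value n ?F = low_value n c" for n using cg(3) by (simp add: low_value_add)
  then have lim: "(\<lambda>n. low_value n ?F) \<longlonglongrightarrow> 0" using low_value_closure[OF cg(1)] by simp
  \<comment> \<open>The factor with which \<open>low_value\<close> recovers a sequence from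
    \<open>embed\<close>, positive because \<kappa> has positive integral.\<close>
  define K where "K = (2 * pi) ^ DIM('a) * (LINT \<xi>|lborel. \<kappa> \<xi>)"
  have K: "K > 0" unfolding K_def using \<kappa>_pos by simp
  have "\<forall>\<^sub>F n in sequentially. norm (low_value n ?F) < K"
    using tendstoD[OF lim K] by simp
  then obtain m where m: "\<And>n. n \<ge> m \<Longrightarrow> norm (low_value n ?F) < K"
    unfolding eventually_sequentially by blast
  obtain n where n: "n \<in> S" "n \<ge> m" using S(1) infinite_nat_iff_unbounded_le by blast
  have "low_value n ?F = of_real K"
    using low_value_embed[where a = "indicator S" and k = n, OF ind] n(1) by (simp add: K_def)
  then show False using m[OF n(2)] K by simp
qed

end

theorem theorem17:
  fixes chi :: "'a::euclidean_space \<Rightarrow> real" and s :: real and p :: ereal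
  assumes "dyadic_cutoff chi"
    and "1 \<le> p"
    and "ereal (real DIM('a)) / p \<le> ereal s"
  shows "\<not> complemented_in (besov_topology chi s p) (besov_closure_Sh chi s p)"
proof -
  have "DIM('a) * inverse_exponent p \<le> s"
    using assms(2)
  proof (cases rule: ereal_exponent_cases)
    case 1
    then show ?thesis using assms(3) by (simp add: inverse_exponent_def zero_ereal_def)
  next
    case (2 q)
    then show ?thesis using assms(3) by (simp add: inverse_exponent_def)
  qed
  then interpret besov_setting chi s p
    using assms(1,2) by unfold_locales
  obtain \<kappa> :: "'a \<Rightarrow> real" where \<kappa>: "(\<lambda>\<xi>. complex_of_real (\<kappa> \<xi>)) \<in> schwartz" "\<And>\<xi>. 0 \<le> \<kappa> \<xi>"
    "0 < (LINT \<xi>|lborel. \<kappa> \<xi>)" "\<And>\<xi>. \<kappa> \<xi> \<noteq> 0 \<Longrightarrow> 1 < norm \<xi>"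
    "\<And>\<xi> j. \<kappa> \<xi> \<noteq> 0 \<Longrightarrow> annulus_fn chi ((2 powi j) *\<^sub>R \<xi>) = (if j = 0 then 1 else 0)"
    using bump_exists by blast
  obtain N where "excess < real N" using reals_Archimedean2 by blast
  then have "excess < real (Suc N)" by simp
  with \<kappa> interpret besov_bump chi s p \<kappa> N by unfold_locales
  show ?thesis by (rule not_complemented)
qed

end
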